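(* Let $a,b,c$ be points in $\mathbb{C}^2$ which do not lie on a complex line, such that $\Lambda(a,b)$ meets $\mathbb{B}$, such that if one of the points $a,b$ lies in $\mathbb{B}$ and the other in $\mathbb{C}^2\setminus\overline{\mathbb{B}}$ then $\langle a|b\rangle\neq 1$, and such that at least one of the numbers $\langle a|c\rangle$, $\langle b|c\rangle$ is different from $1$. Then $\mathcal{L}(a)\cup\mathcal{L}(b)\cup\mathcal{L}(c)$ is a test family for holomorphic extendibility for $C(b\mathbb{B})$; that is, if $f\in C(b\mathbb{B})$ extends holomorphically into $\mathbb{B}$ along each complex line $L\in\mathcal{L}(a)\cup\mathcal{L}(b)\cup\mathcal{L}(c)$, then $f$ extends holomorphically through $\mathbb{B}$.
   Context: $\mathbb{B}$ is the open unit ball in $\mathbb{C}^2$, $b\mathbb{B}$ its boundary (the unit sphere), $\overline{\mathbb{B}}$ its closure, and $C(b\mathbb{B})$ is the space of continuous complex-valued functions on $b\mathbb{B}$. $\langle a|b\rangle=a_1\overline{b_1}+a_2\overline{b_2}$ is the standard Hermitian inner product on $\mathbb{C}^2$. For $a\in\mathbb{C}^2$, $\mathcal{L}(a)$ is the family of all complex lines (complex affine lines) in $\mathbb{C}^2$ passing through $a$. For $a\neq b$, $\Lambda(a,b)$ is the complex line passing through $a$ and $b$. A function $f\in C(b\mathbb{B})$ extends holomorphically into $\mathbb{B}$ along a complex line $L$ if the restriction of $f$ to $L\cap b\mathbb{B}$ extends to a continuous function on $L\cap\overline{\mathbb{B}}$ that is holomorphic on $L\cap\mathbb{B}$ (this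 is vacuous if $L$ does not meet $\mathbb{B}$). It extends holomorphically through $\mathbb{B}$ if it extends to a continuous function on $\overline{\mathbb{B}}$ that is holomorphic on $\mathbb{B}$. *)

theory Defs
  imports "HOL-Complex_Analysis.Complex_Analysis"
begin

(* The norm on complex^2 is the Euclidean one, so ball 0 1, sphere 0 1 and cball 0 1
   are the open unit ball, the unit sphere and the closed unit ball of C^2. *)

definition hermitian_inner :: "complex ^ 2 \<Rightarrow> complex ^ 2 \<Rightarrow> complex" where
  "hermitian_inner a b = a $ 1 * cnj (b $ 1) + a $ 2 * cnj (b $ 2)"

definition line_at :: "complex ^ 2 \<Rightarrow> complex ^ 2 \<Rightarrow> (complex ^ 2) set" where
  "line_at p v = range (\<lambda>t::complex. p + t *s v)"

definition complex_line :: "(complex ^ 2) set \<Rightarrow> bool" where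
  "complex_line L \<longleftrightarrow> (\<exists>p v. v \<noteq> 0 \<and> L = line_at p v)"

definition lines_through :: "complex ^ 2 \<Rightarrow> (complex ^ 2) set set" where
  "lines_through a = {L. complex_line L \<and> a \<in> L}"

(* A complex line only if a \<noteq> b. *)
definition line_join :: "complex ^ 2 \<Rightarrow> complex ^ 2 \<Rightarrow> (complex ^ 2) set" where
  "line_join a b = line_at a (b - a)"

(* For open S: real Frechet differentiability with complex-linear derivative. *)
definition vec_holomorphic_on :: "(complex ^ 2 \<Rightarrow> complex) \<Rightarrow> (complex ^ 2) set \<Rightarrow> bool" where
  "vec_holomorphic_on f S \<longleftrightarrow>
     (\<forall>z\<in>S. \<exists>D. (f has_derivative D) (at z) \<and> (\<forall>c v. D (c *s v) = c * D v))"

(* For a complex line L and U open in C^2: holomorphy on the Riemann surface L \<inter> U, expressed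
   in affine coordinates of L. These differ by affine bijections of C, so all parametrizations
   impose the same condition. *)
definition line_holomorphic_on ::
    "(complex ^ 2 \<Rightarrow> complex) \<Rightarrow> (complex ^ 2) set \<Rightarrow> (complex ^ 2) set \<Rightarrow> bool" where
  "line_holomorphic_on g L U \<longleftrightarrow>
     (\<forall>p v. v \<noteq> 0 \<and> L = line_at p v \<longrightarrow>
        (\<lambda>t. g (p + t *s v)) holomorphic_on {t. p + t *s v \<in> U})"

definition extends_holomorphically_along ::
    "(complex ^ 2 \<Rightarrow> complex) \<Rightarrow> (complex ^ 2) set \<Rightarrow> bool" where
  "extends_holomorphically_along f L \<longleftrightarrow>
     (\<exists>g. continuous_on (L \<inter> cball 0 1) g \<and>
          line_holomorphic_on g L (ball 0 1) \<and>
          (\<forall>z \<in> L \<inter> sphere 0 1. g z = f z))"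

definition extends_holomorphically_through_ball :: "(complex ^ 2 \<Rightarrow> complex) \<Rightarrow> bool" where
  "extends_holomorphically_through_ball f \<longleftrightarrow>
     (\<exists>g. continuous_on (cball 0 1) g \<and>
          vec_holomorphic_on g (ball 0 1) \<and>
          (\<forall>z \<in> sphere 0 1. g z = f z))"

definition holomorphic_test_family :: "(complex ^ 2) set set \<Rightarrow> bool" where
  "holomorphic_test_family F \<longleftrightarrow>
     (\<forall>f. continuous_on (sphere 0 1) f \<and> (\<forall>L\<in>F. extends_holomorphically_along f L)
        \<longrightarrow> extends_holomorphically_through_ball f)"

end

theory Submission
  imports Defs
begin

text \<open>
  Work on functions \<open>F\<close> of pairs of complex numbers, and let \<open>pencil_ext F x\<close> say that \<open>F\<close> extends
  along all complex lines through \<open>x\<close>.  The engine of the proof is \<open>two_pencils_third\<close>: extension along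
  the lines through two points \<open>a\<close>, \<open>b\<close> implies extension along the lines through every point \<open>p\<close> of the
  ball that lies on the line joining \<open>a\<close> and \<open>b\<close> and satisfies
  \<open>Im ((1 - \<langle>a|b\<rangle>) (1 - \<langle>b|p\<rangle>) (1 - \<langle>p|a\<rangle>)) \<noteq> 0\<close>.  A projective automorphism of the ball carries complex
  lines to complex lines and changes this triple product by a positive factor only, so one may take
  \<open>p = 0\<close>, \<open>a = (\<alpha>, 0)\<close>, \<open>b = (\<beta>, 0)\<close>, where the condition reads \<open>Im (\<alpha> * cnj \<beta>) \<noteq> 0\<close>.

  In that position the slices of the sphere by lines through \<open>(\<alpha>, 0)\<close> project to circles in the unit
  disc, with centre \<open>s * \<alpha>\<close> and radius \<open>sqrt ((1 - s) (1 - s * (norm \<alpha>)\<^sup>2))\<close>.  These circles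
  are nested and fill the disc, so area integrals over the disc can be computed along them, for \<open>\<alpha>\<close> and
  for \<open>\<beta>\<close> alike (\<open>pencil_area_independent\<close>).  Let \<open>\<psi> z\<close> be a Fourier coefficient of \<open>F\<close> on the circle of
  the sphere above \<open>z\<close>, times a power of \<open>cnj z\<close>, and let \<open>\<mu> m\<close> be the area integral of \<open>\<psi> z * z ^ m\<close>.  By
  Cauchy's theorem on the lines through \<open>(\<alpha>, 0)\<close>, only boundedly many Fourier modes of \<open>\<psi>\<close> on each of
  the circles matter, and the generating function of the \<open>\<mu> m\<close> becomes an integral of
  \<open>A q s * \<xi> ^ q / (1 - s * \<alpha> * \<xi>) ^ (q + 1)\<close>: it continues holomorphically to the complement of the ray
  on which \<open>\<alpha> * \<xi> \<ge> 1\<close>, with polynomial growth away from it.  Because \<open>\<alpha>\<close> and \<open>\<beta>\<close> give different rays,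
  the generating function is an entire function of polynomial growth, and all \<open>\<mu> m\<close> with large \<open>m\<close>
  vanish (\<open>two_ray_coefficients_vanish\<close>).  This relation between Fourier modes of \<open>F\<close>, together with its
  transport by automorphisms of the ball that preserve the first coordinate axis, removes all the modes
  that could obstruct extension along the lines through the origin (\<open>two_pencils_centre\<close>).

  The hypotheses on \<open>a\<close>, \<open>b\<close>, \<open>c\<close> make this step usable often enough.  They imply \<open>\<langle>a|b\<rangle> \<noteq> 1\<close>, and then
  the points \<open>p\<close> admissible for \<open>a\<close>, \<open>b\<close> are dense in the line through \<open>a\<close> and \<open>b\<close> (\<open>tri_dense\<close>).
  Joining such a \<open>p\<close> with \<open>\<langle>p|c\<rangle> \<noteq> 1\<close> to \<open>c\<close>, and letting \<open>p\<close> vary, yields an open set of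
  points of the ball through which all lines are good; any further point of the ball is collinear
  with two points of this open set.  So \<open>F\<close> extends along every line that meets the ball
  (\<open>three_pencils_everywhere\<close>).

  Finally, the Fourier coefficients of \<open>F\<close> over the tori \<open>norm z = r\<close>, \<open>norm w = sqrt (1 - r\<^sup>2)\<close>, weighted
  by \<open>z powi a * w powi b\<close>, are constant in \<open>r\<close>: along a suitable line the coefficient is a function on
  the unit circle that is invariant under conjugation and has a one-sided spectrum.  Letting \<open>r\<close> tend to \<open>0\<close> or \<open>1\<close> shows that
  they vanish whenever \<open>a > 0\<close> or \<open>b > 0\<close>, so only the modes of holomorphic polynomials survive
  (\<open>torus_coeff_structure\<close>), and a convolution with a positive kernel shows that \<open>F\<close> is a uniform limit of
  polynomials on the sphere (\<open>sphere_polynomial_approx\<close>).  By the maximum principle and Cauchy's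
  estimates the polynomials converge, with their derivatives, to the desired extension
  (\<open>sphere_limit_extends\<close>).
\<close>

section \<open>Integrals over the unit circle\<close>

definition circle_int :: "(complex \<Rightarrow> complex) \<Rightarrow> complex" where
  "circle_int g = integral {0..2*pi} (\<lambda>t. g (cis t))"

lemma continuous_on_cis_comp:
  assumes "continuous_on (sphere 0 1) g"
  shows "continuous_on A (\<lambda>t. g (cis t))"
  by (rule continuous_on_compose2[OF assms]) (auto intro!: continuous_intros)

lemma circle_int_integrable:
  fixes g :: "complex \<Rightarrow> complex"
  assumes "continuous_on (sphere 0 1) g"
  shows "(\<lambda>t. g (cis t)) integrable_on {0..2*pi}"
  by (rule integrable_continuous_real[OF continuous_on_cis_comp[OF assms]])

lemma circle_int_cong:
  assumes "\<And>u. norm u = 1 \<Longrightarrow> f u = g u"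
  shows "circle_int f = circle_int g"
  unfolding circle_int_def by (rule integral_cong) (simp add: assms)

lemma circle_int_add:
  assumes "continuous_on (sphere 0 1) f" "continuous_on (sphere 0 1) g"
  shows "circle_int (\<lambda>u. f u + g u) = circle_int f + circle_int g"
  unfolding circle_int_def using assms by (intro integral_add circle_int_integrable)

lemma circle_int_diff:
  assumes "continuous_on (sphere 0 1) f" "continuous_on (sphere 0 1) g"
  shows "circle_int (\<lambda>u. f u - g u) = circle_int f - circle_int g"
  unfolding circle_int_def using assms by (intro integral_diff circle_int_integrable)

lemma circle_int_cmult: "circle_int (\<lambda>u. c * f u) = c * circle_int f"
  unfolding circle_int_def by simp

lemma circle_int_multc: "circle_int (\<lambda>u. f u * c) = circle_int f * c"
  unfolding circle_int_def by simp

lemma circle_int_const [simp]: "circle_int (\<lambda>u. c) = of_real (2 * pi) * c"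
  unfolding circle_int_def by (simp add: scaleR_conv_of_real)

lemma circle_int_sum:
  assumes "finite I" "\<And>i. i \<in> I \<Longrightarrow> continuous_on (sphere 0 1) (f i)"
  shows "circle_int (\<lambda>u. \<Sum>i\<in>I. f i u) = (\<Sum>i\<in>I. circle_int (f i))"
  unfolding circle_int_def using assms by (intro integral_sum circle_int_integrable) auto

lemma circle_int_bound:
  assumes "continuous_on (sphere 0 1) g" "\<And>u. norm u = 1 \<Longrightarrow> norm (g u) \<le> B"
  shows "norm (circle_int g) \<le> 2 * pi * B"
proof -
  have "norm (integral {0..2*pi} (\<lambda>t. g (cis t))) \<le> B * (2*pi - 0)"
    by (rule integral_bound) (auto intro!: continuous_on_cis_comp assms)
  then show ?thesis by (simp add: circle_int_def mult_ac)
qed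

lemma continuous_on_circle_int:
  fixes H :: "'a::topological_space \<Rightarrow> complex \<Rightarrow> complex"
  assumes "continuous_on (U \<times> sphere 0 1) (\<lambda>(x, u). H x u)"
  shows "continuous_on U (\<lambda>x. circle_int (H x))"
proof -
  have "continuous_on (U \<times> cbox 0 (2*pi)) (\<lambda>(x, t). H x (cis t))"
    unfolding split_beta
    by (rule continuous_on_compose2[OF assms[unfolded split_beta],
          where f="\<lambda>p. (fst p, cis (snd p))", simplified])
       (auto intro!: continuous_intros)
  then show ?thesis
    unfolding circle_int_def by (metis integral_continuous_on_param cbox_interval)
qed

lemma circle_int_swap:
  assumes "continuous_on (sphere 0 1 \<times> sphere 0 1) (\<lambda>(u, v). H u v)"
  shows "circle_int (\<lambda>u. circle_int (\<lambda>v. H u v)) = circle_int (\<lambda>v. circle_int (\<lambda>u. H u v))"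
proof -
  have "continuous_on (cbox (0, 0) (2*pi, 2*pi)) (\<lambda>(s, t). H (cis s) (cis t))"
    unfolding split_beta
    by (rule continuous_on_compose2[OF assms[unfolded split_beta],
          where f="\<lambda>p. (cis (fst p), cis (snd p))", simplified])
       (auto intro!: continuous_intros)
  from integral_swap_continuous[OF this] show ?thesis
    by (simp add: circle_int_def cbox_interval)
qed

lemma circle_int_rotate:
  assumes g: "continuous_on (sphere 0 1) g" and v: "norm v = 1"
  shows "circle_int (\<lambda>u. g (v * u)) = circle_int g"
proof -
  \<comment> \<open>Rotation is a shift of the angle by \<open>a\<close>; the part of the interval beyond \<open>2 * pi\<close> is moved back by periodicity.\<close>
  obtain a where a: "0 \<le> a" "a < 2*pi" "v = cis a"
  proof -
    have "v = cis (Arg2pi v)" using v Arg2pi_eq[of v] by (metis Arg2pi cis_conv_exp mult.left_neutral of_real_1)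
    then show ?thesis using that[of "Arg2pi v"] Arg2pi by metis
  qed
  define h where "h t = g (cis t)" for t
  have hc: "continuous_on A h" for A unfolding h_def by (rule continuous_on_cis_comp[OF g])
  have hi: "h integrable_on {x..y}" for x y by (intro integrable_continuous_real hc)
  have per: "h (t + 2*pi) = h t" for t by (simp add: h_def cis_mult[symmetric])
  have "circle_int (\<lambda>u. g (v * u)) = integral {0..2*pi} (\<lambda>t. h (t + a))"
    by (simp add: circle_int_def h_def a cis_mult add.commute)
  also have "\<dots> = integral {a..2*pi + a} h"
    using integral_shift[where a=0 and b="2*pi" and c=a and f=h] hc by (simp add: add.commute o_def)
  also have "\<dots> = integral {a..2*pi} h + integral {2*pi..2*pi+a} h"
    using a by (intro Henstock_Kurzweil_Integration.integral_combine[symmetric] hi) auto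
  also have "integral {2*pi..2*pi+a} h = integral {0..a} (\<lambda>t. h (t + 2*pi))"
    using integral_shift[where a=0 and b=a and c="2*pi" and f=h] hc by (simp add: add.commute o_def)
  also have "\<dots> = integral {0..a} h" by (simp add: per)
  also have "integral {a..2*pi} h + integral {0..a} h = integral {0..2*pi} h"
    using a by (subst add.commute, intro Henstock_Kurzweil_Integration.integral_combine hi) auto
  also have "\<dots> = circle_int g" by (simp add: circle_int_def h_def[abs_def])
  finally show ?thesis .
qed

lemma circle_int_cnj:
  assumes g: "continuous_on (sphere 0 1) g"
  shows "circle_int (\<lambda>u. g (cnj u)) = circle_int g"
proof -
  define h where "h t = g (cis t)" for t
  have hc: "continuous_on A h" for A unfolding h_def by (rule continuous_on_cis_comp[OF g])
  have per: "h (t - 2*pi) = h t" for t by (simp add: h_def cis_divide[symmetric])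
  have "circle_int (\<lambda>u. g (cnj u)) = integral {0..2*pi} (\<lambda>t. h (- t))"
    by (simp add: circle_int_def h_def cis_cnj)
  also have "\<dots> = integral {-(2*pi)..-0} h"
    using Henstock_Kurzweil_Integration.integral_reflect_real[of 0 "-(2*pi)" h] by simp
  also have "\<dots> = integral {-(2*pi)..0} h" by simp
  also have "\<dots> = integral {0..2*pi} (\<lambda>t. h (t - 2*pi))"
    using integral_shift[where a=0 and b="2*pi" and c="-2*pi" and f=h] hc by (simp add: o_def)
  also have "\<dots> = circle_int g" unfolding per by (simp add: circle_int_def h_def[abs_def])
  finally show ?thesis .
qed

text \<open>
  The factor \<open>u\<close> comes from \<open>dz = \<i> * u * dt\<close>; a Fourier coefficient of positive order of a function
  that extends holomorphically to the disc is of this form.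
\<close>

lemma circle_int_Cauchy:
  assumes "continuous_on (cball 0 1) g" "g holomorphic_on ball 0 1"
  shows "circle_int (\<lambda>u. u * g u) = 0"
proof -
  have "((\<lambda>u. (u * g u)/(u-0)) has_contour_integral (2 * of_real pi * \<i> * (0 * g 0))) (circlepath 0 1)"
    by (rule Cauchy_integral_circlepath) (auto intro!: continuous_intros holomorphic_intros assms)
  then have "((\<lambda>u. (u * g u)/(u-0)) has_contour_integral 0) (part_circlepath 0 1 0 (2*pi))"
    by (simp add: circlepath_def)
  then have "((\<lambda>t. (cis t * g (cis t)) / cis t * 1 * \<i> * cis t) has_integral 0) {0..2*pi}"
    by (subst (asm) has_contour_integral_part_circlepath_iff) auto
  then have "((\<lambda>t. \<i> * (cis t * g (cis t))) has_integral 0) {0..2*pi}"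
    by (simp add: mult_ac)
  then have "((\<lambda>t. -\<i> * (\<i> * (cis t * g (cis t)))) has_integral -\<i> * 0) {0..2*pi}"
    by (rule has_integral_mult_right)
  then show ?thesis
    unfolding circle_int_def by (intro integral_unique) simp
qed

lemma circle_int_power: "n \<noteq> 0 \<Longrightarrow> circle_int (\<lambda>u. u ^ n) = 0"
  using circle_int_Cauchy[of "\<lambda>u. u ^ (n - 1)"]
  by (simp add: continuous_intros holomorphic_intros flip: power_Suc)

lemma circle_int_Cauchy_disc:
  assumes "r \<ge> 0" "continuous_on (cball c r) g" "g holomorphic_on ball c r"
  shows "circle_int (\<lambda>u. u * g (c + of_real r * u)) = 0"
proof (rule circle_int_Cauchy)
  have *: "norm (of_real r * u) \<le> r" if "norm u \<le> 1" for u :: complex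
    using that assms(1) by (simp add: norm_mult mult_left_le)
  show "continuous_on (cball 0 1) (\<lambda>u. g (c + of_real r * u))"
    by (rule continuous_on_compose2[OF assms(2)])
       (use * in \<open>auto intro!: continuous_intros simp: dist_norm\<close>)
  show "(\<lambda>u. g (c + of_real r * u)) holomorphic_on ball 0 1"
  proof (cases "r = 0")
    case False
    then have "r > 0" using assms(1) by simp
    have "(g \<circ> (\<lambda>u. c + of_real r * u)) holomorphic_on ball 0 1"
    proof (rule holomorphic_on_compose_gen[OF _ assms(3)])
      show "(\<lambda>u. c + of_real r * u) ` ball 0 1 \<subseteq> ball c r"
        using \<open>r > 0\<close> by (auto simp: dist_norm norm_mult)
    qed (auto intro!: holomorphic_intros)
    then show ?thesis by (simp add: o_def)
  qed auto
qed

section \<open>Approximation by trigonometric polynomials\<close>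

text \<open>
  The de la Vallee-Poussin kernel, not normalised.  On the circle it is a nonnegative trigonometric
  polynomial of degree \<open>N\<close>, and for large \<open>N\<close> its mass concentrates at \<open>u = 1\<close>.
\<close>

definition vp_kernel :: "nat \<Rightarrow> complex \<Rightarrow> complex" where
  "vp_kernel N u = of_real (norm (1 + u) ^ (2 * N))"

definition vp_mean :: "nat \<Rightarrow> (complex \<Rightarrow> complex) \<Rightarrow> complex" where
  "vp_mean N g = circle_int (\<lambda>u. g u * vp_kernel N u) / circle_int (vp_kernel N)"

lemma continuous_on_vp_kernel [continuous_intros]:
  "continuous_on A f \<Longrightarrow> continuous_on A (\<lambda>x. vp_kernel N (f x))"
  unfolding vp_kernel_def by (intro continuous_intros)

lemma vp_kernel_expand:
  assumes "norm u = 1"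
  shows "vp_kernel N u = (\<Sum>j\<le>2*N. of_nat (2*N choose j) * u ^ j * cnj u ^ N)"
proof -
  have uu: "u * cnj u = 1" using assms by (simp add: complex_norm_square[symmetric])
  have "of_real (norm (1 + u) ^ 2) = (1 + u) * cnj (1 + u)"
    unfolding complex_norm_square[symmetric] by simp
  also have "\<dots> = cnj u * (1 + u) ^ 2"
    using uu by (simp add: power2_eq_square algebra_simps)
  finally have "vp_kernel N u = cnj u ^ N * (u + 1) ^ (2 * N)"
    unfolding vp_kernel_def power_mult of_real_power by (simp add: power_mult_distrib add.commute flip: power_mult)
  then show ?thesis
    by (simp add: binomial_ring sum_distrib_left mult_ac)
qed

text \<open>
  On the arc of length \<open>\<delta>\<close> starting at \<open>1\<close> the kernel is smallest at the end point.  The resulting lower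
  bound for the total mass is what the tail of the kernel is compared with.
\<close>

lemma vp_kernel_int_pos: "\<exists>c>0. circle_int (vp_kernel N) = of_real c \<and>
    (\<forall>\<delta>>0. \<delta> \<le> pi \<longrightarrow> c \<ge> \<delta> * (norm (1 + cis \<delta>)) ^ (2 * N))"
proof -
  define h where "h t = norm (1 + cis t) ^ (2 * N)" for t
  have hc: "continuous_on A h" for A unfolding h_def by (intro continuous_intros)
  define c where "c = integral {0..2*pi} h"
  have e: "circle_int (vp_kernel N) = of_real c"
  proof -
    have "((\<lambda>t. of_real (h t) :: complex) has_integral of_real c) {0..2*pi}"
      unfolding c_def
      by (intro has_integral_of_real integrable_integral integrable_continuous_real hc)
    then show ?thesis by (simp add: circle_int_def vp_kernel_def h_def integral_unique)
  qed
  have mono: "norm (1 + cis \<delta>) \<le> norm (1 + cis t)" if "0 \<le> t" "t \<le> \<delta>" "\<delta> \<le> pi" for t \<delta>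
  proof -
    have "norm (1 + cis x) ^ 2 = 2 + 2 * cos x" for x
      unfolding cmod_power2 by (simp add: power2_eq_square algebra_simps)
    moreover have "cos \<delta> \<le> cos t" using that by (intro cos_monotone_0_pi_le) auto
    ultimately have "norm (1 + cis \<delta>) ^ 2 \<le> norm (1 + cis t) ^ 2" by simp
    then show ?thesis by (rule power2_le_imp_le) auto
  qed
  have low: "c \<ge> \<delta> * (norm (1 + cis \<delta>)) ^ (2 * N)" if "\<delta> > 0" "\<delta> \<le> pi" for \<delta>
  proof -
    have "\<delta> * (norm (1 + cis \<delta>)) ^ (2 * N) = integral {0..\<delta>} (\<lambda>t. norm (1 + cis \<delta>) ^ (2 * N))"
      using that by simp
    also have "\<dots> \<le> integral {0..\<delta>} h"
      by (rule integral_le)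
         (use that in \<open>auto intro!: integrable_continuous_real hc power_mono mono simp: h_def\<close>)
    also have "\<dots> \<le> c" unfolding c_def
      by (rule integral_subset_le)
         (use that in \<open>auto intro!: integrable_continuous_real hc simp: h_def\<close>)
    finally show ?thesis .
  qed
  have "c > 0"
  proof -
    have "norm (1 + cis (pi/2)) > 0" by (auto simp: complex_eq_iff)
    then have "pi/2 * (norm (1 + cis (pi/2))) ^ (2 * N) > 0" by simp
    moreover have "c \<ge> pi/2 * (norm (1 + cis (pi/2))) ^ (2 * N)" by (rule low) auto
    ultimately show ?thesis by linarith
  qed
  then show ?thesis using e low by blast
qed

text \<open>
  At distance at least \<open>\<delta>\<close> from \<open>1\<close> the kernel is at most \<open>q ^ (2 * N)\<close> for some \<open>q < 2\<close>, while its total mass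
  is at least a constant times \<open>p ^ (2 * N)\<close> with \<open>p > q\<close>.  The number \<open>N\<close> depends on \<open>g\<close> only through a bound
  and a modulus of continuity, which is needed when \<open>g\<close> varies in a family.
\<close>

lemma vp_mean_approx:
  assumes "\<epsilon> > 0" "\<delta> > 0" "B \<ge> 0"
  shows "\<exists>N. \<forall>g::complex \<Rightarrow> complex. continuous_on (sphere 0 1) g \<longrightarrow> (\<forall>u. norm u = 1 \<longrightarrow> norm (g u) \<le> B) \<longrightarrow>
            (\<forall>u. norm u = 1 \<longrightarrow> norm (u - 1) < \<delta> \<longrightarrow> norm (g u - g 1) \<le> \<epsilon>) \<longrightarrow>
            norm (vp_mean N g - g 1) \<le> 2 * \<epsilon>"
proof -
  \<comment> \<open>By the parallelogram law, \<open>norm (u - 1) \<ge> \<delta>\<close> gives \<open>norm (1 + u) \<le> sqrt (4 - \<delta>\<^sup>2)\<close>.\<close>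
  define q where "q = sqrt (max 0 (4 - \<delta>\<^sup>2))"
  have parallelogram: "norm (1 + u) ^ 2 + norm (u - 1) ^ 2 = 4" if "norm u = 1" for u :: complex
  proof -
    have "Re u ^ 2 + Im u ^ 2 = 1" using that by (simp add: cmod_def)
    then show ?thesis unfolding cmod_power2 by (simp add: power2_eq_square algebra_simps)
  qed
  have tail: "norm (1 + u) \<le> q" if "norm u = 1" "norm (u - 1) \<ge> \<delta>" for u :: complex
    using parallelogram[OF that(1)] that assms(2) power_mono[OF that(2), of 2]
    unfolding q_def by (intro real_le_rsqrt) linarith
  have q: "0 \<le> q" "q < 2" using assms(2) by (auto simp: q_def intro!: real_sqrt_less_iff[THEN iffD2, of _ 4, simplified])
  obtain d where d: "0 < d" "d \<le> pi" "norm (1 + cis d) > q"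
  proof -
    have "((\<lambda>d. norm (1 + cis d)) \<longlongrightarrow> norm (1 + cis 0)) (at_right 0)"
      by (intro tendsto_intros)
    then have "((\<lambda>d. norm (1 + cis d)) \<longlongrightarrow> 2) (at_right 0)" by simp
    then have "eventually (\<lambda>d. norm (1 + cis d) > q) (at_right 0)"
      using q(2) by (rule order_tendstoD)
    moreover have "eventually (\<lambda>d::real. d < pi) (at_right 0)"
      by (auto simp: eventually_at_right_field intro!: exI[of _ pi])
    moreover have "eventually (\<lambda>d::real. 0 < d) (at_right 0)" by (rule eventually_at_right_less)
    ultimately have "eventually (\<lambda>d. norm (1 + cis d) > q \<and> d < pi \<and> 0 < d) (at_right 0)"
      by eventually_elim simp
    then obtain d where "norm (1 + cis d) > q \<and> d < pi \<and> 0 < d"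
      using eventually_happens trivial_limit_at_right_real by blast
    then show ?thesis using that[of d] by auto
  qed
  define p where "p = norm (1 + cis d)"
  have p: "p > q" "p > 0" using d q by (auto simp: p_def)
  have "(\<lambda>N. 4 * pi * B / d * ((q/p)^2) ^ N) \<longlonglongrightarrow> 4 * pi * B / d * 0"
    using p q by (intro tendsto_intros LIMSEQ_realpow_zero) (auto simp: power_less_one_iff)
  then have "(\<lambda>N. 4 * pi * B / d * ((q/p)^2) ^ N) \<longlonglongrightarrow> 0" by simp
  from order_tendstoD(2)[OF this assms(1)]
  obtain N where N: "4 * pi * B / d * ((q/p)^2) ^ N < \<epsilon>"
    by (auto simp: eventually_sequentially)
  show ?thesis
  proof (intro exI allI impI)
    fix g :: "complex \<Rightarrow> complex" assume g: "continuous_on (sphere 0 1) g" "\<forall>u. norm u = 1 \<longrightarrow> norm (g u) \<le> B"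
        "\<forall>u. norm u = 1 \<longrightarrow> norm (u - 1) < \<delta> \<longrightarrow> norm (g u - g 1) \<le> \<epsilon>"
    obtain c where c: "c > 0" "circle_int (vp_kernel N) = of_real c" "c \<ge> d * p ^ (2 * N)"
      using vp_kernel_int_pos[of N] d unfolding p_def by blast
    have K: "continuous_on (sphere 0 1) (vp_kernel N)" using continuous_on_vp_kernel[of _ "\<lambda>x. x"] by simp
    have "vp_mean N g - g 1 = circle_int (\<lambda>u. (g u - g 1) * vp_kernel N u) / c"
      using c(1) unfolding vp_mean_def c(2) left_diff_distrib
      by (subst circle_int_diff) (auto simp: circle_int_cmult c(2) diff_divide_distrib intro!: continuous_intros g K)
    also have "norm \<dots> \<le> (\<epsilon> * c + 2 * pi * (2 * B * q ^ (2*N))) / c"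
    proof -
      define h where "h t = norm (1 + cis t) ^ (2 * N)" for t
      have hi: "h integrable_on {0..2*pi}" unfolding h_def by (intro integrable_continuous_real continuous_intros)
      have hc: "integral {0..2*pi} h = c"
      proof -
        have "((\<lambda>t. of_real (h t) :: complex) has_integral of_real (integral {0..2*pi} h)) {0..2*pi}"
          by (intro has_integral_of_real integrable_integral hi)
        then have "of_real (integral {0..2*pi} h) = (of_real c :: complex)"
          unfolding c(2)[symmetric] circle_int_def vp_kernel_def h_def by (simp add: integral_unique)
        then show ?thesis by simp
      qed
      have "norm (circle_int (\<lambda>u. (g u - g 1) * vp_kernel N u))
              \<le> integral {0..2*pi} (\<lambda>t. \<epsilon> * h t + 2 * B * q ^ (2*N))"
        unfolding circle_int_def
      proof (rule integral_norm_bound_integral)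
        show "(\<lambda>t. (g (cis t) - g 1) * vp_kernel N (cis t)) integrable_on {0..2*pi}"
          by (rule circle_int_integrable) (intro continuous_intros g K)
        show "(\<lambda>t. \<epsilon> * h t + 2 * B * q ^ (2*N)) integrable_on {0..2*pi}"
          unfolding h_def by (intro integrable_continuous_real continuous_intros)
        fix t assume "t \<in> {0..2*pi}"
        have v: "norm (vp_kernel N (cis t)) = h t" by (simp add: vp_kernel_def h_def norm_power)
        have h0: "h t \<ge> 0" by (simp add: h_def)
        show "norm ((g (cis t) - g 1) * vp_kernel N (cis t)) \<le> \<epsilon> * h t + 2 * B * q ^ (2*N)"
        proof (cases "norm (cis t - 1) < \<delta>")
          case True
          then have "norm ((g (cis t) - g 1) * vp_kernel N (cis t)) \<le> \<epsilon> * h t"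
            unfolding norm_mult v using g(3) h0 by (intro mult_right_mono) auto
          then show ?thesis using assms q by (smt (verit) mult_nonneg_nonneg zero_le_power)
        next
          case False
          have "norm (g (cis t) - g 1) \<le> 2 * B"
            using g(2) norm_triangle_ineq4[of "g (cis t)" "g 1"] by (smt (verit) norm_cis norm_one)
          moreover have "h t \<le> q ^ (2*N)" unfolding h_def using False tail[of "cis t"] by (intro power_mono) auto
          ultimately have "norm ((g (cis t) - g 1) * vp_kernel N (cis t)) \<le> 2 * B * q ^ (2*N)"
            unfolding norm_mult v using h0 assms by (intro mult_mono) auto
          then show ?thesis using assms h0 by (smt (verit) mult_nonneg_nonneg)
        qed
      qed
      also have "\<dots> = \<epsilon> * c + 2 * pi * (2 * B * q ^ (2*N))"
        using hi by (subst integral_add) (auto simp: hc intro!: integrable_on_mult_right)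
      finally show ?thesis using c(1) by (simp add: norm_divide divide_right_mono)
    qed
    also have "\<dots> = \<epsilon> + 4 * pi * B * q ^ (2*N) / c" using c(1) by (simp add: field_simps)
    also have "4 * pi * B * q ^ (2*N) / c \<le> 4 * pi * B * q ^ (2*N) / (d * p ^ (2 * N))"
      using c d p q assms by (intro divide_left_mono) auto
    also have "\<dots> = 4 * pi * B / d * ((q/p)^2) ^ N" by (simp add: power_divide power_mult)
    also have "\<dots> \<le> \<epsilon>" using N by simp
    finally show "norm (vp_mean N g - g 1) \<le> 2 * \<epsilon>" by simp
  qed
qed

lemma vp_mean_approx_rotated:
  assumes "\<epsilon> > 0" "continuous_on (sphere 0 1) g"
  shows "\<exists>N. \<forall>w. norm w = 1 \<longrightarrow> norm (vp_mean N (\<lambda>u. g (w * u)) - g w) \<le> \<epsilon>"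
proof -
  have "uniformly_continuous_on (sphere 0 1) g"
    using assms(2) by (intro compact_uniformly_continuous) auto
  then obtain d where d: "d > 0" "\<And>x y. norm x = 1 \<Longrightarrow> norm y = 1 \<Longrightarrow> dist x y < d \<Longrightarrow> dist (g x) (g y) < \<epsilon>/2"
    using assms(1) unfolding uniformly_continuous_on_def
    by (metis half_gt_zero mem_sphere_0)
  have "compact (g ` sphere 0 1)" using assms(2) by (intro compact_continuous_image) auto
  then obtain B where B: "B \<ge> 0" "\<And>u. norm u = 1 \<Longrightarrow> norm (g u) \<le> B"
    using compact_imp_bounded bounded_pos by (metis imageI less_imp_le mem_sphere_0)
  obtain N where N: "\<And>h::complex \<Rightarrow> complex. continuous_on (sphere 0 1) h \<Longrightarrow> (\<And>u. norm u = 1 \<Longrightarrow> norm (h u) \<le> B) \<Longrightarrow>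
            (\<And>u. norm u = 1 \<Longrightarrow> norm (u - 1) < d \<Longrightarrow> norm (h u - h 1) \<le> \<epsilon>/2) \<Longrightarrow>
            norm (vp_mean N h - h 1) \<le> 2 * (\<epsilon>/2)"
    using vp_mean_approx[of "\<epsilon>/2" d B] assms d B by (metis half_gt_zero)
  have "norm (vp_mean N (\<lambda>u. g (w * u)) - g (w * 1)) \<le> 2 * (\<epsilon>/2)" if w: "norm w = 1" for w
  proof (rule N)
    show "continuous_on (sphere 0 1) (\<lambda>u. g (w * u))"
      by (rule continuous_on_compose2[OF assms(2)]) (use w in \<open>auto intro!: continuous_intros simp: norm_mult\<close>)
    show "norm (g (w * u)) \<le> B" if "norm u = 1" for u using B that w by (simp add: norm_mult)
    show "norm (g (w * u) - g (w * 1)) \<le> \<epsilon>/2" if "norm u = 1" "norm (u - 1) < d" for u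
    proof -
      have "dist (w * u) w = norm (u - 1)" using w
        by (metis dist_norm mult.right_neutral norm_mult mult_1 right_diff_distrib)
      then show ?thesis using d(2)[of "w * u" w] that w by (simp add: norm_mult dist_norm)
    qed
  qed
  then show ?thesis by auto
qed

lemma circle_int_vp_expand:
  assumes "continuous_on (sphere 0 1) g"
  shows "circle_int (\<lambda>u. g u * vp_kernel N u) =
     (\<Sum>j\<le>2*N. of_nat (2*N choose j) * circle_int (\<lambda>u. g u * (u ^ j * cnj u ^ N)))"
proof -
  have "circle_int (\<lambda>u. g u * vp_kernel N u) =
      circle_int (\<lambda>u. \<Sum>j\<le>2*N. of_nat (2*N choose j) * (g u * (u ^ j * cnj u ^ N)))"
    by (rule circle_int_cong) (simp add: vp_kernel_expand sum_distrib_left mult_ac)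
  also have "\<dots> = (\<Sum>j\<le>2*N. circle_int (\<lambda>u. of_nat (2*N choose j) * (g u * (u ^ j * cnj u ^ N))))"
    by (intro circle_int_sum) (auto intro!: continuous_intros assms)
  finally show ?thesis by (simp add: circle_int_cmult)
qed

lemma power_mult_cnj_power:
  assumes "norm u = 1"
  shows "u ^ j * cnj u ^ N = (if j \<ge> N then u ^ (j - N) else cnj u ^ (N - j))"
proof -
  have uu: "u * cnj u = 1" using assms by (simp add: complex_norm_square[symmetric])
  show ?thesis
  proof (cases "j \<ge> N")
    case True
    then have "u ^ j = u ^ (j - N) * u ^ N" by (simp flip: power_add)
    then show ?thesis using True uu by (simp add: mult.assoc flip: power_mult_distrib)
  next
    case False
    then have "cnj u ^ N = cnj u ^ j * cnj u ^ (N - j)" by (simp flip: power_add)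
    then show ?thesis using False uu by (simp flip: mult.assoc power_mult_distrib)
  qed
qed

text \<open>
  The mean \<open>vp_mean N (\<lambda>u. g (w * u))\<close> is a combination of Fourier coefficients of \<open>g\<close>, hence zero, and it
  converges to \<open>g w\<close>.
\<close>

lemma circle_fourier_unique:
  assumes g: "continuous_on (sphere 0 1) g"
    and p: "\<And>n. circle_int (\<lambda>u. g u * u ^ n) = 0"
    and m: "\<And>n. circle_int (\<lambda>u. g u * cnj u ^ n) = 0"
    and w: "norm w = 1"
  shows "g w = 0"
proof -
  have "vp_mean N (\<lambda>u. g (w * u)) = 0" for N
  proof -
    have c: "continuous_on (sphere 0 1) (\<lambda>u. g (w * u))"
      by (rule continuous_on_compose2[OF g]) (use w in \<open>auto intro!: continuous_intros simp: norm_mult\<close>)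
    have wwu: "cnj w * (w * u) = u" for u
      using w complex_norm_square[of w] by (simp add: mult.commute[of w] flip: mult.assoc)
    have "circle_int (\<lambda>u. g (w * u) * (u ^ j * cnj u ^ N)) = 0" for j
    proof -
      have "circle_int (\<lambda>u. g (w * u) * (u ^ j * cnj u ^ N))
          = circle_int (\<lambda>u. (\<lambda>v. g v * ((cnj w * v) ^ j * cnj (cnj w * v) ^ N)) (w * u))"
        by (rule circle_int_cong) (simp only: wwu)
      also have "\<dots> = circle_int (\<lambda>v. g v * ((cnj w * v) ^ j * cnj (cnj w * v) ^ N))"
        by (rule circle_int_rotate) (use w in \<open>auto intro!: continuous_intros g\<close>)
      also have "\<dots> = circle_int (\<lambda>v. (cnj w ^ j * w ^ N) * (if j \<ge> N then g v * v ^ (j - N) else g v * cnj v ^ (N - j)))"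
        by (rule circle_int_cong) (use power_mult_cnj_power[of _ j N] in \<open>auto simp: power_mult_distrib\<close>)
      also have "\<dots> = 0" unfolding circle_int_cmult by (cases "N \<le> j") (simp_all add: p m)
      finally show ?thesis .
    qed
    then show ?thesis unfolding vp_mean_def circle_int_vp_expand[OF c] by simp
  qed
  then have "norm (g w) \<le> \<epsilon>" if "\<epsilon> > 0" for \<epsilon>
    using vp_mean_approx_rotated[OF that g] w by auto
  then show ?thesis by (metis field_lbound_gt_zero norm_le_zero_iff not_less zero_less_norm_iff)
qed

text \<open>
  The means of \<open>g\<close> are trigonometric polynomials in \<open>w\<close> whose coefficients are multiples of the Fourier
  coefficients of \<open>g\<close>; the hypothesis removes the negative powers of \<open>w\<close>.
\<close>

lemma circle_polynomial_approx:
  assumes g: "continuous_on (sphere 0 1) g"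
    and p: "\<And>n. n \<ge> 1 \<Longrightarrow> circle_int (\<lambda>u. g u * u ^ n) = 0"
    and e: "\<epsilon> > 0"
  shows "\<exists>c N. \<forall>w. norm w = 1 \<longrightarrow> norm (g w - (\<Sum>j\<le>(N::nat). c j * w ^ j)) \<le> \<epsilon>"
proof -
  obtain N where N: "\<And>w. norm w = 1 \<Longrightarrow> norm (vp_mean N (\<lambda>u. g (w * u)) - g w) \<le> \<epsilon>"
    using vp_mean_approx_rotated[OF e g] by blast
  define K where "K = circle_int (vp_kernel N)"
  define c where "c i = of_nat (2*N choose (N - i)) * circle_int (\<lambda>v. g v * cnj v ^ i) / K" for i
  have "vp_mean N (\<lambda>u. g (w * u)) = (\<Sum>j\<le>N. c j * w ^ j)" if w: "norm w = 1" for w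
  proof -
    have cont: "continuous_on (sphere 0 1) (\<lambda>u. g (w * u))"
      by (rule continuous_on_compose2[OF g]) (use w in \<open>auto intro!: continuous_intros simp: norm_mult\<close>)
    have wwu: "cnj w * (w * u) = u" for u
      using w complex_norm_square[of w] by (simp add: mult.commute[of w] flip: mult.assoc)
    have *: "circle_int (\<lambda>u. g (w * u) * (u ^ j * cnj u ^ N)) =
        (if j \<le> N then w ^ (N - j) * circle_int (\<lambda>v. g v * cnj v ^ (N - j)) else 0)" for j
    proof -
      have "circle_int (\<lambda>u. g (w * u) * (u ^ j * cnj u ^ N))
          = circle_int (\<lambda>u. (\<lambda>v. g v * ((cnj w * v) ^ j * cnj (cnj w * v) ^ N)) (w * u))"
        by (rule circle_int_cong) (simp only: wwu)
      also have "\<dots> = circle_int (\<lambda>v. g v * ((cnj w * v) ^ j * cnj (cnj w * v) ^ N))"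
        by (rule circle_int_rotate) (use w in \<open>auto intro!: continuous_intros g\<close>)
      also have "\<dots> = circle_int (\<lambda>v. (w ^ N * cnj w ^ j) * (g v * (v ^ j * cnj v ^ N)))"
        by (rule circle_int_cong) (simp add: power_mult_distrib mult_ac)
      also have "\<dots> = (w ^ N * cnj w ^ j) * circle_int (\<lambda>v. g v * (v ^ j * cnj v ^ N))"
        by (rule circle_int_cmult)
      also have "\<dots> = (if j \<le> N then w ^ (N - j) * circle_int (\<lambda>v. g v * cnj v ^ (N - j)) else 0)"
      proof (cases "j \<le> N")
        case True
        have "w ^ N * cnj w ^ j = w ^ (N - j)" using True by (subst power_mult_cnj_power[OF w]) simp
        moreover have "circle_int (\<lambda>v. g v * (v ^ j * cnj v ^ N)) = circle_int (\<lambda>v. g v * cnj v ^ (N - j))"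
          by (rule circle_int_cong) (use True in \<open>auto simp: power_mult_cnj_power\<close>)
        ultimately show ?thesis using True by simp
      next
        case False
        have "circle_int (\<lambda>v. g v * (v ^ j * cnj v ^ N)) = circle_int (\<lambda>v. g v * v ^ (j - N))"
          by (rule circle_int_cong) (use False in \<open>auto simp: power_mult_cnj_power\<close>)
        then show ?thesis using False p[of "j - N"] by simp
      qed
      finally show ?thesis .
    qed
    have "vp_mean N (\<lambda>u. g (w * u)) =
       (\<Sum>j\<le>2*N. of_nat (2*N choose j) * (if j \<le> N then w ^ (N - j) * circle_int (\<lambda>v. g v * cnj v ^ (N - j)) else 0)) / K"
      unfolding vp_mean_def circle_int_vp_expand[OF cont] * K_def ..
    also have "(\<Sum>j\<le>2*N. of_nat (2*N choose j) * (if j \<le> N then w ^ (N - j) * circle_int (\<lambda>v. g v * cnj v ^ (N - j)) else 0))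
       = (\<Sum>j\<le>N. of_nat (2*N choose j) * (w ^ (N - j) * circle_int (\<lambda>v. g v * cnj v ^ (N - j))))"
      by (rule sum.mono_neutral_cong_right) auto
    also have "\<dots> / K = (\<Sum>j\<le>N. c (N - j) * w ^ (N - j))"
      unfolding sum_divide_distrib c_def by (rule sum.cong) auto
    also have "\<dots> = (\<Sum>j\<le>N. c j * w ^ j)"
      by (rule sum.reindex_bij_witness[of _ "\<lambda>j. N - j" "\<lambda>j. N - j"]) auto
    finally show ?thesis .
  qed
  then have "\<forall>w. norm w = 1 \<longrightarrow> norm (g w - (\<Sum>j\<le>N. c j * w ^ j)) \<le> \<epsilon>"
    using N by (simp add: norm_minus_commute)
  then show ?thesis by blast
qed

section \<open>Extension along complex lines\<close>

definition line_pt :: "complex \<times> complex \<Rightarrow> complex \<times> complex \<Rightarrow> complex \<Rightarrow> complex \<times> complex" where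
  "line_pt x v t = (fst x + t * fst v, snd x + t * snd v)"

text \<open>
  Extension up to arbitrarily small uniform errors.  By the maximum principle this is the same as exact
  extension; the approximate form lets polynomials serve as witnesses and needs no limit function.
  Lines that miss the ball, and tangent lines, satisfy it trivially.
\<close>

definition line_ext :: "(complex \<times> complex \<Rightarrow> complex) \<Rightarrow> complex \<times> complex \<Rightarrow> complex \<times> complex \<Rightarrow> bool" where
  "line_ext F x v \<longleftrightarrow> (\<forall>\<epsilon>>0. \<exists>\<phi>. continuous_on {t. norm (line_pt x v t) \<le> 1} \<phi> \<and>
      \<phi> holomorphic_on {t. norm (line_pt x v t) < 1} \<and>
      (\<forall>t. norm (line_pt x v t) = 1 \<longrightarrow> norm (F (line_pt x v t) - \<phi> t) \<le> \<epsilon>))"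

definition pencil_ext :: "(complex \<times> complex \<Rightarrow> complex) \<Rightarrow> complex \<times> complex \<Rightarrow> bool" where
  "pencil_ext F x \<longleftrightarrow> (\<forall>v. v \<noteq> 0 \<longrightarrow> line_ext F x v)"

definition herm :: "complex \<times> complex \<Rightarrow> complex \<times> complex \<Rightarrow> complex" where
  "herm a b = fst a * cnj (fst b) + snd a * cnj (snd b)"

lemma herm_self: "herm a a = of_real ((norm a)\<^sup>2)"
  unfolding herm_def norm_prod_def by (simp add: complex_norm_square[symmetric])

lemma norm_pair_sq: "(norm (a :: complex \<times> complex))\<^sup>2 = (norm (fst a))\<^sup>2 + (norm (snd a))\<^sup>2"
  by (simp add: norm_prod_def)

lemma herm_bound: "norm (herm a b) \<le> norm a * norm b"
proof -
  have "norm (herm a b) \<le> norm (fst a) * norm (fst b) + norm (snd a) * norm (snd b)"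
    unfolding herm_def by (rule order_trans[OF norm_triangle_ineq]) (simp add: norm_mult)
  also have "\<dots> = inner (norm (fst a), norm (snd a)) (norm (fst b), norm (snd b))"
    by simp
  also have "\<dots> \<le> norm (norm (fst a), norm (snd a)) * norm (norm (fst b), norm (snd b))"
    by (rule norm_cauchy_schwarz)
  also have "\<dots> = norm a * norm b"
    by (simp add: norm_prod_def)
  finally show ?thesis .
qed

text \<open>
  The approximating holomorphic functions satisfy Cauchy's theorem exactly, and the error is uniformly
  small on the circle.  The multiplier \<open>\<psi>\<close> will carry all the weights that are holomorphic along the line.
\<close>

lemma line_ext_Cauchy:
  assumes ext: "line_ext F x v" and r: "r > 0"
    and F: "continuous_on (sphere 0 1) F"
    and disc: "\<And>t. norm (line_pt x v t) \<le> 1 \<longleftrightarrow> t \<in> cball c r"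
      "\<And>t. norm (line_pt x v t) < 1 \<longleftrightarrow> t \<in> ball c r"
    and chi: "continuous_on (cball c r) \<psi>" "\<psi> holomorphic_on ball c r"
  shows "circle_int (\<lambda>u. u * (F (line_pt x v (c + of_real r * u)) * \<psi> (c + of_real r * u))) = 0"
    (is "?I = 0")
proof -
  define T where "T u = c + of_real r * u" for u :: complex
  have T: "T u \<in> cball c r" "norm (line_pt x v (T u)) = 1" if "norm u = 1" for u
  proof -
    have "dist c (T u) = r" using that r by (simp add: T_def dist_norm norm_mult)
    then have "T u \<in> cball c r" "T u \<notin> ball c r" by auto
    then show "T u \<in> cball c r" "norm (line_pt x v (T u)) = 1"
      using disc[of "T u"] by auto
  qed
  have Tc: "continuous_on A T" for A unfolding T_def by (intro continuous_intros)
  obtain B where B: "B > 0" "\<And>t. t \<in> cball c r \<Longrightarrow> norm (\<psi> t) \<le> B"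
    using compact_imp_bounded[OF compact_continuous_image[OF chi(1) compact_cball]]
    unfolding bounded_pos by auto
  have Fc: "continuous_on (sphere 0 1) (\<lambda>u. F (line_pt x v (T u)))"
    by (rule continuous_on_compose2[OF F])
       (use T in \<open>auto simp: line_pt_def intro!: continuous_intros Tc\<close>)
  have chic: "continuous_on (sphere 0 1) (\<lambda>u. \<psi> (T u))"
    by (rule continuous_on_compose2[OF chi(1) Tc]) (use T in auto)
  have "norm ?I \<le> 2 * pi * (\<epsilon> * B)" if "\<epsilon> > 0" for \<epsilon>
  proof -
    obtain \<phi> where phi: "continuous_on (cball c r) \<phi>" "\<phi> holomorphic_on ball c r"
      "\<And>t. norm (line_pt x v t) = 1 \<Longrightarrow> norm (F (line_pt x v t) - \<phi> t) \<le> \<epsilon>"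
    proof -
      have "{t. norm (line_pt x v t) \<le> 1} = cball c r" "{t. norm (line_pt x v t) < 1} = ball c r"
        using disc by blast+
      with ext[unfolded line_ext_def, rule_format, OF \<open>\<epsilon> > 0\<close>] that show ?thesis by auto
    qed
    have phic: "continuous_on (sphere 0 1) (\<lambda>u. \<phi> (T u))"
      by (rule continuous_on_compose2[OF phi(1) Tc]) (use T in auto)
    have z: "circle_int (\<lambda>u. u * (\<phi> (T u) * \<psi> (T u))) = 0"
      unfolding T_def
      by (rule circle_int_Cauchy_disc[of r c "\<lambda>t. \<phi> t * \<psi> t"])
         (use r in \<open>auto intro!: continuous_intros holomorphic_intros phi chi\<close>)
    have "?I = circle_int (\<lambda>u. u * (F (line_pt x v (T u)) * \<psi> (T u))) - circle_int (\<lambda>u. u * (\<phi> (T u) * \<psi> (T u)))"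
      unfolding z by (simp add: T_def)
    also have "\<dots> = circle_int (\<lambda>u. u * (F (line_pt x v (T u)) * \<psi> (T u)) - u * (\<phi> (T u) * \<psi> (T u)))"
      by (rule circle_int_diff[symmetric]) (intro continuous_intros Fc chic phic)+
    also have "norm \<dots> \<le> 2 * pi * (\<epsilon> * B)"
    proof (rule circle_int_bound)
      show "continuous_on (sphere 0 1) (\<lambda>u. u * (F (line_pt x v (T u)) * \<psi> (T u)) - u * (\<phi> (T u) * \<psi> (T u)))"
        by (intro continuous_intros Fc chic phic)
      fix u :: complex assume u: "norm u = 1"
      have "u * (F (line_pt x v (T u)) * \<psi> (T u)) - u * (\<phi> (T u) * \<psi> (T u))
          = u * ((F (line_pt x v (T u)) - \<phi> (T u)) * \<psi> (T u))" by (simp add: algebra_simps)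
      moreover have "norm (u * ((F (line_pt x v (T u)) - \<phi> (T u)) * \<psi> (T u))) \<le> \<epsilon> * B"
        unfolding norm_mult u mult_1_left
        using phi(3) T[OF u] B that by (intro mult_mono) auto
      ultimately show "norm (u * (F (line_pt x v (T u)) * \<psi> (T u)) - u * (\<phi> (T u) * \<psi> (T u))) \<le> \<epsilon> * B"
        by simp
    qed
    finally show ?thesis .
  qed
  then have "norm ?I \<le> e" if "e > 0" for e
  proof -
    have "norm ?I \<le> 2 * pi * (e / (2 * pi * B) * B)"
      using B(1) that by (intro \<open>\<And>\<epsilon>. \<epsilon> > 0 \<Longrightarrow> norm ?I \<le> 2 * pi * (\<epsilon> * B)\<close>) simp
    then show ?thesis using B(1) by simp
  qed
  then have "norm ?I \<le> 0" by (rule field_le_epsilon[of _ 0, simplified])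
  then show ?thesis by simp
qed

section \<open>Projective automorphisms of the ball\<close>

text \<open>
  A triple stands for a row of a \<open>3 \<times> 3\<close> matrix that acts on homogeneous coordinates.
\<close>

definition aff :: "complex \<times> complex \<times> complex \<Rightarrow> complex \<times> complex \<Rightarrow> complex" where
  "aff k x = fst k * fst x + fst (snd k) * snd x + snd (snd k)"

definition proj_map where
  "proj_map k l d x = (aff k x / aff d x, aff l x / aff d x)"

text \<open>
  The identity says that the matrix with the rows \<open>k\<close>, \<open>l\<close>, \<open>d\<close> preserves
  the Hermitian form \<open>(norm z)\<^sup>2 + (norm w)\<^sup>2 - 1\<close>, homogenised,
  up to the positive factor \<open>\<kappa>\<close>.
\<close>

definition ball_aut where
  "ball_aut k l d \<longleftrightarrow> (\<exists>\<kappa>>0. \<forall>x. (norm (aff k x))\<^sup>2 + (norm (aff l x))\<^sup>2 - (norm (aff d x))\<^sup>2 = \<kappa> * ((norm x)\<^sup>2 - 1))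
     \<and> (\<forall>x. norm x \<le> 1 \<longrightarrow> aff d x \<noteq> 0)"

lemma ball_aut_den: "ball_aut k l d \<Longrightarrow> norm x \<le> 1 \<Longrightarrow> aff d x \<noteq> 0"
  unfolding ball_aut_def by blast

lemma aff_line_pt: "aff k (line_pt x v t) = aff k x + t * (fst k * fst v + fst (snd k) * snd v)"
  by (simp add: aff_def line_pt_def algebra_simps)

lemma ball_aut_norm:
  assumes "ball_aut k l d" "aff d x \<noteq> 0"
  shows "norm (proj_map k l d x) \<le> 1 \<longleftrightarrow> norm x \<le> 1" "norm (proj_map k l d x) < 1 \<longleftrightarrow> norm x < 1"
    "norm (proj_map k l d x) = 1 \<longleftrightarrow> norm x = 1"
proof -
  obtain \<kappa> where k: "\<kappa> > 0" "(norm (aff k x))\<^sup>2 + (norm (aff l x))\<^sup>2 - (norm (aff d x))\<^sup>2 = \<kappa> * ((norm x)\<^sup>2 - 1)"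
    using assms(1) unfolding ball_aut_def by blast
  define D where "D = (norm (aff d x))\<^sup>2"
  have D: "D > 0" using assms(2) by (simp add: D_def)
  \<comment> \<open>Dividing the identity of \<open>ball_aut\<close> by \<open>(norm (aff d x))\<^sup>2\<close> keeps the sign of \<open>(norm x)\<^sup>2 - 1\<close>.\<close>
  have "(norm (proj_map k l d x))\<^sup>2 - 1 = (\<kappa> / D) * ((norm x)\<^sup>2 - 1)"
  proof -
    have "(norm (proj_map k l d x))\<^sup>2 = (norm (aff k x / aff d x))\<^sup>2 + (norm (aff l x / aff d x))\<^sup>2"
      unfolding norm_pair_sq by (simp add: proj_map_def)
    also have "\<dots> = (norm (aff k x))\<^sup>2 / D + (norm (aff l x))\<^sup>2 / D"
      by (simp add: norm_divide power_divide D_def)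
    finally show ?thesis using D k(2) unfolding D_def[symmetric] by (simp add: field_simps)
  qed
  moreover have "\<kappa> / D > 0" using k D by simp
  ultimately obtain c where c: "c > 0" "(norm (proj_map k l d x))\<^sup>2 - 1 = c * ((norm x)\<^sup>2 - 1)"
    by blast
  have n: "norm y \<le> 1 \<longleftrightarrow> (norm y)\<^sup>2 - 1 \<le> 0" "norm y < 1 \<longleftrightarrow> (norm y)\<^sup>2 - 1 < 0" "norm y = 1 \<longleftrightarrow> (norm y)\<^sup>2 - 1 = 0"
     for y :: "complex \<times> complex"
    using abs_square_le_1[of "norm y"] abs_square_less_1[of "norm y"] abs_square_eq_1[of "norm y"]
    by (simp_all only: abs_norm_cancel diff_le_0_iff_le diff_less_0_iff_less right_minus_eq)
  show "norm (proj_map k l d x) \<le> 1 \<longleftrightarrow> norm x \<le> 1"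
    unfolding n c(2) using c(1) by (simp only: mult_le_0_iff) auto
  show "norm (proj_map k l d x) < 1 \<longleftrightarrow> norm x < 1"
    unfolding n c(2) using c(1) by (simp only: mult_less_0_iff) auto
  show "norm (proj_map k l d x) = 1 \<longleftrightarrow> norm x = 1"
    unfolding n c(2) using c(1) by (simp only: mult_eq_0_iff) auto
qed

lemma moebius_split: "D \<noteq> 0 \<Longrightarrow> D + t * L \<noteq> 0 \<Longrightarrow> (K + t * N) / (D + t * L) = K / D + t / (D + t * L) * ((N * D - K * L) / D)" for D :: complex
  by (simp add: divide_simps) (simp add: algebra_simps)

text \<open>
  A projective map sends the line through \<open>x\<close> in direction \<open>v\<close> to a line through the image of \<open>x\<close>, and on
  that line it is the Moebius map \<open>M\<close> of the parameter.  The pole of \<open>M\<close> lies outside the closed ball, so a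
  holomorphic extension on the image line can be pulled back.
\<close>

lemma pencil_ext_transfer:
  assumes aut: "ball_aut k l d" and dx: "aff d x \<noteq> 0"
    and ext: "pencil_ext F (proj_map k l d x)"
  shows "pencil_ext (F \<circ> proj_map k l d) x"
  unfolding pencil_ext_def
proof (intro allI impI)
  fix v :: "complex \<times> complex" assume "v \<noteq> 0"
  define P where "P = proj_map k l d"
  define lin where "lin k = fst k * fst v + fst (snd k) * snd v" for k :: "complex \<times> complex \<times> complex"
  define V where "V = ((lin k * aff d x - aff k x * lin d) / aff d x, (lin l * aff d x - aff l x * lin d) / aff d x)"
  define M where "M t = t / (aff d x + t * lin d)" for t
  have dl: "aff d (line_pt x v t) = aff d x + t * lin d" for t
    by (simp add: aff_line_pt lin_def)
  \<comment> \<open>\<open>V\<close> is the image direction, and \<open>moebius_split\<close> separates the value at \<open>t = 0\<close> in each coordinate.\<close>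
  have PM: "P (line_pt x v t) = line_pt (P x) V (M t)" if "aff d x + t * lin d \<noteq> 0" for t
  proof -
    have a: "aff m (line_pt x v t) = aff m x + t * lin m" for m by (simp add: aff_line_pt lin_def)
    show ?thesis
      unfolding P_def proj_map_def a moebius_split[OF dx that] line_pt_def[of "(aff k x / aff d x, aff l x / aff d x)"]
      by (simp add: V_def M_def)
  qed
  have nz: "aff d x + t * lin d \<noteq> 0" if "norm (line_pt x v t) \<le> 1" for t
    using ball_aut_den[OF aut that] by (simp add: dl)
  have Mc: "continuous_on {t. norm (line_pt x v t) \<le> 1} M"
    unfolding M_def by (intro continuous_intros) (use nz in auto)
  have Mh: "M holomorphic_on {t. norm (line_pt x v t) < 1}"
    unfolding M_def by (intro holomorphic_intros) (use nz in auto)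
  have Mn: "norm (line_pt (P x) V (M t)) \<le> 1 \<longleftrightarrow> norm (line_pt x v t) \<le> 1"
    "norm (line_pt (P x) V (M t)) < 1 \<longleftrightarrow> norm (line_pt x v t) < 1"
    "norm (line_pt (P x) V (M t)) = 1 \<longleftrightarrow> norm (line_pt x v t) = 1"
    if "norm (line_pt x v t) \<le> 1" for t
    using nz[OF that] ball_aut_norm[OF aut, of "line_pt x v t"] PM[of t] unfolding dl P_def by simp_all
  show "line_ext (F \<circ> proj_map k l d) x v"
    unfolding line_ext_def
  proof (intro allI impI)
    fix \<epsilon> :: real assume "\<epsilon> > 0"
    show "\<exists>\<phi>. continuous_on {t. norm (line_pt x v t) \<le> 1} \<phi> \<and>
      \<phi> holomorphic_on {t. norm (line_pt x v t) < 1} \<and>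
      (\<forall>t. norm (line_pt x v t) = 1 \<longrightarrow> norm ((F \<circ> proj_map k l d) (line_pt x v t) - \<phi> t) \<le> \<epsilon>)"
    \<comment> \<open>If the map collapses the line, a constant is the extension.\<close>
    proof (cases "V = 0")
      case True
      then have "P (line_pt x v t) = P x" if "norm (line_pt x v t) = 1" for t
        using PM[of t] nz[of t] that by (simp add: line_pt_def)
      then show ?thesis
        using \<open>\<epsilon> > 0\<close> by (intro exI[of _ "\<lambda>_. F (P x)"]) (auto simp: P_def)
    next
      case False
      then obtain \<phi> where phi: "continuous_on {t. norm (line_pt (P x) V t) \<le> 1} \<phi>"
        "\<phi> holomorphic_on {t. norm (line_pt (P x) V t) < 1}"
        "\<And>t. norm (line_pt (P x) V t) = 1 \<Longrightarrow> norm (F (line_pt (P x) V t) - \<phi> t) \<le> \<epsilon>"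
        using ext \<open>\<epsilon> > 0\<close> unfolding pencil_ext_def line_ext_def P_def by blast
      have "continuous_on {t. norm (line_pt x v t) \<le> 1} (\<lambda>t. \<phi> (M t))"
        by (rule continuous_on_compose2[OF phi(1) Mc]) (use Mn in auto)
      moreover have "(\<phi> \<circ> M) holomorphic_on {t. norm (line_pt x v t) < 1}"
        by (rule holomorphic_on_compose_gen[OF Mh phi(2)]) (use Mn in auto)
      moreover have "norm ((F \<circ> proj_map k l d) (line_pt x v t) - (\<phi> \<circ> M) t) \<le> \<epsilon>"
        if "norm (line_pt x v t) = 1" for t
        using phi(3)[of "M t"] Mn[of t] that PM[OF nz[of t]] by (simp add: P_def)
      ultimately show ?thesis by (intro exI[of _ "\<phi> \<circ> M"]) (auto simp: o_def)
    qed
  qed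
qed

lemma proj_map_continuous:
  assumes "ball_aut k l d" "continuous_on (sphere 0 1) F"
  shows "continuous_on (sphere 0 1) (F \<circ> proj_map k l d)"
  unfolding o_def
proof (rule continuous_on_compose2[OF assms(2)])
  have nz: "aff d x \<noteq> 0" if "x \<in> sphere 0 1" for x
    using ball_aut_den[OF assms(1)] that by simp
  show "continuous_on (sphere 0 1) (proj_map k l d)"
    unfolding proj_map_def[abs_def]
    by (intro continuous_intros) (use nz in \<open>auto simp: aff_def[abs_def] intro!: continuous_intros\<close>)
  show "proj_map k l d ` sphere 0 1 \<subseteq> sphere 0 1"
    using ball_aut_norm[OF assms(1) nz] by auto
qed

section \<open>An area integral along the circles of a pencil\<close>

text \<open>
  The value of \<open>s\<close> at which the circle with centre \<open>s * \<alpha>\<close> and radius \<open>pencil_rad \<alpha> s\<close> has shrunk to a point.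
\<close>

definition pencil_len :: "complex \<Rightarrow> real" where
  "pencil_len \<alpha> = (if norm \<alpha> \<le> 1 then 1 else 1 / (norm \<alpha>)\<^sup>2)"

definition pencil_rad :: "complex \<Rightarrow> real \<Rightarrow> real" where
  "pencil_rad \<alpha> s = sqrt ((1 - s) * (1 - s * (norm \<alpha>)\<^sup>2))"

definition pencil_pt :: "complex \<Rightarrow> real \<Rightarrow> complex \<Rightarrow> complex" where
  "pencil_pt \<alpha> s u = of_real s * \<alpha> + of_real (pencil_rad \<alpha> s) * u"

text \<open>
  Minus twice the Jacobian determinant of \<open>(s, t) \<mapsto> pencil_pt \<alpha> s (cis t)\<close>.
\<close>

definition pencil_jac :: "complex \<Rightarrow> real \<Rightarrow> complex \<Rightarrow> real" where
  "pencil_jac \<alpha> s u = 1 + (norm \<alpha>)\<^sup>2 - 2 * s * (norm \<alpha>)\<^sup>2 - 2 * pencil_rad \<alpha> s * Re (cnj \<alpha> * u)"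

text \<open>
  Twice the planar area integral of \<open>\<psi>\<close> over the unit disc, in the coordinates given by the nested
  circles \<open>pencil_pt \<alpha> s\<close>.
\<close>

definition pencil_area :: "complex \<Rightarrow> (complex \<Rightarrow> complex) \<Rightarrow> complex" where
  "pencil_area \<alpha> \<psi> = integral {0..pencil_len \<alpha>} (\<lambda>s. circle_int (\<lambda>u. \<psi> (pencil_pt \<alpha> s u) * of_real (pencil_jac \<alpha> s u)))"

lemma pencil_len_bounds: "0 < pencil_len \<alpha>" "pencil_len \<alpha> \<le> 1" "pencil_len \<alpha> * (norm \<alpha>)\<^sup>2 \<le> 1"
proof -
  show "0 < pencil_len \<alpha>" "pencil_len \<alpha> \<le> 1"
    by (auto simp: pencil_len_def divide_le_eq)
  show "pencil_len \<alpha> * (norm \<alpha>)\<^sup>2 \<le> 1"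
    by (auto simp: pencil_len_def power_le_one_iff)
qed

lemma pencil_rad_sq:
  assumes "0 \<le> s" "s \<le> pencil_len \<alpha>"
  shows "(pencil_rad \<alpha> s)\<^sup>2 = (1 - s) * (1 - s * (norm \<alpha>)\<^sup>2)" "0 \<le> pencil_rad \<alpha> s"
proof -
  have "s * (norm \<alpha>)\<^sup>2 \<le> pencil_len \<alpha> * (norm \<alpha>)\<^sup>2" using assms by (intro mult_right_mono) auto
  then have "0 \<le> (1 - s) * (1 - s * (norm \<alpha>)\<^sup>2)"
    using assms pencil_len_bounds[of \<alpha>] by (intro mult_nonneg_nonneg) auto
  then show "(pencil_rad \<alpha> s)\<^sup>2 = (1 - s) * (1 - s * (norm \<alpha>)\<^sup>2)" "0 \<le> pencil_rad \<alpha> s"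
    by (simp_all add: pencil_rad_def)
qed

lemma pencil_rad_pos:
  assumes "0 \<le> s" "s < pencil_len \<alpha>"
  shows "(1 - s) * (1 - s * (norm \<alpha>)\<^sup>2) > 0" "pencil_rad \<alpha> s > 0"
proof -
  have "s * (norm \<alpha>)\<^sup>2 < 1"
  proof (cases "norm \<alpha> \<le> 1")
    case True
    then have "s * (norm \<alpha>)\<^sup>2 \<le> s * 1" using assms by (intro mult_left_mono) (auto simp: power_le_one_iff)
    then show ?thesis using assms pencil_len_bounds[of \<alpha>] by linarith
  next
    case False
    then have "norm \<alpha> > 0" by linarith
    then have "(norm \<alpha>)\<^sup>2 > 0" by simp
    then show ?thesis using assms False by (simp add: pencil_len_def field_simps)
  qed
  then show "(1 - s) * (1 - s * (norm \<alpha>)\<^sup>2) > 0"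
    using assms pencil_len_bounds[of \<alpha>] by (intro mult_pos_pos) auto
  then show "pencil_rad \<alpha> s > 0" by (simp add: pencil_rad_def)
qed

lemma pencil_rad_end: "pencil_rad \<alpha> (pencil_len \<alpha>) = 0"
proof (cases "norm \<alpha> \<le> 1")
  case False
  then have "norm \<alpha> > 0" by linarith
  then show ?thesis using False by (simp add: pencil_rad_def pencil_len_def)
qed (simp add: pencil_rad_def pencil_len_def)

lemma pencil_rad_le_1:
  assumes "0 \<le> s" "s \<le> pencil_len \<alpha>"
  shows "pencil_rad \<alpha> s \<le> 1"
proof -
  have "s * (norm \<alpha>)\<^sup>2 \<le> pencil_len \<alpha> * (norm \<alpha>)\<^sup>2" using assms by (intro mult_right_mono) auto
  then have "(1 - s) * (1 - s * (norm \<alpha>)\<^sup>2) \<le> 1 * 1"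
    using assms pencil_len_bounds[of \<alpha>] by (intro mult_mono) auto
  then show ?thesis by (simp add: pencil_rad_def)
qed

lemma continuous_on_pencil_rad [continuous_intros]:
  "continuous_on A f \<Longrightarrow> continuous_on A (\<lambda>x. pencil_rad \<alpha> (f x))"
  unfolding pencil_rad_def by (intro continuous_intros)

lemma continuous_on_pencil_pt [continuous_intros]:
  "continuous_on A f \<Longrightarrow> continuous_on A g \<Longrightarrow> continuous_on A (\<lambda>x. pencil_pt \<alpha> (f x) (g x))"
  unfolding pencil_pt_def by (intro continuous_intros)

lemma continuous_on_pencil_jac [continuous_intros]:
  "continuous_on A f \<Longrightarrow> continuous_on A g \<Longrightarrow> continuous_on A (\<lambda>x. pencil_jac \<alpha> (f x) (g x))"
  unfolding pencil_jac_def by (intro continuous_intros)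

lemma norm_add_sq_complex: "(norm (x + y))\<^sup>2 = (norm x)\<^sup>2 + (norm y)\<^sup>2 + 2 * Re (cnj x * y)" for x y :: complex
  unfolding cmod_power2 by (simp add: power2_eq_square algebra_simps)

text \<open>
  Together: \<open>1 - (norm z)\<^sup>2 = s / (1 - s) * (norm (z - \<alpha>))\<^sup>2\<close> for every point \<open>z\<close> of the circle, if \<open>s < 1\<close>.
  Therefore the circle is the projection of the part of the sphere in any line \<open>w = l * (z - \<alpha>)\<close> with
  \<open>(norm l)\<^sup>2 = s / (1 - s)\<close>.
\<close>

lemma pencil_identities:
  assumes s: "0 \<le> s" "s \<le> pencil_len \<alpha>" and u: "norm u = 1"
  shows "1 - (norm (pencil_pt \<alpha> s u))\<^sup>2 = s * pencil_jac \<alpha> s u"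
    "(1 - s) * pencil_jac \<alpha> s u = (norm (pencil_pt \<alpha> s u - \<alpha>))\<^sup>2"
proof -
  define A where "A = (norm \<alpha>)\<^sup>2"
  define r where "r = pencil_rad \<alpha> s"
  define c where "c = Re (cnj \<alpha> * u)"
  have r2: "r\<^sup>2 = (1 - s) * (1 - s * A)" using pencil_rad_sq(1)[OF s] by (simp add: r_def A_def)
  have rr: "r * r = (1 - s) * (1 - s * A)" using r2 by (simp add: power2_eq_square)
  have n1: "(norm (pencil_pt \<alpha> s u))\<^sup>2 = s\<^sup>2 * A + r\<^sup>2 + 2 * (s * r * c)"
    unfolding pencil_pt_def r_def[symmetric] norm_add_sq_complex
    by (simp add: norm_mult power_mult_distrib u A_def c_def algebra_simps)
  show "1 - (norm (pencil_pt \<alpha> s u))\<^sup>2 = s * pencil_jac \<alpha> s u"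
    unfolding n1 r2 pencil_jac_def A_def[symmetric] r_def[symmetric] c_def[symmetric]
    by (simp add: power2_eq_square algebra_simps)
  have "pencil_pt \<alpha> s u - \<alpha> = of_real (s - 1) * \<alpha> + of_real r * u"
    by (simp add: pencil_pt_def r_def algebra_simps)
  then have n2: "(norm (pencil_pt \<alpha> s u - \<alpha>))\<^sup>2 = (s - 1)\<^sup>2 * A + r\<^sup>2 + 2 * ((s - 1) * r * c)"
    unfolding norm_add_sq_complex by (simp only:) (simp add: norm_add_sq_complex norm_mult power_mult_distrib u A_def c_def algebra_simps del: of_real_diff)
  show "(1 - s) * pencil_jac \<alpha> s u = (norm (pencil_pt \<alpha> s u - \<alpha>))\<^sup>2"
    unfolding n2 r2 pencil_jac_def A_def[symmetric] r_def[symmetric] c_def[symmetric]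
    by (simp add: power2_eq_square algebra_simps)
qed

lemma pencil_jac_bounds:
  assumes s: "0 \<le> s" "s \<le> pencil_len \<alpha>" and u: "norm u = 1"
  shows "0 \<le> pencil_jac \<alpha> s u" "pencil_jac \<alpha> s u \<le> (1 + norm \<alpha>)\<^sup>2"
proof -
  have c: "\<bar>Re (cnj \<alpha> * u)\<bar> \<le> norm \<alpha>"
    using abs_Re_le_cmod[of "cnj \<alpha> * u"] u by (simp add: norm_mult)
  have r: "0 \<le> pencil_rad \<alpha> s" "pencil_rad \<alpha> s \<le> 1" using pencil_rad_sq(2)[OF s] pencil_rad_le_1[OF s] .
  show "0 \<le> pencil_jac \<alpha> s u"
  proof (cases "s = 1")
    case True
    have "norm \<alpha> \<le> 1"
    proof (rule ccontr)
      assume "\<not> norm \<alpha> \<le> 1"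
      then have "1 < (norm \<alpha>)\<^sup>2" by (simp add: one_less_power)
      then have "1 / (norm \<alpha>)\<^sup>2 < 1" by (subst divide_less_eq) auto
      then show False using s True \<open>\<not> norm \<alpha> \<le> 1\<close> by (simp add: pencil_len_def)
    qed
    then show ?thesis using True by (simp add: pencil_jac_def pencil_rad_def power_le_one_iff)
  next
    case False
    then have "1 - s > 0" using s pencil_len_bounds[of \<alpha>] by simp
    moreover have "(1 - s) * pencil_jac \<alpha> s u \<ge> 0" unfolding pencil_identities(2)[OF assms] by simp
    ultimately show ?thesis by (simp add: zero_le_mult_iff)
  qed
  have "- (pencil_rad \<alpha> s * Re (cnj \<alpha> * u)) \<le> \<bar>pencil_rad \<alpha> s * Re (cnj \<alpha> * u)\<bar>" by simp
  also have "\<dots> \<le> 1 * norm \<alpha>" unfolding abs_mult using r c by (intro mult_mono) auto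
  finally show "pencil_jac \<alpha> s u \<le> (1 + norm \<alpha>)\<^sup>2"
    using mult_nonneg_nonneg[OF s(1) zero_le_power2[of "norm \<alpha>"]]
    unfolding pencil_jac_def power2_sum mult.assoc by simp
qed

lemma pencil_pt_in_disc:
  assumes "0 \<le> s" "s \<le> pencil_len \<alpha>" "norm u = 1"
  shows "pencil_pt \<alpha> s u \<in> cball 0 1"
proof -
  have "(norm (pencil_pt \<alpha> s u))\<^sup>2 \<le> 1"
    using pencil_identities(1)[OF assms] pencil_jac_bounds(1)[OF assms] assms(1)
    by (smt (verit) mult_nonneg_nonneg)
  then show ?thesis by (simp add: power_le_one_iff abs_square_le_1)
qed

lemma pencil_integrand_continuous:
  fixes \<psi> :: "complex \<Rightarrow> complex"
  assumes "continuous_on (cball 0 1) \<psi>"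
  shows "continuous_on ({0..pencil_len \<alpha>} \<times> sphere 0 1)
           (\<lambda>(s, u). \<psi> (pencil_pt \<alpha> s u) * of_real (pencil_jac \<alpha> s u))"
  unfolding split_beta
  by (intro continuous_intros continuous_on_compose2[OF assms])
     (use pencil_pt_in_disc in auto)

lemma pencil_area_integrable:
  assumes "continuous_on (cball 0 1) \<psi>"
  shows "(\<lambda>s. circle_int (\<lambda>u. \<psi> (pencil_pt \<alpha> s u) * of_real (pencil_jac \<alpha> s u))) integrable_on {0..pencil_len \<alpha>}"
  by (intro integrable_continuous_real continuous_on_circle_int pencil_integrand_continuous assms)

lemma pencil_circle_continuous:
  fixes \<psi> :: "complex \<Rightarrow> complex"
  assumes "continuous_on (cball 0 1) \<psi>" "0 \<le> s" "s \<le> pencil_len \<alpha>"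
  shows "continuous_on (sphere 0 1) (\<lambda>u. \<psi> (pencil_pt \<alpha> s u) * of_real (pencil_jac \<alpha> s u))"
  by (intro continuous_intros continuous_on_compose2[OF assms(1)])
     (use assms pencil_pt_in_disc in auto)

lemma pencil_area_diff:
  assumes "continuous_on (cball 0 1) f" "continuous_on (cball 0 1) g"
  shows "pencil_area \<alpha> (\<lambda>z. f z - g z) = pencil_area \<alpha> f - pencil_area \<alpha> g"
proof -
  have "pencil_area \<alpha> (\<lambda>z. f z - g z) = integral {0..pencil_len \<alpha>} (\<lambda>s.
     circle_int (\<lambda>u. f (pencil_pt \<alpha> s u) * of_real (pencil_jac \<alpha> s u)) - circle_int (\<lambda>u. g (pencil_pt \<alpha> s u) * of_real (pencil_jac \<alpha> s u)))"
    unfolding pencil_area_def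
    by (intro integral_cong) (auto simp: left_diff_distrib intro!: circle_int_diff pencil_circle_continuous assms)
  also have "\<dots> = pencil_area \<alpha> f - pencil_area \<alpha> g"
    unfolding pencil_area_def by (intro integral_diff pencil_area_integrable assms)
  finally show ?thesis .
qed

lemma pencil_area_add:
  assumes "continuous_on (cball 0 1) f" "continuous_on (cball 0 1) g"
  shows "pencil_area \<alpha> (\<lambda>z. f z + g z) = pencil_area \<alpha> f + pencil_area \<alpha> g"
proof -
  have "pencil_area \<alpha> (\<lambda>z. f z + g z) = integral {0..pencil_len \<alpha>} (\<lambda>s.
     circle_int (\<lambda>u. f (pencil_pt \<alpha> s u) * of_real (pencil_jac \<alpha> s u)) + circle_int (\<lambda>u. g (pencil_pt \<alpha> s u) * of_real (pencil_jac \<alpha> s u)))"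
    unfolding pencil_area_def
    by (intro integral_cong) (auto simp: distrib_right intro!: circle_int_add pencil_circle_continuous assms)
  also have "\<dots> = pencil_area \<alpha> f + pencil_area \<alpha> g"
    unfolding pencil_area_def by (intro integral_add pencil_area_integrable assms)
  finally show ?thesis .
qed

lemma pencil_area_cmult: "pencil_area \<alpha> (\<lambda>z. c * f z) = c * pencil_area \<alpha> f"
  by (simp add: pencil_area_def mult.assoc circle_int_cmult)

lemma pencil_area_bound:
  assumes f: "continuous_on (cball 0 1) f" and B: "\<And>z. norm z \<le> 1 \<Longrightarrow> norm (f z) \<le> B"
  shows "norm (pencil_area \<alpha> f) \<le> 2 * pi * (1 + norm \<alpha>)\<^sup>2 * B"
proof -
  have B0: "B \<ge> 0" using order_trans[OF norm_ge_zero B[of 0]] by simp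
  have "norm (integral {0..pencil_len \<alpha>} (\<lambda>s. circle_int (\<lambda>u. f (pencil_pt \<alpha> s u) * of_real (pencil_jac \<alpha> s u))))
      \<le> (2 * pi * (B * (1 + norm \<alpha>)\<^sup>2)) * (pencil_len \<alpha> - 0)"
  proof (rule integral_bound)
    show "continuous_on {0..pencil_len \<alpha>} (\<lambda>s. circle_int (\<lambda>u. f (pencil_pt \<alpha> s u) * of_real (pencil_jac \<alpha> s u)))"
      by (intro continuous_on_circle_int pencil_integrand_continuous f)
    fix s assume s: "s \<in> {0..pencil_len \<alpha>}"
    show "norm (circle_int (\<lambda>u. f (pencil_pt \<alpha> s u) * of_real (pencil_jac \<alpha> s u))) \<le> 2 * pi * (B * (1 + norm \<alpha>)\<^sup>2)"
    proof (rule circle_int_bound)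
      show "continuous_on (sphere 0 1) (\<lambda>u. f (pencil_pt \<alpha> s u) * of_real (pencil_jac \<alpha> s u))"
        using s by (intro pencil_circle_continuous f) auto
      fix u :: complex assume "norm u = 1"
      then show "norm (f (pencil_pt \<alpha> s u) * of_real (pencil_jac \<alpha> s u)) \<le> B * (1 + norm \<alpha>)\<^sup>2"
        unfolding norm_mult using s pencil_jac_bounds[of s \<alpha> u] pencil_pt_in_disc[of s \<alpha> u] B0
        by (intro mult_mono B) auto
    qed
  qed (use pencil_len_bounds[of \<alpha>] in auto)
  also have "\<dots> \<le> (2 * pi * (B * (1 + norm \<alpha>)\<^sup>2)) * 1"
    using B0 pencil_len_bounds[of \<alpha>] by (intro mult_left_mono) auto
  finally show ?thesis by (simp add: pencil_area_def mult_ac)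
qed

lemma has_vector_derivative_power_complex:
  fixes f :: "real \<Rightarrow> complex"
  assumes "(f has_vector_derivative f') (at x)"
  shows "((\<lambda>x. f x ^ n) has_vector_derivative f' * (of_nat n * f x ^ (n - 1))) (at x)"
proof -
  have "((\<lambda>z. z ^ n) has_field_derivative (of_nat n * f x ^ (n - 1))) (at (f x))"
    by (auto intro!: derivative_eq_intros)
  from field_vector_diff_chain_at[OF assms this] show ?thesis by (simp add: o_def)
qed

lemma has_vector_derivative_cis: "(cis has_vector_derivative \<i> * cis t) (at t)"
  using has_derivative_cis[OF has_derivative_ident, of t UNIV] by (simp add: has_vector_derivative_def)

text \<open>
  The integrand identity behind \<open>pencil_flux_derivative\<close>, with \<open>e\<close>, \<open>ce\<close> for \<open>cis t\<close> and its conjugate, \<open>Z\<close>,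
  \<open>w * W\<close> for the powers of \<open>z\<close> and \<open>cnj z\<close>, and primes for derivatives.
\<close>

lemma flux_algebra:
  fixes e :: complex
  assumes "e * ce = 1"
  shows "-\<i> * (Z * (w * W) * (R' * (\<i> * e)) + (Z * ((R * (-\<i> * ce)) * (n * W)) + R * (\<i> * e) * Z' * (w * W)) * (a + R' * e))
     = ((a + R' * e) * Z' * (w * W) + Z * ((ca + R' * ce) * (n * W))) * (R * e) + Z * (w * W) * (R' * e)
       + n * (Z * W * (- (2 * (R * R')) - R * (ca * e + a * ce)))"
proof -
  have "ce * e = 1" "e * (ce * x) = x" "ce * (e * x) = x" for x
    using assms by (metis mult.commute, metis mult.assoc mult_1, metis mult.assoc mult.commute mult_1)
  then show ?thesis using assms by (simp add: algebra_simps)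
qed

text \<open>
  An instance of Stokes' theorem: \<open>z ^ m * cnj z ^ (n + 1) dz\<close> has differential
  \<open>(n + 1) * z ^ m * cnj z ^ n\<close> times a constant multiple of the area form, so the
  rate of change of its integral over the moving circle is an integral of \<open>z ^ m * cnj z ^ n\<close> against the Jacobian.  In coordinates, the sum of the
  two integrands is the derivative in \<open>t\<close> of a periodic function.
\<close>

lemma pencil_flux_derivative:
  assumes s: "0 < s" "s < pencil_len \<alpha>"
  shows "((\<lambda>s. circle_int (\<lambda>u. pencil_pt \<alpha> s u ^ m * cnj (pencil_pt \<alpha> s u) ^ Suc n * (of_real (pencil_rad \<alpha> s) * u)))
     has_vector_derivative - of_nat (Suc n) * circle_int (\<lambda>u. pencil_pt \<alpha> s u ^ m * cnj (pencil_pt \<alpha> s u) ^ n * of_real (pencil_jac \<alpha> s u))) (at s)"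
proof -
  define A where "A = (norm \<alpha>)\<^sup>2"
  define r where "r = pencil_rad \<alpha>"
  define r' where "r' s = (- (1 + A) + 2 * s * A) / (2 * r s)" for s
  define z where "z s t = of_real s * \<alpha> + of_real (r s) * cis t" for s t
  define zs where "zs s t = \<alpha> + of_real (r' s) * cis t" for s t
  define f where "f s t = z s t ^ m * cnj (z s t) ^ Suc n * (of_real (r s) * cis t)" for s t
  define fx where "fx s t = 
     (zs s t * (of_nat m * z s t ^ (m - 1)) * cnj (z s t) ^ Suc n
       + z s t ^ m * (cnj (zs s t) * (of_nat (Suc n) * cnj (z s t) ^ n))) * (of_real (r s) * cis t)
     + z s t ^ m * cnj (z s t) ^ Suc n * (of_real (r' s) * cis t)" for s t
  have rpos: "r s > 0" if "s \<in> {0<..<pencil_len \<alpha>}" for s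
    using pencil_rad_pos[of s \<alpha>] that by (simp add: r_def)
  have rd: "(r has_real_derivative r' s) (at s)" if "s \<in> {0<..<pencil_len \<alpha>}" for s
  proof -
    have p: "(1 - s) * (1 - s * A) > 0" using pencil_rad_pos(1)[of s \<alpha>] that by (simp add: A_def)
    have "((\<lambda>s. (1 - s) * (1 - s * A)) has_real_derivative (- (1 + A) + 2 * s * A)) (at s)"
      by (auto intro!: derivative_eq_intros simp: algebra_simps)
    from DERIV_chain2[OF DERIV_real_sqrt[OF p] this]
    have "((\<lambda>s. sqrt ((1 - s) * (1 - s * A))) has_real_derivative r' s) (at s)"
      unfolding r'_def r_def pencil_rad_def A_def[symmetric] by (simp add: field_simps)
    then show ?thesis by (simp add: r_def pencil_rad_def[abs_def] A_def)
  qed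
  have zd: "((\<lambda>s. z s t) has_vector_derivative zs s t) (at s)" if "s \<in> {0<..<pencil_len \<alpha>}" for s t
  proof -
    have "((\<lambda>s. of_real s * \<alpha> + of_real (r s) * cis t) has_vector_derivative
       (of_real s * 0 + of_real 1 * \<alpha>) + (of_real (r s) * 0 + of_real (r' s) * cis t)) (at s)"
      by (intro has_vector_derivative_add has_vector_derivative_mult has_vector_derivative_of_real rd that
          has_vector_derivative_const DERIV_ident)
    then show ?thesis by (simp add: z_def zs_def)
  qed
  have fd: "((\<lambda>s. f s t) has_vector_derivative fx s t) (at s)" if "s \<in> {0<..<pencil_len \<alpha>}" for s t
  proof -
    note z1 = has_vector_derivative_power_complex[OF zd[OF that, of t], of m]
    note z2 = has_vector_derivative_power_complex[OF has_vector_derivative_cnj[OF zd[OF that, of t]], of "Suc n"]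
    note rr = has_vector_derivative_mult[OF has_vector_derivative_of_real[OF rd[OF that], where 'a=complex] has_vector_derivative_const[of "cis t"]]
    show ?thesis
      using has_vector_derivative_mult[OF has_vector_derivative_mult[OF z1 z2] rr]
      unfolding f_def fx_def by (rule has_vector_derivative_eq_rhs) (simp add: algebra_simps)
  qed
  have rcont: "continuous_on B r" for B unfolding r_def[abs_def] by (intro continuous_intros)
  have zcont: "continuous_on (B \<times> C) (\<lambda>p. z (fst p) (snd p))" for B C
    unfolding z_def by (intro continuous_intros continuous_on_compose2[OF rcont[of UNIV]]) auto
  have r'cont: "continuous_on ({0<..<pencil_len \<alpha>} \<times> C) (\<lambda>p. r' (fst p))" for C :: "real set"
    unfolding r'_def by (intro continuous_intros continuous_on_compose2[OF rcont[of UNIV]]) (use rpos in \<open>force+\<close>)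
  have rcont': "continuous_on (B \<times> C) (\<lambda>p. r (fst p))" for B and C :: "real set"
    by (intro continuous_intros continuous_on_compose2[OF rcont[of UNIV]]) auto
  have zscont: "continuous_on ({0<..<pencil_len \<alpha>} \<times> C) (\<lambda>p. zs (fst p) (snd p))" for C
    unfolding zs_def by (intro continuous_intros r'cont)
  have fxcont: "continuous_on ({0<..<pencil_len \<alpha>} \<times> C) (\<lambda>(s, t). fx s t)" for C
    unfolding fx_def split_beta by (intro continuous_intros r'cont rcont' zcont zscont)
  have fcont: "continuous_on (B \<times> C) (\<lambda>(s, t). f s t)" for B C
    unfolding f_def split_beta by (intro continuous_intros rcont' zcont)
  have fcont1: "continuous_on C (f s)" for C s
    using continuous_on_compose2[OF fcont[of UNIV UNIV] continuous_on_Pair[OF continuous_on_const[of C s] continuous_on_id]]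
    by simp
  have deriv: "((\<lambda>s. integral (cbox 0 (2*pi)) (f s)) has_vector_derivative integral (cbox 0 (2*pi)) (fx s)) (at s within {0<..<pencil_len \<alpha>})"
  proof (rule leibniz_rule_vector_derivative)
    show "((\<lambda>x. f x t) has_vector_derivative fx x t) (at x within {0<..<pencil_len \<alpha>})" if "x \<in> {0<..<pencil_len \<alpha>}" for x t
      using fd[OF that] by (rule has_vector_derivative_at_within)
    show "f x integrable_on cbox 0 (2*pi)" for x
      by (rule integrable_continuous[OF fcont1])
  qed (use s fxcont in auto)
  have sS: "s \<in> {0<..<pencil_len \<alpha>}" using s by simp
  have deriv': "((\<lambda>s. integral {0..2*pi} (f s)) has_vector_derivative integral {0..2*pi} (fx s)) (at s)"
    using deriv unfolding has_vector_derivative_within_open[OF sS open_greaterThanLessThan] cbox_interval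
    by simp
  \<comment> \<open>Integrating the differential form along the circle, the rate of change has a boundary part and an
    area part; \<open>G\<close> is, up to a constant, the contraction of the form with the velocity \<open>zs\<close>.\<close>
  define G where "G t = -\<i> * (z s t ^ m * cnj (z s t) ^ Suc n * zs s t)" for t
  define h where "h t = z s t ^ m * cnj (z s t) ^ n * of_real (pencil_jac \<alpha> s (cis t))" for t
  have Gd: "(G has_vector_derivative fx s t + of_nat (Suc n) * h t) (at t)" for t
  proof -
    define e where "e = cis t"
    have ee: "e * cnj e = 1" by (simp add: e_def cis_cnj cis_mult)
    have jac: "of_real (pencil_jac \<alpha> s e) = - (2 * of_real (r s * r' s)) - of_real (r s) * (cnj \<alpha> * e + \<alpha> * cnj e)"
    proof -
      have "2 * (r s * r' s) = - (1 + A) + 2 * s * A" using rpos[OF sS] by (simp add: r'_def)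
      moreover have "cnj \<alpha> * e + \<alpha> * cnj e = of_real (2 * Re (cnj \<alpha> * e))"
        using complex_add_cnj[of "cnj \<alpha> * e"] by (simp add: mult.commute)
      ultimately show ?thesis
        unfolding pencil_jac_def A_def[symmetric] r_def[symmetric]
        by (simp add: complex_eq_iff algebra_simps)
    qed
    have zt: "((\<lambda>t. z s t) has_vector_derivative of_real (r s) * (\<i> * e)) (at t)"
      using has_vector_derivative_add[OF has_vector_derivative_const[of "of_real s * \<alpha>"]
          has_vector_derivative_mult[OF has_vector_derivative_const[of "of_real (r s)"] has_vector_derivative_cis]]
      by (simp add: z_def e_def)
    have zst: "((\<lambda>t. zs s t) has_vector_derivative of_real (r' s) * (\<i> * e)) (at t)"
      using has_vector_derivative_add[OF has_vector_derivative_const[of "\<alpha>"]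
          has_vector_derivative_mult[OF has_vector_derivative_const[of "of_real (r' s)"] has_vector_derivative_cis]]
      by (simp add: zs_def e_def)
    note z1 = has_vector_derivative_power_complex[OF zt, of m]
    note z2 = has_vector_derivative_power_complex[OF has_vector_derivative_cnj[OF zt], of "Suc n"]
    note GG = has_vector_derivative_mult[OF has_vector_derivative_const[of "-\<i>"] has_vector_derivative_mult[OF has_vector_derivative_mult[OF z1 z2] zst]]
    define Z where "Z = z s t ^ m"
    define Z' where "Z' = of_nat m * z s t ^ (m - 1)"
    define W where "W = cnj (z s t) ^ n"
    define w where "w = cnj (z s t)"
    define R where "R = complex_of_real (r s)"
    define R' where "R' = complex_of_real (r' s)"
    have zse: "zs s t = \<alpha> + R' * e" "cnj (zs s t) = cnj \<alpha> + R' * cnj e"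
      by (simp_all add: zs_def R'_def e_def)
    have fx: "fx s t = ((\<alpha> + R' * e) * Z' * (w * W) + Z * ((cnj \<alpha> + R' * cnj e) * (of_nat (Suc n) * W))) * (R * e)
       + Z * (w * W) * (R' * e)"
      unfolding fx_def zse by (simp add: Z_def Z'_def W_def w_def R_def R'_def e_def)
    have ht: "h t = Z * W * (- (2 * (R * R')) - R * (cnj \<alpha> * e + \<alpha> * cnj e))"
      unfolding h_def e_def[symmetric] jac by (simp add: Z_def W_def R_def R'_def)
    have "(G has_vector_derivative (-\<i> * (Z * (w * W) * (R' * (\<i> * e)) +
        (Z * ((R * (-\<i> * cnj e)) * (of_nat (Suc n) * W)) + R * (\<i> * e) * Z' * (w * W)) * (\<alpha> + R' * e)))) (at t)"
      using GG unfolding G_def zse by (simp add: Z_def Z'_def W_def w_def R_def R'_def)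
    then show ?thesis unfolding flux_algebra[OF ee, where ca = "cnj \<alpha>"] fx ht .
  qed
  have "((\<lambda>t. fx s t + of_nat (Suc n) * h t) has_integral G (2*pi) - G 0) {0..2*pi}"
    by (rule fundamental_theorem_of_calculus, simp, rule has_vector_derivative_at_within[OF Gd])
  moreover have "G (2*pi) = G 0" by (simp add: G_def z_def zs_def)
  ultimately have i0: "((\<lambda>t. fx s t + of_nat (Suc n) * h t) has_integral 0) {0..2*pi}" by simp
  have hcont: "continuous_on B h" for B
    unfolding h_def z_def by (intro continuous_intros)
  have "((\<lambda>t. of_nat (Suc n) * h t) has_integral of_nat (Suc n) * integral {0..2*pi} h) {0..2*pi}"
    by (intro has_integral_mult_right integrable_integral integrable_continuous_real hcont)
  from has_integral_diff[OF i0 this]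
  have "(fx s has_integral - of_nat (Suc n) * integral {0..2*pi} h) {0..2*pi}"
    by (simp add: algebra_simps)
  then have "integral {0..2*pi} (fx s) = - of_nat (Suc n) * integral {0..2*pi} h"
    by (rule integral_unique)
  then show ?thesis
    using deriv' by (simp add: circle_int_def f_def[abs_def] h_def[abs_def] z_def[abs_def] r_def pencil_pt_def)
qed

lemma circle_int_cnj_power: "n \<noteq> 0 \<Longrightarrow> circle_int (\<lambda>u. cnj u ^ n) = 0"
  using circle_int_cnj[of "\<lambda>u. u ^ n"] circle_int_power[of n] by (simp add: continuous_intros)

text \<open>
  By the flux formula the value is a difference of two boundary terms.  The one for the circle that has
  shrunk to a point is zero, and the other one belongs to the unit circle, for every \<open>\<alpha>\<close>.
\<close>

lemma pencil_area_monomial: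
  "pencil_area \<alpha> (\<lambda>z. z ^ m * cnj z ^ n) = (if m = n then of_real (2 * pi / real (Suc n)) else 0)"
proof -
  define P where "P s = circle_int (\<lambda>u. pencil_pt \<alpha> s u ^ m * cnj (pencil_pt \<alpha> s u) ^ Suc n * (of_real (pencil_rad \<alpha> s) * u))" for s
  define Q where "Q s = circle_int (\<lambda>u. pencil_pt \<alpha> s u ^ m * cnj (pencil_pt \<alpha> s u) ^ n * of_real (pencil_jac \<alpha> s u))" for s
  have Pc: "continuous_on {0..pencil_len \<alpha>} P"
    unfolding P_def[abs_def] by (rule continuous_on_circle_int) (unfold split_beta, intro continuous_intros)
  have Qi: "Q integrable_on {0..pencil_len \<alpha>}"
    unfolding Q_def[abs_def]
    by (rule pencil_area_integrable[of "\<lambda>z. z ^ m * cnj z ^ n"]) (intro continuous_intros)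
  have "((\<lambda>s. - of_nat (Suc n) * Q s) has_integral P (pencil_len \<alpha>) - P 0) {0..pencil_len \<alpha>}"
  proof (rule fundamental_theorem_of_calculus_interior)
    show "0 \<le> pencil_len \<alpha>" using pencil_len_bounds[of \<alpha>] by simp
    show "continuous_on {0..pencil_len \<alpha>} P" by (rule Pc)
    show "(P has_vector_derivative - of_nat (Suc n) * Q s) (at s)" if "s \<in> {0<..<pencil_len \<alpha>}" for s
      using pencil_flux_derivative[of s \<alpha> m n] that unfolding P_def[abs_def] Q_def by simp
  qed
  moreover have "((\<lambda>s. - of_nat (Suc n) * Q s) has_integral - of_nat (Suc n) * integral {0..pencil_len \<alpha>} Q) {0..pencil_len \<alpha>}"
    by (intro has_integral_mult_right integrable_integral Qi)
  ultimately have "- of_nat (Suc n) * integral {0..pencil_len \<alpha>} Q = P (pencil_len \<alpha>) - P 0"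
    by (metis has_integral_unique)
  moreover have "P (pencil_len \<alpha>) = 0" by (simp add: P_def pencil_rad_end)
  moreover have "P 0 = (if m = n then 2 * pi else 0)"
  proof -
    have "P 0 = circle_int (\<lambda>u. if m \<ge> n then u ^ (m - n) else cnj u ^ (n - m))"
      unfolding P_def
    proof (rule circle_int_cong)
      fix u :: complex assume u: "norm u = 1"
      have "u ^ m * (cnj u * cnj u ^ n) * u = u ^ m * cnj u ^ n"
        using u complex_norm_square[of u] by (simp add: mult_ac)
      then show "pencil_pt \<alpha> 0 u ^ m * cnj (pencil_pt \<alpha> 0 u) ^ Suc n * (of_real (pencil_rad \<alpha> 0) * u)
          = (if m \<ge> n then u ^ (m - n) else cnj u ^ (n - m))"
        using power_mult_cnj_power[OF u, of m n] by (simp add: pencil_pt_def pencil_rad_def)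
    qed
    also have "\<dots> = (if m = n then 2 * pi else 0)"
      using circle_int_power[of "m - n"] circle_int_cnj_power[of "n - m"] circle_int_const[of 1]
      by (cases m n rule: linorder_cases) auto
    finally show ?thesis .
  qed
  ultimately have "of_nat (Suc n) * integral {0..pencil_len \<alpha>} Q = (if m = n then 2 * pi else 0)"
    by (auto simp: algebra_simps minus_equation_iff[of "_ + _"])
  then have "integral {0..pencil_len \<alpha>} Q = (if m = n then 2 * pi else 0) / of_nat (Suc n)"
    by (simp add: field_simps del: of_nat_Suc)
  then show ?thesis
    unfolding pencil_area_def Q_def[abs_def] by (simp del: of_nat_Suc)
qed

text \<open>
  Polynomials in \<open>z\<close> and \<open>cnj z\<close>, closed under sums and products: the form in which
  Stone-Weierstrass approximants are compared with \<open>pencil_area_monomial\<close>.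
\<close>

inductive wirtinger_poly :: "(complex \<Rightarrow> complex) \<Rightarrow> bool" where
  mono: "wirtinger_poly (\<lambda>z. c * (z ^ m * cnj z ^ n))"
| add: "wirtinger_poly f \<Longrightarrow> wirtinger_poly g \<Longrightarrow> wirtinger_poly (\<lambda>z. f z + g z)"

lemma wirtinger_poly_mult:
  assumes "wirtinger_poly f" "wirtinger_poly g"
  shows "wirtinger_poly (\<lambda>z. f z * g z)"
  using assms
proof (induction f arbitrary: g)
  case (mono c m n)
  show ?case using mono
  proof (induction g)
    case (mono d k l)
    show ?case
      using wirtinger_poly.mono[of "c * d" "m + k" "n + l"] by (simp add: power_add mult_ac)
  next
    case (add f g)
    then show ?case using wirtinger_poly.add by (simp add: distrib_left)
  qed
next
  case (add f1 f2)
  then show ?case using wirtinger_poly.add by (simp add: distrib_right)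
qed

lemma wirtinger_poly_const: "wirtinger_poly (\<lambda>z. c)"
  using wirtinger_poly.mono[of c 0 0] by simp

lemma wirtinger_poly_cmult: "wirtinger_poly f \<Longrightarrow> wirtinger_poly (\<lambda>z. c * f z)"
  using wirtinger_poly_mult[OF wirtinger_poly_const] .

lemma wirtinger_poly_real:
  assumes "real_polynomial_function p"
  shows "wirtinger_poly (\<lambda>z. of_real (p z))"
  using assms
proof induction
  case (linear f)
  interpret f: bounded_linear f by fact
  have "f z = f 1 * Re z + f \<i> * Im z" for z
  proof -
    have "z = Re z *\<^sub>R 1 + Im z *\<^sub>R \<i>" by (simp add: complex_eq_iff)
    then have "f z = f (Re z *\<^sub>R 1 + Im z *\<^sub>R \<i>)" by (rule arg_cong)
    also have "\<dots> = Re z *\<^sub>R f 1 + Im z *\<^sub>R f \<i>" by (simp only: f.add f.scaleR)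
    finally show ?thesis by (simp add: mult.commute)
  qed
  moreover have "of_real (a * Re z + b * Im z) = (of_real a - \<i> * of_real b) / 2 * z + (of_real a + \<i> * of_real b) / 2 * cnj z" for z a b
    by (simp add: complex_eq_iff field_simps)
  ultimately have "of_real (f z) = (of_real (f 1) - \<i> * of_real (f \<i>)) / 2 * z + (of_real (f 1) + \<i> * of_real (f \<i>)) / 2 * cnj z" for z
    by metis
  then have "(\<lambda>z. of_real (f z)) = (\<lambda>z. (of_real (f 1) - \<i> * of_real (f \<i>)) / 2 * z + (of_real (f 1) + \<i> * of_real (f \<i>)) / 2 * cnj z)"
    by (intro ext)
  moreover have "wirtinger_poly (\<lambda>z. (of_real (f 1) - \<i> * of_real (f \<i>)) / 2 * z + (of_real (f 1) + \<i> * of_real (f \<i>)) / 2 * cnj z)"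
    using wirtinger_poly.add[OF wirtinger_poly.mono[of "(of_real (f 1) - \<i> * of_real (f \<i>)) / 2" 1 0]
        wirtinger_poly.mono[of "(of_real (f 1) + \<i> * of_real (f \<i>)) / 2" 0 1]] by simp
  ultimately show ?case by (simp only:)
qed (simp_all add: wirtinger_poly_const wirtinger_poly.add wirtinger_poly_mult)

lemma wirtinger_poly_continuous: "wirtinger_poly f \<Longrightarrow> continuous_on A f"
  by (induction rule: wirtinger_poly.induct) (auto intro!: continuous_intros)

lemma polynomial_function_wirtinger:
  fixes p :: "complex \<Rightarrow> complex"
  assumes "polynomial_function p"
  shows "wirtinger_poly p"
proof -
  have "real_polynomial_function (\<lambda>z. Re (p z))" "real_polynomial_function (\<lambda>z. Im (p z))"
    using assms unfolding polynomial_function_def by (auto simp: o_def bounded_linear_Re bounded_linear_Im)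
  then have "wirtinger_poly (\<lambda>z. of_real (Re (p z)) + \<i> * of_real (Im (p z)))"
    by (intro wirtinger_poly.add wirtinger_poly_cmult wirtinger_poly_real)
  then show ?thesis by (simp flip: complex_eq)
qed

lemma pencil_area_wirtinger: "wirtinger_poly f \<Longrightarrow> pencil_area \<alpha> f = pencil_area \<beta> f"
proof (induction rule: wirtinger_poly.induct)
  case (mono c m n)
  show ?case unfolding pencil_area_cmult pencil_area_monomial ..
next
  case (add f g)
  then show ?case by (subst (1 2) pencil_area_add) (auto intro: wirtinger_poly_continuous)
qed

theorem pencil_area_independent:
  assumes f: "continuous_on (cball 0 1) f"
  shows "pencil_area \<alpha> f = pencil_area \<beta> f"
proof -
  define C where "C = 2 * pi * (1 + norm \<alpha>)\<^sup>2 + 2 * pi * (1 + norm \<beta>)\<^sup>2"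
  have C: "C > 0" 
  proof -
    have "(1 + norm \<alpha>)\<^sup>2 > 0" "(1 + norm \<beta>)\<^sup>2 > 0"
      by (rule zero_less_power, rule add_pos_nonneg, simp, simp)+
    then show ?thesis unfolding C_def by (intro add_pos_pos) simp_all
  qed
  have "norm (pencil_area \<alpha> f - pencil_area \<beta> f) \<le> 0 + e" if e: "e > 0" for e
  proof -
    obtain g where g: "polynomial_function g" "\<And>z. z \<in> cball 0 1 \<Longrightarrow> norm (f z - g z) < e / C"
      using Stone_Weierstrass_polynomial_function[OF compact_cball f, of "e / C"] e C by auto
    have w: "wirtinger_poly g" using g(1) by (rule polynomial_function_wirtinger)
    have gc: "continuous_on (cball 0 1) g" using w by (rule wirtinger_poly_continuous)
    have b: "norm (pencil_area \<gamma> f - pencil_area \<gamma> g) \<le> 2 * pi * (1 + norm \<gamma>)\<^sup>2 * (e / C)" for \<gamma>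
      unfolding pencil_area_diff[OF f gc, symmetric]
      by (rule pencil_area_bound) (use g(2) in \<open>auto intro!: continuous_intros f gc less_imp_le\<close>)
    have "pencil_area \<alpha> f - pencil_area \<beta> f = (pencil_area \<alpha> f - pencil_area \<alpha> g) - (pencil_area \<beta> f - pencil_area \<beta> g)"
      using pencil_area_wirtinger[OF w, of \<alpha> \<beta>] by simp
    also have "norm \<dots> \<le> 2 * pi * (1 + norm \<alpha>)\<^sup>2 * (e / C) + 2 * pi * (1 + norm \<beta>)\<^sup>2 * (e / C)"
      using b[of \<alpha>] b[of \<beta>] norm_triangle_ineq4 order_trans add_mono by meson
    also have "\<dots> = C * (e / C)" by (simp only: C_def distrib_right)
    also have "\<dots> = e" using C by simp
    finally show ?thesis by simp
  qed
  then have "norm (pencil_area \<alpha> f - pencil_area \<beta> f) \<le> 0" by (rule field_le_epsilon)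
  then show ?thesis by simp
qed

section \<open>Functions holomorphic off a ray\<close>

text \<open>
  The plane cut along the ray swept out by the points \<open>1 / (s * \<alpha>)\<close> with \<open>0 < s \<le> 1\<close>; for \<open>\<alpha> = 0\<close> it is the
  whole plane.
\<close>

definition off_ray :: "complex \<Rightarrow> complex set" where
  "off_ray \<alpha> = {\<xi>. \<not> (Re (\<alpha> * \<xi>) \<ge> 1 \<and> Im (\<alpha> * \<xi>) = 0)}"

text \<open>
  A superposition of poles of order at most \<open>N\<close> at the points \<open>1 / (s * \<alpha>)\<close>, hence holomorphic off the ray.
\<close>

definition ray_int :: "(nat \<Rightarrow> real \<Rightarrow> complex) \<Rightarrow> complex \<Rightarrow> real \<Rightarrow> nat \<Rightarrow> complex \<Rightarrow> complex" where
  "ray_int A \<alpha> S N \<xi> = (\<Sum>q<N. integral {0..S} (\<lambda>s. A q s * \<xi> ^ q / (1 - of_real s * \<alpha> * \<xi>) ^ Suc q))"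

lemma open_off_ray: "open (off_ray \<alpha>)"
proof -
  have "closed {\<xi>. Re (\<alpha> * \<xi>) \<ge> 1 \<and> Im (\<alpha> * \<xi>) = 0}"
    by (intro closed_Collect_conj closed_Collect_le closed_Collect_eq continuous_intros)
  then have "open (- {\<xi>. Re (\<alpha> * \<xi>) \<ge> 1 \<and> Im (\<alpha> * \<xi>) = 0})" by (rule open_Compl)
  then show ?thesis unfolding off_ray_def Collect_neg_eq .
qed

lemma off_ray_0: "0 \<in> off_ray \<alpha>" by (simp add: off_ray_def)

lemma off_ray_scale:
  assumes "\<xi> \<in> off_ray \<alpha>" "0 \<le> t" "t \<le> 1"
  shows "of_real t * \<xi> \<in> off_ray \<alpha>"
proof (rule ccontr)
  assume "of_real t * \<xi> \<notin> off_ray \<alpha>"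
  then have h: "t * Re (\<alpha> * \<xi>) \<ge> 1" "t * Im (\<alpha> * \<xi>) = 0"
    by (auto simp: off_ray_def algebra_simps)
  then have "t > 0" using assms(2) by (cases "t = 0") auto
  then have "Re (\<alpha> * \<xi>) > 0" using h(1) by (smt (verit) zero_less_mult_pos)
  then have "t * Re (\<alpha> * \<xi>) \<le> 1 * Re (\<alpha> * \<xi>)" using assms(3) by (intro mult_right_mono) auto
  then have "Re (\<alpha> * \<xi>) \<ge> 1" "Im (\<alpha> * \<xi>) = 0" using h \<open>t > 0\<close> by auto
  then show False using assms(1) by (simp add: off_ray_def)
qed

lemma off_ray_nonzero:
  assumes "\<xi> \<in> off_ray \<alpha>" "0 \<le> s" "s \<le> 1"
  shows "1 - of_real s * \<alpha> * \<xi> \<noteq> 0"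
proof
  assume "1 - of_real s * \<alpha> * \<xi> = 0"
  then have "\<alpha> * (of_real s * \<xi>) = 1" by (simp add: mult_ac)
  moreover have "of_real s * \<xi> \<in> off_ray \<alpha>" using off_ray_scale[OF assms] .
  ultimately show False by (simp add: off_ray_def del: times_complex.sel)
qed

lemma connected_off_rays: "connected (off_ray \<alpha> \<inter> off_ray \<beta>)"
proof (rule starlike_imp_connected)
  show "starlike (off_ray \<alpha> \<inter> off_ray \<beta>)"
    unfolding starlike_def
  proof (intro bexI ballI)
    show "0 \<in> off_ray \<alpha> \<inter> off_ray \<beta>" by (simp add: off_ray_0)
    fix x assume x: "x \<in> off_ray \<alpha> \<inter> off_ray \<beta>"
    show "closed_segment 0 x \<subseteq> off_ray \<alpha> \<inter> off_ray \<beta>"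
      using x off_ray_scale by (auto simp: closed_segment_def scaleR_conv_of_real)
  qed
qed

lemma ray_int_holomorphic:
  assumes A: "\<And>q. q < N \<Longrightarrow> continuous_on {0..S} (A q)" and S: "S \<le> 1"
  shows "ray_int A \<alpha> S N holomorphic_on off_ray \<alpha>"
proof -
  have "(\<lambda>\<xi>. integral (cbox 0 S) (\<lambda>s. A q s * \<xi> ^ q / (1 - of_real s * \<alpha> * \<xi>) ^ Suc q)) holomorphic_on U"
    if q: "q < N" and U: "convex U" "U \<subseteq> off_ray \<alpha>" for q U
  proof -
    define D where "D \<xi> s = (A q s * (of_nat q * \<xi> ^ (q - 1)) * (1 - of_real s * \<alpha> * \<xi>) ^ Suc q -
        A q s * \<xi> ^ q * (of_nat (Suc q) * (1 - of_real s * \<alpha> * \<xi>) ^ q * (- (of_real s * \<alpha>))))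
         / ((1 - of_real s * \<alpha> * \<xi>) ^ Suc q * (1 - of_real s * \<alpha> * \<xi>) ^ Suc q)" for \<xi> :: complex and s :: real
    have nz: "1 - of_real s * \<alpha> * \<xi> \<noteq> 0" if "\<xi> \<in> U" "s \<in> {0..S}" for \<xi> s
      using off_ray_nonzero[of \<xi> \<alpha> s] that U S by auto
    show ?thesis
    proof (rule leibniz_rule_holomorphic[of U 0 S _ D])
      fix \<xi> :: complex and s :: real
      assume h: "\<xi> \<in> U" "s \<in> cbox 0 S"
      have "1 - of_real s * \<alpha> * \<xi> \<noteq> 0" using nz h by simp
      then show "((\<lambda>\<xi>. A q s * \<xi> ^ q / (1 - of_real s * \<alpha> * \<xi>) ^ Suc q) has_field_derivative D \<xi> s) (at \<xi> within U)"
        unfolding D_def by (auto intro!: derivative_eq_intros simp del: power_Suc)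
    next
      fix \<xi> assume "\<xi> \<in> U"
      have "continuous_on {0..S} (\<lambda>s. A q s * \<xi> ^ q / (1 - of_real s * \<alpha> * \<xi>) ^ Suc q)"
        by (intro continuous_intros A q) (use nz[OF \<open>\<xi> \<in> U\<close>] in auto)
      then show "(\<lambda>s. A q s * \<xi> ^ q / (1 - of_real s * \<alpha> * \<xi>) ^ Suc q) integrable_on cbox 0 S"
        by (simp add: integrable_continuous_real)
    next
      have Ac: "continuous_on (U \<times> cbox 0 S) (\<lambda>p. A q (snd p))"
        by (rule continuous_on_compose2[OF A[OF q]]) (auto intro!: continuous_intros)
      show "continuous_on (U \<times> cbox 0 S) (\<lambda>(\<xi>, s). D \<xi> s)"
        unfolding D_def split_beta by (intro continuous_intros Ac) (use nz in auto)
    qed (use U in auto)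
  qed
  then have loc: "ray_int A \<alpha> S N holomorphic_on U" if "convex U" "U \<subseteq> off_ray \<alpha>" for U
    unfolding ray_int_def[abs_def] using that by (intro holomorphic_on_sum) auto
  show ?thesis
    unfolding holomorphic_on_open[OF open_off_ray]
  proof
    fix \<xi> assume "\<xi> \<in> off_ray \<alpha>"
    then obtain e where e: "e > 0" "ball \<xi> e \<subseteq> off_ray \<alpha>" using open_off_ray by (meson open_contains_ball)
    have "ray_int A \<alpha> S N holomorphic_on ball \<xi> e" using e by (intro loc) auto
    then show "\<exists>f'. (ray_int A \<alpha> S N has_field_derivative f') (at \<xi>)"
      using e(1) holomorphic_on_open[OF open_ball] by (metis centre_in_ball)
  qed
qed

text \<open>
  The unit vectors in the directions of \<open>\<alpha>\<close> and \<open>\<beta>\<close> differ, so \<open>\<alpha> * \<xi>\<close> and \<open>\<beta> * \<xi>\<close> are never both close in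
  direction to the positive real axis; and for \<open>T\<close> outside a sector about that axis, \<open>norm (1 - T)\<close> is
  comparable to \<open>1 + norm T\<close>.
\<close>

lemma ray_alternative:
  assumes ab: "Im (\<alpha> * cnj \<beta>) \<noteq> 0"
  obtains \<kappa> where "\<kappa> > 0"
    "\<And>\<xi>. (\<forall>s. 0 \<le> s \<longrightarrow> s \<le> 1 \<longrightarrow> norm (1 - of_real s * \<alpha> * \<xi>) \<ge> \<kappa> * (1 + s * norm \<xi>)) \<or>
          (\<forall>s. 0 \<le> s \<longrightarrow> s \<le> 1 \<longrightarrow> norm (1 - of_real s * \<beta> * \<xi>) \<ge> \<kappa> * (1 + s * norm \<xi>))"
proof -
  have nz: "\<alpha> \<noteq> 0" "\<beta> \<noteq> 0" using ab by auto
  define a where "a = \<alpha> / of_real (norm \<alpha>)"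
  define b where "b = \<beta> / of_real (norm \<beta>)"
  have na: "norm a = 1" "norm b = 1" "\<alpha> = of_real (norm \<alpha>) * a" "\<beta> = of_real (norm \<beta>) * b"
    using nz by (simp_all add: a_def b_def norm_divide)
  have "a \<noteq> b"
  proof
    assume "a = b"
    then have "\<alpha> * cnj \<beta> = of_real (norm \<alpha> * norm \<beta>) * (b * cnj b)"
      using na(3,4) by (metis (no_types, opaque_lifting) complex_cnj_complex_of_real complex_cnj_mult mult.assoc mult.left_commute of_real_mult)
    also have "\<dots> = of_real (norm \<alpha> * norm \<beta>)" using na(2) complex_norm_square[of b] by simp
    finally show False using ab by (metis Im_complex_of_real)
  qed
  \<comment> \<open>If both \<open>a * x\<close> and \<open>b * x\<close> had real part above \<open>1 - d\<close> for a unit vector \<open>x\<close>, then \<open>(norm (a - b))\<^sup>2 < 8 * d\<close>.\<close>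
  define d where "d = (norm (a - b))\<^sup>2 / 8"
  have d: "d > 0" "d \<le> 1/2"
  proof -
    show "d > 0" using \<open>a \<noteq> b\<close> by (simp add: d_def)
    have "norm (a - b) \<le> 2" using norm_triangle_ineq4[of a b] na by simp
    then have "(norm (a - b))\<^sup>2 \<le> 2\<^sup>2" by (intro power_mono) auto
    then show "d \<le> 1/2" by (simp add: d_def)
  qed
  define \<kappa> where "\<kappa> = sqrt (d / 2) * min 1 (min (norm \<alpha>) (norm \<beta>))"
  have kpos: "\<kappa> > 0" using d nz by (simp add: \<kappa>_def)
  have dir: "Re (a * \<xi>) \<le> (1 - d) * norm \<xi> \<or> Re (b * \<xi>) \<le> (1 - d) * norm \<xi>" for \<xi>
  proof (rule ccontr)
    assume "\<not> ?thesis"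
    then have h: "Re (a * \<xi>) > (1 - d) * norm \<xi>" "Re (b * \<xi>) > (1 - d) * norm \<xi>" by auto
    then have "\<xi> \<noteq> 0" by auto
    define x where "x = \<xi> / of_real (norm \<xi>)"
    have x: "norm x = 1" "\<xi> = of_real (norm \<xi>) * x" using \<open>\<xi> \<noteq> 0\<close> by (simp_all add: x_def norm_divide)
    have r: "Re (c * \<xi>) = norm \<xi> * Re (c * x)" for c
    proof -
      have e: "c * \<xi> = of_real (norm \<xi>) * (c * x)" using x(2) by (metis mult.left_commute)
      have "Re (of_real t * w) = t * Re w" for t w by simp
      then show ?thesis by (simp only: e)
    qed
    have hx: "Re (a * x) > 1 - d" "Re (b * x) > 1 - d"
      using h \<open>\<xi> \<noteq> 0\<close> unfolding r by (simp_all add: mult.commute[of "norm \<xi>"])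
    have sq: "(norm (c - 1))\<^sup>2 < 2 * d" if "norm c = 1" "Re c > 1 - d" for c
    proof -
      have "(norm (c - 1))\<^sup>2 = (norm c)\<^sup>2 + 1 - 2 * Re c"
        unfolding cmod_power2 by (simp add: power2_eq_square algebra_simps)
      then show ?thesis using that by simp
    qed
    have "norm (a - b) = norm (a * x - b * x)" using x(1) by (metis left_diff_distrib mult.right_neutral norm_mult)
    also have "\<dots> \<le> norm (a * x - 1) + norm (b * x - 1)"
      using norm_triangle_ineq4[of "a * x - 1" "b * x - 1"] by simp
    finally have "(norm (a - b))\<^sup>2 \<le> (norm (a * x - 1) + norm (b * x - 1))\<^sup>2" by (intro power_mono) auto
    also have "\<dots> \<le> 2 * (norm (a * x - 1))\<^sup>2 + 2 * (norm (b * x - 1))\<^sup>2"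
      using zero_le_power2[of "norm (a * x - 1) - norm (b * x - 1)"] by (simp add: power2_eq_square algebra_simps)
    also have "\<dots> < 2 * (2 * d) + 2 * (2 * d)"
      using sq[of "a * x"] sq[of "b * x"] hx na x by (simp add: norm_mult)
    finally show False by (simp add: d_def)
  qed
  have low: "\<kappa> * (1 + s * norm \<xi>) \<le> norm (1 - of_real s * \<gamma> * \<xi>)"
    if s: "0 \<le> s" "s \<le> 1" and g: "\<gamma> = of_real (norm \<gamma>) * c" "min (norm \<alpha>) (norm \<beta>) \<le> norm \<gamma>" "norm c = 1"
      and D: "Re (c * \<xi>) \<le> (1 - d) * norm \<xi>" for s \<gamma> c \<xi>
  proof -
    define T where "T = s * norm \<gamma> * norm \<xi>"
    have T: "T \<ge> 0" using s by (simp add: T_def)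
    have "Re (of_real s * \<gamma> * \<xi>) = s * norm \<gamma> * Re (c * \<xi>)"
    proof -
      have "of_real s * \<gamma> * \<xi> = of_real (s * norm \<gamma>) * (c * \<xi>)"
        by (subst g(1)) (simp only: of_real_mult mult_ac)
      moreover have "Re (of_real t * w) = t * Re w" for t w by simp
      ultimately show ?thesis by (simp only:)
    qed
    also have "\<dots> \<le> s * norm \<gamma> * ((1 - d) * norm \<xi>)" using D s by (intro mult_left_mono) auto
    finally have re: "Re (of_real s * \<gamma> * \<xi>) \<le> (1 - d) * T" by (simp add: T_def mult_ac)
    have "(norm (1 - of_real s * \<gamma> * \<xi>))\<^sup>2 = 1 - 2 * Re (of_real s * \<gamma> * \<xi>) + (norm (of_real s * \<gamma> * \<xi>))\<^sup>2"
      unfolding cmod_power2 by (simp add: power2_eq_square algebra_simps)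
    also have "norm (of_real s * \<gamma> * \<xi>) = T" using s by (simp add: T_def norm_mult)
    finally have "(norm (1 - of_real s * \<gamma> * \<xi>))\<^sup>2 \<ge> 1 - 2 * ((1 - d) * T) + T\<^sup>2" using re by linarith
    \<comment> \<open>This difference is a nonnegative multiple of \<open>(1 - T)\<^sup>2\<close>.\<close>
    moreover have "1 - 2 * ((1 - d) * T) + T\<^sup>2 - d / 2 * (1 + T)\<^sup>2 = (1 - d) * (1 - T)\<^sup>2 + d / 2 * (1 - T)\<^sup>2"
      by (simp add: power2_eq_square algebra_simps)
    moreover have "(1 - d) * (1 - T)\<^sup>2 + d / 2 * (1 - T)\<^sup>2 \<ge> 0" using d by simp
    ultimately have "d / 2 * (1 + T)\<^sup>2 \<le> (norm (1 - of_real s * \<gamma> * \<xi>))\<^sup>2" by linarith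
    then have "sqrt (d / 2 * (1 + T)\<^sup>2) \<le> norm (1 - of_real s * \<gamma> * \<xi>)"
      by (rule real_le_lsqrt[rotated 1]) (use d in auto)
    then have l: "sqrt (d / 2) * (1 + T) \<le> norm (1 - of_real s * \<gamma> * \<xi>)"
      unfolding real_sqrt_mult using T by simp
    have "min 1 (min (norm \<alpha>) (norm \<beta>)) * (1 + s * norm \<xi>) \<le> 1 + T"
    proof -
      have "min 1 (min (norm \<alpha>) (norm \<beta>)) * (s * norm \<xi>) \<le> norm \<gamma> * (s * norm \<xi>)"
        using g(2) s by (intro mult_right_mono) auto
      then have "min 1 (min (norm \<alpha>) (norm \<beta>)) * 1 + min 1 (min (norm \<alpha>) (norm \<beta>)) * (s * norm \<xi>) \<le> 1 + norm \<gamma> * (s * norm \<xi>)"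
        by (intro add_mono) auto
      then show ?thesis unfolding distrib_left T_def by (simp add: mult_ac)
    qed
    then have "\<kappa> * (1 + s * norm \<xi>) \<le> sqrt (d / 2) * (1 + T)"
      unfolding \<kappa>_def mult.assoc using d by (intro mult_left_mono) auto
    then show ?thesis using l by linarith
  qed
  show ?thesis
  proof (rule that[OF kpos])
    fix \<xi>
    show "(\<forall>s. 0 \<le> s \<longrightarrow> s \<le> 1 \<longrightarrow> norm (1 - of_real s * \<alpha> * \<xi>) \<ge> \<kappa> * (1 + s * norm \<xi>)) \<or>
          (\<forall>s. 0 \<le> s \<longrightarrow> s \<le> 1 \<longrightarrow> norm (1 - of_real s * \<beta> * \<xi>) \<ge> \<kappa> * (1 + s * norm \<xi>))"
      using dir[of \<xi>]
    proof
      assume "Re (a * \<xi>) \<le> (1 - d) * norm \<xi>"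
      then show ?thesis using low[OF _ _ na(3) _ na(1)] by auto
    next
      assume "Re (b * \<xi>) \<le> (1 - d) * norm \<xi>"
      then show ?thesis using low[OF _ _ na(4) _ na(2)] by auto
    qed
  qed
qed

text \<open>
  Since \<open>sqrt (s * X) ^ k \<le> sqrt (1 + s * X)\<close>, the integrand is at most
  \<open>X ^ q / sqrt X ^ k * (1 + s * X) powr (- q - 1/2)\<close>.  For \<open>q \<ge> 1\<close> the integral of the last factor is at most
  \<open>2 / X\<close>: this brings the exponent \<open>q \<le> M + 1\<close> down to \<open>M\<close>.
\<close>

lemma ray_weight_bound:
  assumes h: "0 \<le> S" "S \<le> 1" "X \<ge> 1" "k \<le> 1" "q \<le> Suc M"
  shows "\<exists>g. g integrable_on {0..S} \<and> (\<forall>s\<in>{0..S}. sqrt s ^ k * X ^ q / (1 + s * X) ^ Suc q \<le> g s)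
     \<and> integral {0..S} g \<le> 2 * X ^ M / sqrt X ^ k"
proof -
  have pw: "sqrt s ^ k * X ^ q / (1 + s * X) ^ Suc q \<le> X ^ q / sqrt X ^ k * (sqrt (1 + s * X) / (1 + s * X) ^ Suc q)"
    if s: "s \<ge> 0" for s
  proof -
    have Y: "1 + s * X \<ge> 1" using s h by simp
    have "sqrt s ^ k * sqrt X ^ k = sqrt (s * X) ^ k" by (simp add: real_sqrt_mult power_mult_distrib)
    also have "\<dots> \<le> sqrt (1 + s * X) ^ k" using s h by (intro power_mono) auto
    also have "\<dots> \<le> sqrt (1 + s * X) ^ 1" using Y h by (intro power_increasing) auto
    finally have "sqrt s ^ k \<le> sqrt (1 + s * X) / sqrt X ^ k" using h by (simp add: field_simps)
    then have "sqrt s ^ k * (X ^ q / (1 + s * X) ^ Suc q) \<le> sqrt (1 + s * X) / sqrt X ^ k * (X ^ q / (1 + s * X) ^ Suc q)"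
      using Y h by (intro mult_right_mono) auto
    then show ?thesis by (simp add: mult_ac)
  qed
  show ?thesis
  proof (cases q)
    case 0
    have "sqrt s ^ k * X ^ q / (1 + s * X) ^ Suc q \<le> 1 / sqrt X ^ k" if "s \<in> {0..S}" for s
    proof -
      have Y: "1 + s * X \<ge> 1" using that h by simp
      then have "sqrt (1 + s * X) \<le> 1 + s * X"
        by (intro real_le_lsqrt) (auto simp: power2_eq_square)
      then have "sqrt (1 + s * X) / (1 + s * X) \<le> 1" using Y by simp
      then have "1 / sqrt X ^ k * (sqrt (1 + s * X) / (1 + s * X)) \<le> 1 / sqrt X ^ k * 1"
        using h by (intro mult_left_mono) auto
      then show ?thesis using pw[of s] that 0 by simp
    qed
    moreover have "integral {0..S} (\<lambda>s. 1 / sqrt X ^ k) \<le> 2 * X ^ M / sqrt X ^ k"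
    proof -
      have "S * (1 / sqrt X ^ k) \<le> (2 * X ^ M) * (1 / sqrt X ^ k)"
        using h one_le_power[of X M] by (intro mult_right_mono) (linarith, simp)
      then show ?thesis using h by simp
    qed
    ultimately show ?thesis by (intro exI[of _ "\<lambda>s. 1 / sqrt X ^ k"]) auto
  next
    case (Suc p)
    define c where "c = X ^ q / sqrt X ^ k"
    define g where "g s = c * (1 / ((1 + s * X) * sqrt (1 + s * X)))" for s
    define G where "G s = c * (- 2 / X / sqrt (1 + s * X))" for s
    have gi: "(g has_integral (G S - G 0)) {0..S}"
    proof (rule fundamental_theorem_of_calculus)
      show "0 \<le> S" by fact
      fix s assume s: "s \<in> {0..S}"
      then have Y: "1 + s * X > 0" using h by (auto intro: add_pos_nonneg)
      have "((\<lambda>s. 1 + s * X) has_real_derivative X) (at s)"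
        by (auto intro!: derivative_eq_intros)
      note D = DERIV_inverse'[OF DERIV_chain2[OF DERIV_real_sqrt[OF Y] this]]
      have "((\<lambda>s. inverse (sqrt (1 + s * X))) has_real_derivative - (X / (2 * ((1 + s * X) * sqrt (1 + s * X))))) (at s)"
      proof (rule DERIV_cong[OF D])
        define R where "R = sqrt (1 + s * X)"
        have R: "R > 0" "1 + s * X = R * R" using Y by (simp_all add: R_def)
        show "- (inverse (sqrt (1 + s * X)) * (inverse (sqrt (1 + s * X)) / 2 * X) * inverse (sqrt (1 + s * X))) =
            - (X / (2 * ((1 + s * X) * sqrt (1 + s * X))))"
          unfolding R_def[symmetric] unfolding R(2) by (simp only: divide_inverse inverse_mult_distrib mult_ac)
      qed (use Y in simp)
      from DERIV_cmult[OF this, of "c * (- 2 / X)"]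
      have "((\<lambda>s. c * (- 2 / X) * inverse (sqrt (1 + s * X))) has_real_derivative g s) (at s)"
      proof (rule DERIV_cong)
        define W where "W = (1 + s * X) * sqrt (1 + s * X)"
        show "c * (- 2 / X) * - (X / (2 * ((1 + s * X) * sqrt (1 + s * X)))) = g s"
          unfolding g_def W_def[symmetric] using h by simp
      qed
      moreover have "(\<lambda>s. c * (- 2 / X) * inverse (sqrt (1 + s * X))) = G"
        unfolding G_def[abs_def] by (simp only: divide_inverse mult_ac)
      ultimately have "(G has_real_derivative g s) (at s)" by simp
      then show "(G has_vector_derivative g s) (at s within {0..S})"
        by (simp add: has_real_derivative_iff_has_vector_derivative has_vector_derivative_at_within)
    qed
    have "sqrt s ^ k * X ^ q / (1 + s * X) ^ Suc q \<le> g s" if s: "s \<in> {0..S}" for s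
    proof -
      have Y: "1 + s * X \<ge> 1" using that h by simp
      define Y where "Y = 1 + s * X"
      have Y1: "Y \<ge> 1" using Y by (simp add: Y_def)
      have "sqrt Y / Y ^ Suc q \<le> sqrt Y / Y ^ 2"
        using Y1 Suc by (intro divide_left_mono power_increasing) auto
      also have "\<dots> = sqrt Y / (Y * (sqrt Y * sqrt Y))" using Y1 by (simp add: power2_eq_square)
      also have "\<dots> = 1 / (Y * sqrt Y)" using Y1 by (simp add: field_simps)
      finally have "X ^ q / sqrt X ^ k * (sqrt Y / Y ^ Suc q) \<le> g s"
        unfolding g_def c_def Y_def[symmetric] using h by (intro mult_left_mono) auto
      then show ?thesis using pw[of s] that by (simp add: Y_def)
    qed
    moreover have "G S - G 0 \<le> 2 * X ^ M / sqrt X ^ k"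
    proof -
      have "G S \<le> 0" unfolding G_def c_def using h by (intro mult_nonneg_nonpos divide_nonpos_nonneg) auto
      moreover have "- G 0 = 2 * X ^ p / sqrt X ^ k" using h Suc by (simp add: G_def c_def)
      moreover have "2 * X ^ p / sqrt X ^ k \<le> 2 * X ^ M / sqrt X ^ k"
        using h Suc by (intro divide_right_mono mult_left_mono power_increasing) auto
      ultimately show ?thesis by linarith
    qed
    ultimately show ?thesis using gi by (intro exI[of _ g]) (auto simp: integral_unique)
  qed
qed

lemma ray_int_bound:
  assumes A: "\<And>q. q < M + 2 \<Longrightarrow> continuous_on {0..S} (A q)"
    and b: "\<And>q s. q < M + 2 \<Longrightarrow> s \<in> {0..S} \<Longrightarrow> norm (A q s) \<le> C * sqrt s ^ k"
    and S: "0 \<le> S" "S \<le> 1" and k: "k \<le> 1" and C: "C \<ge> 0"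
    and kap: "0 < \<kappa>" "\<kappa> \<le> 1" and X: "norm \<xi> \<ge> 1"
    and low: "\<And>s. 0 \<le> s \<Longrightarrow> s \<le> 1 \<Longrightarrow> norm (1 - of_real s * \<alpha> * \<xi>) \<ge> \<kappa> * (1 + s * norm \<xi>)"
  shows "norm (ray_int A \<alpha> S (M + 2) \<xi>) \<le> real (M + 2) * (C / \<kappa> ^ (M + 2) * 2) * (norm \<xi> ^ M / sqrt (norm \<xi>) ^ k)"
proof -
  define X where "X = norm \<xi>"
  have each: "norm (integral {0..S} (\<lambda>s. A q s * \<xi> ^ q / (1 - of_real s * \<alpha> * \<xi>) ^ Suc q)) \<le> C / \<kappa> ^ (M + 2) * (2 * X ^ M / sqrt X ^ k)"
    if q: "q < M + 2" for q
  proof -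
    obtain g where g: "g integrable_on {0..S}" "\<And>s. s \<in> {0..S} \<Longrightarrow> sqrt s ^ k * X ^ q / (1 + s * X) ^ Suc q \<le> g s"
      "integral {0..S} g \<le> 2 * X ^ M / sqrt X ^ k"
      using ray_weight_bound[of S X k q M] S X k q by (auto simp: X_def)
    have pos: "\<kappa> * (1 + s * X) > 0" if "s \<in> {0..S}" for s
      using kap that by (intro mult_pos_pos) (auto simp: X_def add_pos_nonneg)
    have lo: "\<kappa> * (1 + s * X) \<le> norm (1 - of_real s * \<alpha> * \<xi>)" if "s \<in> {0..S}" for s
      using low[of s] that S by (auto simp: X_def)
    have "norm (integral {0..S} (\<lambda>s. A q s * \<xi> ^ q / (1 - of_real s * \<alpha> * \<xi>) ^ Suc q)) \<le> integral {0..S} (\<lambda>s. C / \<kappa> ^ (M + 2) * g s)"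
    proof (rule integral_norm_bound_integral)
      have "1 - of_real s * \<alpha> * \<xi> \<noteq> 0" if "s \<in> {0..S}" for s
        using pos[OF that] lo[OF that] by (metis norm_zero not_less)
      then show "(\<lambda>s. A q s * \<xi> ^ q / (1 - of_real s * \<alpha> * \<xi>) ^ Suc q) integrable_on {0..S}"
        by (intro integrable_continuous_real continuous_intros A q) auto
      show "(\<lambda>s. C / \<kappa> ^ (M + 2) * g s) integrable_on {0..S}" by (intro integrable_on_mult_right g)
      fix s assume s: "s \<in> {0..S}"
      have "norm (A q s * \<xi> ^ q / (1 - of_real s * \<alpha> * \<xi>) ^ Suc q) = norm (A q s) * X ^ q / norm (1 - of_real s * \<alpha> * \<xi>) ^ Suc q"
        by (simp add: norm_mult norm_divide norm_power X_def del: power_Suc)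
      also have "\<dots> \<le> (C * sqrt s ^ k) * X ^ q / (\<kappa> * (1 + s * X)) ^ Suc q"
        using b[OF q s] lo[OF s] pos[OF s] C s
        by (intro frac_le mult_right_mono power_mono zero_less_power) (auto simp: X_def)
      also have "\<dots> = C / \<kappa> ^ Suc q * (sqrt s ^ k * X ^ q / (1 + s * X) ^ Suc q)"
        by (simp add: power_mult_distrib del: power_Suc)
      also have "\<dots> \<le> C / \<kappa> ^ (M + 2) * (sqrt s ^ k * X ^ q / (1 + s * X) ^ Suc q)"
      proof (rule mult_right_mono)
        have "\<kappa> ^ (M + 2) \<le> \<kappa> ^ Suc q" using q kap by (intro power_decreasing) auto
        then show "C / \<kappa> ^ Suc q \<le> C / \<kappa> ^ (M + 2)" using kap C by (intro divide_left_mono) auto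
        show "0 \<le> sqrt s ^ k * X ^ q / (1 + s * X) ^ Suc q" using s by (auto simp: X_def)
      qed
      also have "\<dots> \<le> C / \<kappa> ^ (M + 2) * g s" using g(2)[OF s] C kap by (intro mult_left_mono) auto
      finally show "norm (A q s * \<xi> ^ q / (1 - of_real s * \<alpha> * \<xi>) ^ Suc q) \<le> C / \<kappa> ^ (M + 2) * g s" .
    qed
    also have "\<dots> \<le> C / \<kappa> ^ (M + 2) * (2 * X ^ M / sqrt X ^ k)"
      using g(3) C kap by (simp only: integral_mult_right) (intro mult_left_mono, auto)
    finally show ?thesis .
  qed
  have "norm (ray_int A \<alpha> S (M + 2) \<xi>) \<le> (\<Sum>q<M + 2. C / \<kappa> ^ (M + 2) * (2 * X ^ M / sqrt X ^ k))"
    unfolding ray_int_def by (rule sum_norm_le) (use each in auto)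
  also have "\<dots> = real (M + 2) * (C / \<kappa> ^ (M + 2) * 2) * (X ^ M / sqrt X ^ k)" by simp
  finally show ?thesis unfolding X_def .
qed

text \<open>
  The two integrals agree near \<open>0\<close>, hence on the connected intersection of their domains, and they
  glue to an entire function because the domains cover the plane.  At each \<open>\<xi>\<close> one of the two
  denominators is large, so the entire function is \<open>O (norm \<xi> powr (M - k / 2))\<close>, and Liouville's argument
  kills its coefficients of higher order.  The gain of half a power for \<open>k = 1\<close> matters: it removes
  the coefficient with \<open>m = M\<close> as well.
\<close>

theorem two_ray_coefficients_vanish:
  assumes ab: "Im (\<alpha> * cnj \<beta>) \<noteq> 0"
    and A: "\<And>q. q < M + 2 \<Longrightarrow> continuous_on {0..S} (A q)"
    and B: "\<And>q. q < M + 2 \<Longrightarrow> continuous_on {0..T} (B q)"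
    and bA: "\<And>q s. q < M + 2 \<Longrightarrow> s \<in> {0..S} \<Longrightarrow> norm (A q s) \<le> C * sqrt s ^ k"
    and bB: "\<And>q s. q < M + 2 \<Longrightarrow> s \<in> {0..T} \<Longrightarrow> norm (B q s) \<le> C * sqrt s ^ k"
    and S: "0 \<le> S" "S \<le> 1" and T: "0 \<le> T" "T \<le> 1" and k: "k \<le> 1" and C: "C \<ge> 0"
    and sA: "\<And>\<xi>. norm \<xi> < 1 \<Longrightarrow> (\<lambda>m. \<mu> m * \<xi> ^ m) sums ray_int A \<alpha> S (M + 2) \<xi>"
    and sB: "\<And>\<xi>. norm \<xi> < 1 \<Longrightarrow> (\<lambda>m. \<mu> m * \<xi> ^ m) sums ray_int B \<beta> T (M + 2) \<xi>"
    and m: "m + k > M"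
  shows "\<mu> m = 0"
proof -
  define GA where "GA = ray_int A \<alpha> S (M + 2)"
  define GB where "GB = ray_int B \<beta> T (M + 2)"
  have hA: "GA holomorphic_on off_ray \<alpha>" unfolding GA_def by (rule ray_int_holomorphic) (use A S in auto)
  have hB: "GB holomorphic_on off_ray \<beta>" unfolding GB_def by (rule ray_int_holomorphic) (use B T in auto)
  obtain \<kappa>' where k': "\<kappa>' > 0"
    "\<And>\<xi>. (\<forall>s. 0 \<le> s \<longrightarrow> s \<le> 1 \<longrightarrow> norm (1 - of_real s * \<alpha> * \<xi>) \<ge> \<kappa>' * (1 + s * norm \<xi>)) \<or>
          (\<forall>s. 0 \<le> s \<longrightarrow> s \<le> 1 \<longrightarrow> norm (1 - of_real s * \<beta> * \<xi>) \<ge> \<kappa>' * (1 + s * norm \<xi>))"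
    using ray_alternative[OF ab] by blast
  define \<kappa> where "\<kappa> = min 1 \<kappa>'"
  define good where "good \<gamma> \<xi> \<longleftrightarrow> (\<forall>s. 0 \<le> s \<longrightarrow> s \<le> 1 \<longrightarrow> norm (1 - of_real s * \<gamma> * \<xi>) \<ge> \<kappa> * (1 + s * norm \<xi>))" for \<gamma> \<xi> :: complex
  have kap: "0 < \<kappa>" "\<kappa> \<le> 1" using k' by (auto simp: \<kappa>_def)
  have kle: "\<kappa> * (1 + s * norm \<xi>) \<le> \<kappa>' * (1 + s * norm \<xi>)" if "0 \<le> s" for s and \<xi> :: complex
    using that by (intro mult_right_mono) (auto simp: \<kappa>_def)
  have alt: "good \<alpha> \<xi> \<or> good \<beta> \<xi>" for \<xi>
    using k'(2)[of \<xi>] unfolding good_def by (meson kle order_trans)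
  have good_off: "\<xi> \<in> off_ray \<gamma>" if "good \<gamma> \<xi>" for \<gamma> \<xi>
  proof (rule ccontr)
    assume "\<xi> \<notin> off_ray \<gamma>"
    then have r: "Re (\<gamma> * \<xi>) \<ge> 1" "Im (\<gamma> * \<xi>) = 0" by (auto simp: off_ray_def)
    define s where "s = 1 / Re (\<gamma> * \<xi>)"
    have s: "0 \<le> s" "s \<le> 1" using r by (auto simp: s_def)
    have "\<gamma> * \<xi> = of_real (Re (\<gamma> * \<xi>))"
      using r(2) by (simp add: complex_eq_iff del: times_complex.sel)
    then have "of_real s * \<gamma> * \<xi> = of_real s * of_real (Re (\<gamma> * \<xi>))"
      by (metis mult.assoc)
    also have "\<dots> = 1" using r by (simp add: s_def flip: of_real_mult)
    finally have "norm (1 - of_real s * \<gamma> * \<xi>) = 0" by simp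
    moreover have "\<kappa> * (1 + s * norm \<xi>) > 0" using kap s by (intro mult_pos_pos) (auto simp: add_pos_nonneg)
    ultimately show False using that s unfolding good_def by (metis not_less)
  qed
  \<comment> \<open>A point on the ray for \<open>\<gamma>\<close> is the pole for some \<open>s\<close> in \<open>{0..1}\<close>, so it cannot be good for \<open>\<gamma>\<close>.\<close>
  have cover: "off_ray \<alpha> \<union> off_ray \<beta> = UNIV" using alt good_off by blast
  define W where "W = off_ray \<alpha> \<inter> off_ray \<beta>"
  have W: "open W" "connected W" "0 \<in> W"
    by (auto simp: W_def connected_off_rays open_off_ray off_ray_0 intro!: open_Int)
  have agree: "GA \<xi> = GB \<xi>" if "\<xi> \<in> W" for \<xi>
  proof -
    have "GA \<xi> - GB \<xi> = 0"
    proof (rule analytic_continuation[of "\<lambda>\<xi>. GA \<xi> - GB \<xi>" W "W \<inter> ball 0 1" 0])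
      show "(\<lambda>\<xi>. GA \<xi> - GB \<xi>) holomorphic_on W"
        by (intro holomorphic_on_diff holomorphic_on_subset[OF hA] holomorphic_on_subset[OF hB]) (auto simp: W_def)
      show "0 islimpt W \<inter> ball 0 1"
        using W by (intro interior_limit_point) (auto simp: interior_open)
      show "GA z - GB z = 0" if "z \<in> W \<inter> ball 0 1" for z
        using sums_unique2[OF sA sB, of z] that by (auto simp: GA_def GB_def)
    qed (use W that in auto)
    then show ?thesis by simp
  qed
  define G where "G \<xi> = (if \<xi> \<in> off_ray \<alpha> then GA \<xi> else GB \<xi>)" for \<xi>
  have GGB: "G \<xi> = GB \<xi>" if "\<xi> \<in> off_ray \<beta>" for \<xi>
    using agree[of \<xi>] that by (auto simp: G_def W_def)
  have hG: "G holomorphic_on UNIV"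
    unfolding cover[symmetric] G_def
    by (rule holomorphic_on_If_Un) (use hA hB agree in \<open>auto simp: open_off_ray W_def\<close>)
  define D where "D = real (M + 2) * (C / \<kappa> ^ (M + 2) * 2)"
  have bG: "norm (G \<xi>) \<le> D * (norm \<xi> ^ M / sqrt (norm \<xi>) ^ k)" if X: "norm \<xi> \<ge> 1" for \<xi>
    using alt[of \<xi>]
  proof
    assume g: "good \<alpha> \<xi>"
    then have "G \<xi> = GA \<xi>" using good_off by (simp add: G_def)
    then show ?thesis
      unfolding D_def GA_def using ray_int_bound[of M S A C k \<kappa> \<xi> \<alpha>] A bA S k C kap X g
      by (auto simp: good_def)
  next
    assume g: "good \<beta> \<xi>"
    then have "G \<xi> = GB \<xi>" using good_off GGB by blast
    then show ?thesis
      unfolding D_def GB_def using ray_int_bound[of M T B C k \<kappa> \<xi> \<beta>] B bB T k C kap X g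
      by (auto simp: good_def)
  qed
  have D0: "D \<ge> 0" using C kap by (simp add: D_def)
  have sG: "(\<lambda>m. \<mu> m * \<xi> ^ m) sums G \<xi>" if "norm \<xi> < 1" for \<xi>
    using sA[OF that] sB[OF that] by (simp add: G_def GA_def GB_def)
  have coeff: "\<mu> n = (deriv ^^ n) G 0 / fact n" for n
  proof -
    define a where "a n = \<mu> n - (deriv ^^ n) G 0 / fact n" for n
    have "(\<lambda>n. (deriv ^^ n) G 0 / fact n * (\<xi> - 0) ^ n) sums G \<xi>" if "norm \<xi> < 1" for \<xi>
      by (rule holomorphic_power_series[OF holomorphic_on_subset[OF hG]]) (use that in auto)
    then have za: "(\<lambda>n. a n * (\<xi> - 0) ^ n) sums 0" if "norm (\<xi> - 0) < 1" for \<xi>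
      using sums_diff[OF sG[of \<xi>]] that unfolding a_def by (fastforce simp: left_diff_distrib)
    have "a n = 0"
    proof (rule ccontr)
      assume an: "a n \<noteq> 0"
      have a0: "a 0 = 0" using sums_unique2[OF powser_sums_zero[of a], of 0] za[of 0] by simp
      then have "n > 0" using an by (cases n) auto
      show False
      proof (rule powser_0_nonzero[of 1 0 a "\<lambda>_. 0" n])
        fix s :: real
        assume s: "0 < s" "\<And>z::complex. z \<in> cball 0 s - {0} \<Longrightarrow> (0::complex) \<noteq> 0"
        show False using s(2)[of "of_real s"] s(1) by simp
      qed (use za an \<open>n > 0\<close> in auto)
    qed
    then show ?thesis by (simp add: a_def)
  qed
  \<comment> \<open>Cauchy's inequality on the circle of radius \<open>r\<close>; the surplus in the exponent is at least one half
    because \<open>m > M\<close> or \<open>k = 1\<close>, \<open>m \<ge> M\<close>.\<close>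
  have fin: "norm (\<mu> m) \<le> D / sqrt r" if r: "r \<ge> 1" for r
  proof -
    have "norm ((deriv ^^ m) G 0) \<le> fact m * (D * (r ^ M / sqrt r ^ k)) / r ^ m"
    proof (rule Cauchy_inequality)
      show "G holomorphic_on ball 0 r" by (rule holomorphic_on_subset[OF hG]) simp
      show "continuous_on (cball 0 r) G"
        by (rule holomorphic_on_imp_continuous_on[OF holomorphic_on_subset[OF hG]]) simp
      show "norm (G x) \<le> D * (r ^ M / sqrt r ^ k)" if "norm (0 - x) = r" for x
        using bG[of x] that r by simp
    qed (use r in simp)
    then have "norm (\<mu> m) \<le> D * (r ^ M / (sqrt r ^ k * r ^ m))"
      unfolding coeff by (simp add: norm_divide field_simps)
    also have "\<dots> \<le> D * (1 / sqrt r)"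
    proof (rule mult_left_mono[OF _ D0])
      have "sqrt r * r ^ M \<le> sqrt r ^ k * r ^ m"
      proof (cases "k = 0")
        case True
        have "sqrt r \<le> r" using r by (intro real_le_lsqrt) (auto simp: power2_eq_square)
        then have "sqrt r * r ^ M \<le> r ^ Suc M" using r by simp
        also have "\<dots> \<le> r ^ m" using r m True by (intro power_increasing) auto
        finally show ?thesis using True by simp
      next
        case False
        then have "k = 1" using k by simp
        then show ?thesis using r m by (auto intro!: power_increasing)
      qed
      then show "r ^ M / (sqrt r ^ k * r ^ m) \<le> 1 / sqrt r" using r by (simp add: field_simps)
    qed
    finally show ?thesis by simp
  qed
  have "(\<lambda>n. D / sqrt (real (Suc n))) \<longlonglongrightarrow> 0"
    by (rule real_tendsto_divide_at_top[OF tendsto_const])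
       (intro filterlim_compose[OF sqrt_at_top] filterlim_compose[OF filterlim_real_sequentially filterlim_Suc])
  then have "norm (\<mu> m) \<le> 0"
    by (rule LIMSEQ_le_const) (use fin in \<open>auto intro!: exI[of _ 0]\<close>)
  then show ?thesis by simp
qed

section \<open>Moments of fibre coefficients\<close>

text \<open>
  Approximating \<open>cnj (V t)\<close> uniformly by polynomials shows that the integral of \<open>(norm (V t))\<^sup>2\<close> vanishes.
\<close>

lemma interval_moments_zero:
  fixes V :: "real \<Rightarrow> complex"
  assumes V: "continuous_on {0..1} V" and m: "\<And>n. integral {0..1} (\<lambda>t. of_real (t ^ n) * V t) = 0"
    and t: "t \<in> {0..1}"
  shows "V t = 0"
proof -
  obtain B where B: "B > 0" "\<And>t. t \<in> {0..1} \<Longrightarrow> norm (V t) \<le> B"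
    using compact_imp_bounded[OF compact_continuous_image[OF V compact_Icc]]
    unfolding bounded_pos by auto
  have sq: "continuous_on {0..1} (\<lambda>t. (norm (V t))\<^sup>2)" by (intro continuous_intros V)
  have "integral {0..1} (\<lambda>t. (norm (V t))\<^sup>2) \<le> 0 + e" if e: "e > 0" for e
  proof -
    obtain p where p: "polynomial_function p" "\<And>t. t \<in> {0..1} \<Longrightarrow> norm (cnj (V t) - p t) < e / B"
    proof -
      have "continuous_on {0..1} (\<lambda>t. cnj (V t))" "e / B > 0" using e B by (auto intro!: continuous_intros V)
      from Stone_Weierstrass_polynomial_function[OF compact_Icc this] that show ?thesis by blast
    qed
    have "real_polynomial_function (\<lambda>t. Re (p t))" "real_polynomial_function (\<lambda>t. Im (p t))"
      using p(1) unfolding polynomial_function_def by (auto simp: o_def bounded_linear_Re bounded_linear_Im)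
    then obtain a b n k where ab: "\<And>t. Re (p t) = (\<Sum>i\<le>n. a i * t ^ i)" "\<And>t. Im (p t) = (\<Sum>i\<le>k. b i * t ^ i)"
    proof -
      assume r: "real_polynomial_function (\<lambda>t. Re (p t))" "real_polynomial_function (\<lambda>t. Im (p t))"
      obtain a n where "(\<lambda>t. Re (p t)) = (\<lambda>t. \<Sum>i\<le>n. a i * t ^ i)"
        using r(1) unfolding real_polynomial_function_iff_sum by blast
      moreover obtain b k where "(\<lambda>t. Im (p t)) = (\<lambda>t. \<Sum>i\<le>k. b i * t ^ i)"
        using r(2) unfolding real_polynomial_function_iff_sum by blast
      ultimately show ?thesis by (intro that[of a n b k]) (auto dest: fun_cong)
    qed
    have pc: "continuous_on {0..1} p" by (rule continuous_on_polymonial_function[OF p(1)])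
    have mono: "(\<lambda>t. c * (of_real (t ^ i) * V t)) integrable_on {0..1}" for c i
      by (intro integrable_continuous_real continuous_intros V)
    have "integral {0..1} (\<lambda>t. p t * V t) = 0"
    proof -
      have "p t * V t = (\<Sum>i\<le>n. of_real (a i) * (of_real (t ^ i) * V t)) + (\<Sum>i\<le>k. \<i> * of_real (b i) * (of_real (t ^ i) * V t))" for t
      proof -
        have "p t = of_real (Re (p t)) + \<i> * of_real (Im (p t))" by (rule complex_eq)
        then have "p t * V t = (of_real (\<Sum>i\<le>n. a i * t ^ i) + \<i> * of_real (\<Sum>i\<le>k. b i * t ^ i)) * V t"
          unfolding ab by simp
        then show ?thesis
          by (simp add: distrib_right sum_distrib_right sum_distrib_left mult.assoc)
      qed
      then have "integral {0..1} (\<lambda>t. p t * V t) = integral {0..1} (\<lambda>t. (\<Sum>i\<le>n. of_real (a i) * (of_real (t ^ i) * V t)) + (\<Sum>i\<le>k. \<i> * of_real (b i) * (of_real (t ^ i) * V t)))"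
        by simp
      also have "\<dots> = integral {0..1} (\<lambda>t. (\<Sum>i\<le>n. of_real (a i) * (of_real (t ^ i) * V t))) + integral {0..1} (\<lambda>t. (\<Sum>i\<le>k. \<i> * of_real (b i) * (of_real (t ^ i) * V t)))"
        by (intro integral_add integrable_sum mono) auto
      also have "\<dots> = 0"
        by (subst (1 2) integral_sum) (use mono m in auto)
      finally show ?thesis .
    qed
    then have "of_real (integral {0..1} (\<lambda>t. (norm (V t))\<^sup>2)) = integral {0..1} (\<lambda>t. (cnj (V t) - p t) * V t)"
    proof -
      assume z: "integral {0..1} (\<lambda>t. p t * V t) = 0"
      have "((\<lambda>t. of_real ((norm (V t))\<^sup>2) :: complex) has_integral of_real (integral {0..1} (\<lambda>t. (norm (V t))\<^sup>2))) {0..1}"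
        by (intro has_integral_of_real integrable_integral integrable_continuous_real sq)
      then have "of_real (integral {0..1} (\<lambda>t. (norm (V t))\<^sup>2)) = integral {0..1} (\<lambda>t. cnj (V t) * V t)"
        by (simp add: complex_norm_square mult.commute integral_unique del: of_real_power)
      also have "\<dots> = integral {0..1} (\<lambda>t. cnj (V t) * V t) - integral {0..1} (\<lambda>t. p t * V t)" by (simp add: z)
      also have "\<dots> = integral {0..1} (\<lambda>t. cnj (V t) * V t - p t * V t)"
        by (intro integral_diff[symmetric] integrable_continuous_real continuous_intros V pc)
      finally show ?thesis by (simp add: left_diff_distrib)
    qed
    then have "\<bar>integral {0..1} (\<lambda>t. (norm (V t))\<^sup>2)\<bar> = norm (integral {0..1} (\<lambda>t. (cnj (V t) - p t) * V t))"
      using norm_of_real[of "integral {0..1} (\<lambda>t. (norm (V t))\<^sup>2)", where 'a=complex] by simp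
    also have "\<dots> \<le> e / B * B * (1 - 0)"
    proof (rule integral_bound)
      show "continuous_on {0..1} (\<lambda>t. (cnj (V t) - p t) * V t)" by (intro continuous_intros V pc)
      fix t :: real assume "t \<in> {0..1}"
      then show "norm ((cnj (V t) - p t) * V t) \<le> e / B * B"
        unfolding norm_mult using p(2)[of t, THEN less_imp_le] B e by (intro mult_mono) auto
    qed simp
    finally show ?thesis using B by simp
  qed
  then have "integral {0..1} (\<lambda>t. (norm (V t))\<^sup>2) \<le> 0" by (rule field_le_epsilon)
  moreover have "integral {0..1} (\<lambda>t. (norm (V t))\<^sup>2) \<ge> 0" by (intro integral_nonneg integrable_continuous_real sq) auto
  ultimately have "integral {0..1} (\<lambda>t. (norm (V t))\<^sup>2) = 0" by simp
  then have "(norm (V t))\<^sup>2 = 0"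
    using integral_eq_0_iff[OF sq] t by auto
  then show ?thesis by simp
qed

text \<open>
  A Fourier coefficient of \<open>F\<close> on the circle of the sphere above \<open>z\<close>.  The weight contains the powers of
  \<open>w\<close> and \<open>cnj w\<close>, not of \<open>\<theta>\<close>: on a complex line it is then a polynomial in the parameter and its
  conjugate.
\<close>

definition fibre_coeff :: "(complex \<times> complex \<Rightarrow> complex) \<Rightarrow> nat \<Rightarrow> nat \<Rightarrow> complex \<Rightarrow> complex" where
  "fibre_coeff F i j z = (let w = complex_of_real (sqrt (1 - (norm z)\<^sup>2)) in
     circle_int (\<lambda>\<theta>. F (z, w * \<theta>) * (w * \<theta>) ^ i * cnj (w * \<theta>) ^ j))"

lemma sphere_fibre:
  assumes "norm z \<le> 1" "norm \<theta> = 1"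
  shows "(z, complex_of_real (sqrt (1 - (norm z)\<^sup>2)) * \<theta>) \<in> sphere 0 1"
proof -
  have "0 \<le> 1 - (norm z)\<^sup>2" using assms(1) by (simp add: power_le_one_iff)
  then have "(norm z)\<^sup>2 + (norm (complex_of_real (sqrt (1 - (norm z)\<^sup>2)) * \<theta>))\<^sup>2 = 1"
    using assms(2) by (simp add: norm_mult)
  then show ?thesis by (simp add: norm_prod_def)
qed

lemma fibre_continuous:
  assumes F: "continuous_on (sphere 0 1) F"
  shows "continuous_on (cball 0 1 \<times> sphere 0 1) (\<lambda>(z, \<theta>). F (z, complex_of_real (sqrt (1 - (norm z)\<^sup>2)) * \<theta>))"
  unfolding split_beta
  by (rule continuous_on_compose2[OF F]) (use sphere_fibre in \<open>force intro!: continuous_intros\<close>)+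

lemma fibre_coeff_continuous:
  assumes F: "continuous_on (sphere 0 1) F"
  shows "continuous_on (cball 0 1) (fibre_coeff F i j)"
  unfolding fibre_coeff_def[abs_def] Let_def
proof (rule continuous_on_circle_int)
  show "continuous_on (cball 0 1 \<times> sphere 0 1) (\<lambda>(z, \<theta>). F (z, complex_of_real (sqrt (1 - (norm z)\<^sup>2)) * \<theta>)
     * (complex_of_real (sqrt (1 - (norm z)\<^sup>2)) * \<theta>) ^ i * cnj (complex_of_real (sqrt (1 - (norm z)\<^sup>2)) * \<theta>) ^ j)"
    using fibre_continuous[OF F] unfolding split_beta by (intro continuous_intros)
qed

lemma fibre_circle_continuous:
  assumes F: "continuous_on (sphere 0 1) F" and z: "norm z \<le> 1"
  shows "continuous_on (sphere 0 1) (\<lambda>\<theta>. F (z, complex_of_real (sqrt (1 - (norm z)\<^sup>2)) * \<theta>))"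
  by (rule continuous_on_compose2[OF F]) (use sphere_fibre[OF z] in \<open>auto intro!: continuous_intros\<close>)

lemma fibre_coeff_bound:
  assumes F: "continuous_on (sphere 0 1) F" and B: "\<And>x. x \<in> sphere 0 1 \<Longrightarrow> norm (F x) \<le> B"
    and z: "norm z \<le> 1"
  shows "norm (fibre_coeff F i j z) \<le> 2 * pi * (B * sqrt (1 - (norm z)\<^sup>2) ^ (i + j))"
  unfolding fibre_coeff_def Let_def
proof (rule circle_int_bound)
  show "continuous_on (sphere 0 1) (\<lambda>\<theta>. F (z, complex_of_real (sqrt (1 - (norm z)\<^sup>2)) * \<theta>)
     * (complex_of_real (sqrt (1 - (norm z)\<^sup>2)) * \<theta>) ^ i * cnj (complex_of_real (sqrt (1 - (norm z)\<^sup>2)) * \<theta>) ^ j)"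
    by (intro continuous_intros fibre_circle_continuous[OF F z])
  fix \<theta> :: complex assume t: "norm \<theta> = 1"
  define w where "w = sqrt (1 - (norm z)\<^sup>2)"
  have w: "w \<ge> 0" using z by (simp add: w_def power_le_one_iff)
  have "norm (F (z, of_real w * \<theta>)) * w ^ (i + j) \<le> B * w ^ (i + j)"
    using B[OF sphere_fibre[OF z t]] w by (intro mult_right_mono) (auto simp: w_def)
  then show "norm (F (z, complex_of_real (sqrt (1 - (norm z)\<^sup>2)) * \<theta>)
     * (complex_of_real (sqrt (1 - (norm z)\<^sup>2)) * \<theta>) ^ i * cnj (complex_of_real (sqrt (1 - (norm z)\<^sup>2)) * \<theta>) ^ j)
      \<le> B * sqrt (1 - (norm z)\<^sup>2) ^ (i + j)"
    unfolding w_def[symmetric] using t w by (simp add: norm_mult norm_power power_add mult_ac)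
qed

text \<open>
  The slice of the ball by a line through \<open>(\<alpha>, 0)\<close>, in the parameter \<open>t = z - \<alpha>\<close>.
\<close>

lemma pencil_line_disc:
  assumes s: "0 \<le> s" "s < 1" and R: "R \<ge> 0" "R\<^sup>2 = (1 - s) * (1 - s * (norm \<alpha>)\<^sup>2)" and l: "(norm l)\<^sup>2 = s / (1 - s)"
  shows "norm (line_pt (\<alpha>, 0) (1, l) t) \<le> 1 \<longleftrightarrow> t \<in> cball (of_real (s - 1) * \<alpha>) R"
    "norm (line_pt (\<alpha>, 0) (1, l) t) < 1 \<longleftrightarrow> t \<in> ball (of_real (s - 1) * \<alpha>) R"
proof -
  define c where "c = of_real (s - 1) * \<alpha>"
  have n: "(norm (line_pt (\<alpha>, 0) (1, l) t))\<^sup>2 = (norm (\<alpha> + t))\<^sup>2 + (norm t)\<^sup>2 * (s / (1 - s))"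
    by (simp add: line_pt_def norm_pair_sq norm_mult power_mult_distrib l)
  have "(1 - s) * ((norm (line_pt (\<alpha>, 0) (1, l) t))\<^sup>2 - 1) = (1 - s) * (norm (\<alpha> + t))\<^sup>2 + s * (norm t)\<^sup>2 - (1 - s)"
    unfolding n using s by (simp add: field_simps)
  also have "\<dots> = (norm (t - c))\<^sup>2 - R\<^sup>2"
    unfolding R(2) c_def cmod_power2 by (simp add: power2_eq_square algebra_simps)
  finally have e: "(1 - s) * ((norm (line_pt (\<alpha>, 0) (1, l) t))\<^sup>2 - 1) = (dist c t)\<^sup>2 - R\<^sup>2"
    by (simp add: dist_norm norm_minus_commute)
  have a: "x \<le> y \<longleftrightarrow> x\<^sup>2 - y\<^sup>2 \<le> 0" "x < y \<longleftrightarrow> x\<^sup>2 - y\<^sup>2 < 0" if "x \<ge> 0" "y \<ge> 0" for x y :: real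
  proof -
    have "x \<le> y \<longleftrightarrow> x\<^sup>2 \<le> y\<^sup>2" "y \<le> x \<longleftrightarrow> y\<^sup>2 \<le> x\<^sup>2"
      using that abs_le_square_iff[of x y] abs_le_square_iff[of y x] by auto
    then show "x \<le> y \<longleftrightarrow> x\<^sup>2 - y\<^sup>2 \<le> 0" "x < y \<longleftrightarrow> x\<^sup>2 - y\<^sup>2 < 0" by linarith+
  qed
  have "norm (line_pt (\<alpha>, 0) (1, l) t) \<le> 1 \<longleftrightarrow> (norm (line_pt (\<alpha>, 0) (1, l) t))\<^sup>2 - 1 \<le> 0"
    using a(1)[of "norm (line_pt (\<alpha>, 0) (1, l) t)" 1] by simp
  also have "\<dots> \<longleftrightarrow> (1 - s) * ((norm (line_pt (\<alpha>, 0) (1, l) t))\<^sup>2 - 1) \<le> 0" using s by (simp add: mult_le_0_iff)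
  also have "\<dots> \<longleftrightarrow> dist c t \<le> R" unfolding e using a(1)[of "dist c t" R] R by simp
  finally show "norm (line_pt (\<alpha>, 0) (1, l) t) \<le> 1 \<longleftrightarrow> t \<in> cball (of_real (s - 1) * \<alpha>) R" by (simp add: c_def)
  have "norm (line_pt (\<alpha>, 0) (1, l) t) < 1 \<longleftrightarrow> (norm (line_pt (\<alpha>, 0) (1, l) t))\<^sup>2 - 1 < 0"
    using a(2)[of "norm (line_pt (\<alpha>, 0) (1, l) t)" 1] by simp
  also have "\<dots> \<longleftrightarrow> (1 - s) * ((norm (line_pt (\<alpha>, 0) (1, l) t))\<^sup>2 - 1) < 0" using s by (simp add: mult_less_0_iff)
  also have "\<dots> \<longleftrightarrow> dist c t < R" unfolding e using a(2)[of "dist c t" R] R by simp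
  finally show "norm (line_pt (\<alpha>, 0) (1, l) t) < 1 \<longleftrightarrow> t \<in> ball (of_real (s - 1) * \<alpha>) R" by (simp add: c_def)
qed

text \<open>
  Rotating the integration variable parametrises the fibre circle over \<open>z\<close> by the lines through \<open>(\<alpha>, 0)\<close> of a
  common slope \<open>l\<close> in modulus, so that for fixed \<open>\<theta>\<close> the points above a circle of the pencil lie on one line.
\<close>

lemma fibre_coeff_on_pencil:
  assumes F: "continuous_on (sphere 0 1) F" and z: "norm z \<le> 1" and l: "l \<ge> 0"
    and e: "1 - (norm z)\<^sup>2 = l\<^sup>2 * (norm (z - \<alpha>))\<^sup>2"
  shows "fibre_coeff F i j z =
     circle_int (\<lambda>\<theta>. F (z, of_real l * \<theta> * (z - \<alpha>)) * (of_real l * \<theta> * (z - \<alpha>)) ^ i * cnj (of_real l * \<theta> * (z - \<alpha>)) ^ j)"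
proof -
  define w where "w = complex_of_real (sqrt (1 - (norm z)\<^sup>2))"
  have w: "w = of_real (l * norm (z - \<alpha>))"
    unfolding w_def e by (simp add: real_sqrt_mult l)
  define g where "g \<theta> = F (z, w * \<theta>) * (w * \<theta>) ^ i * cnj (w * \<theta>) ^ j" for \<theta>
  have g: "continuous_on (sphere 0 1) g"
    unfolding g_def w_def by (intro continuous_intros fibre_circle_continuous[OF F z])
  \<comment> \<open>At \<open>z = \<alpha>\<close> the fibre circle is a point, and the direction is arbitrary.\<close>
  define v where "v = (if z = \<alpha> then 1 else (z - \<alpha>) / of_real (norm (z - \<alpha>)))"
  have v: "norm v = 1" by (simp add: v_def norm_divide)
  have wv: "w * (v * \<theta>) = of_real l * \<theta> * (z - \<alpha>)" for \<theta>
    by (cases "z = \<alpha>") (simp_all add: w v_def)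
  have "fibre_coeff F i j z = circle_int g" by (simp add: fibre_coeff_def Let_def g_def[abs_def] w_def)
  also have "\<dots> = circle_int (\<lambda>\<theta>. g (v * \<theta>))" by (rule circle_int_rotate[OF g v, symmetric])
  finally show ?thesis by (simp only: g_def wv)
qed

text \<open>
  For fixed \<open>\<theta>\<close> everything takes place on one line through \<open>(\<alpha>, 0)\<close>.  Put \<open>D = pencil_rad \<alpha> s * u\<close>.  On the
  circle, \<open>D * cnj z\<close>, \<open>D * cnj w\<close> and \<open>D * pencil_jac\<close> are polynomials in \<open>D\<close>, as \<open>D * cnj D\<close> is constant.  The
  power \<open>D ^ (n + j + 2)\<close> thus turns the \<open>n\<close> factors \<open>cnj z\<close>, the \<open>j\<close> factors \<open>cnj w\<close> and the Jacobian into
  polynomials and leaves one factor \<open>D\<close> for the differential; then Cauchy's theorem applies.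
\<close>

lemma pencil_moment_high_order:
  assumes F: "continuous_on (sphere 0 1) F" and ext: "pencil_ext F (\<alpha>, 0)"
    and s: "0 \<le> s" "s \<le> pencil_len \<alpha>"
    and phi: "continuous_on (cball 0 1) \<phi>" "\<phi> holomorphic_on ball 0 1"
  shows "circle_int (\<lambda>u. cnj (pencil_pt \<alpha> s u) ^ n * fibre_coeff F i j (pencil_pt \<alpha> s u) * of_real (pencil_jac \<alpha> s u)
           * (of_real (pencil_rad \<alpha> s) * u) ^ (n + j + 2) * \<phi> (pencil_pt \<alpha> s u)) = 0"
proof (cases "pencil_rad \<alpha> s = 0")
  case False
  define R where "R = pencil_rad \<alpha> s"
  have R: "R > 0" "R \<ge> 0" "R\<^sup>2 = (1 - s) * (1 - s * (norm \<alpha>)\<^sup>2)"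
    using False pencil_rad_sq[OF s] by (auto simp: R_def)
  have s1: "s < 1"
  proof -
    have "s \<noteq> 1" using R by auto
    then show ?thesis using s pencil_len_bounds[of \<alpha>] by linarith
  qed
  define l where "l = sqrt (s / (1 - s))"
  have l: "l \<ge> 0" "l\<^sup>2 = s / (1 - s)" using s s1 by (simp_all add: l_def)
  define c where "c = of_real (s - 1) * \<alpha>"
  define Z where "Z = pencil_pt \<alpha> s"
  have Zc: "Z u = \<alpha> + (c + of_real R * u)" for u
    by (simp add: Z_def c_def pencil_pt_def R_def algebra_simps)
  have Zd: "norm (Z u) \<le> 1" if "norm u = 1" for u
    using pencil_pt_in_disc[OF s that] by (simp add: Z_def)
  have Ze: "1 - (norm (Z u))\<^sup>2 = l\<^sup>2 * (norm (Z u - \<alpha>))\<^sup>2" if "norm u = 1" for u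
  proof -
    have "pencil_jac \<alpha> s u = (norm (Z u - \<alpha>))\<^sup>2 / (1 - s)"
      using pencil_identities(2)[OF s that] s1 unfolding Z_def[symmetric] by (simp add: eq_divide_eq mult.commute)
    then show ?thesis using pencil_identities(1)[OF s that] unfolding l(2) Z_def[symmetric] by simp
  qed
  define a1 where "a1 = complex_of_real (1 + (norm \<alpha>)\<^sup>2 - 2 * s * (norm \<alpha>)\<^sup>2)"
  define H where "H u \<theta> = F (Z u, of_real l * \<theta> * (Z u - \<alpha>)) * (of_real l * \<theta> * (Z u - \<alpha>)) ^ i * cnj (of_real l * \<theta> * (Z u - \<alpha>)) ^ j" for u \<theta>
  define K where "K u = cnj (Z u) ^ n * of_real (pencil_jac \<alpha> s u) * (of_real R * u) ^ (n + j + 2) * \<phi> (Z u)" for u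
  have onS: "(Z u, of_real l * \<theta> * (Z u - \<alpha>)) \<in> sphere 0 1" if "norm u = 1" "norm \<theta> = 1" for u \<theta>
  proof -
    have "(norm (Z u))\<^sup>2 + (norm (of_real l * \<theta> * (Z u - \<alpha>)))\<^sup>2 = 1"
      using Ze[OF that(1)] that(2) l by (simp add: norm_mult power_mult_distrib)
    then show ?thesis by (simp add: norm_prod_def)
  qed
  have Zcont: "continuous_on A Z" for A unfolding Z_def[abs_def] by (intro continuous_intros)
  have Zcont1: "continuous_on (A \<times> B) (\<lambda>p. Z (fst p))" for A B
    by (rule continuous_on_compose2[OF Zcont[of UNIV]]) (auto intro!: continuous_intros)
  have Kc: "continuous_on (sphere 0 1) K"
    unfolding K_def by (intro continuous_intros Zcont continuous_on_compose2[OF phi(1) Zcont]) (use Zd in auto)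
  have Kc1: "continuous_on (sphere 0 1 \<times> sphere 0 1) (\<lambda>p. K (fst p))"
    by (rule continuous_on_compose2[OF Kc]) (auto intro!: continuous_intros)
  have Fc: "continuous_on (sphere 0 1 \<times> sphere 0 1) (\<lambda>p. F (Z (fst p), of_real l * snd p * (Z (fst p) - \<alpha>)))"
    by (rule continuous_on_compose2[OF F]) (use onS in \<open>force intro!: continuous_intros Zcont1\<close>)+
  have HK: "continuous_on (sphere 0 1 \<times> sphere 0 1) (\<lambda>(u, \<theta>). H u \<theta> * K u)"
    unfolding split_beta H_def by (intro continuous_intros Kc1 Fc Zcont1)
  have "circle_int (\<lambda>u. cnj (pencil_pt \<alpha> s u) ^ n * fibre_coeff F i j (pencil_pt \<alpha> s u) * of_real (pencil_jac \<alpha> s u)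
           * (of_real (pencil_rad \<alpha> s) * u) ^ (n + j + 2) * \<phi> (pencil_pt \<alpha> s u))
      = circle_int (\<lambda>u. circle_int (\<lambda>\<theta>. H u \<theta> * K u))"
  proof (rule circle_int_cong)
    fix u :: complex assume u: "norm u = 1"
    have "fibre_coeff F i j (Z u) = circle_int (H u)"
      unfolding H_def by (rule fibre_coeff_on_pencil[OF F Zd[OF u] l(1) Ze[OF u]])
    then show "cnj (pencil_pt \<alpha> s u) ^ n * fibre_coeff F i j (pencil_pt \<alpha> s u) * of_real (pencil_jac \<alpha> s u)
           * (of_real (pencil_rad \<alpha> s) * u) ^ (n + j + 2) * \<phi> (pencil_pt \<alpha> s u) = circle_int (\<lambda>\<theta>. H u \<theta> * K u)"
      unfolding circle_int_multc by (simp only: K_def Z_def R_def mult_ac)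
  qed
  also have "\<dots> = circle_int (\<lambda>\<theta>. circle_int (\<lambda>u. H u \<theta> * K u))" by (rule circle_int_swap[OF HK])
  also have "\<dots> = circle_int (\<lambda>\<theta>. 0)"
  proof (rule circle_int_cong)
    fix \<theta> :: complex assume th: "norm \<theta> = 1"
    define mm where "mm = of_real l * \<theta>"
    have nl: "(norm mm)\<^sup>2 = s / (1 - s)" using th l by (simp add: mm_def norm_mult power_mult_distrib)
    define d where "d t = t - c" for t
    \<comment> \<open>The holomorphic form of the integrand: each conjugate has been multiplied by \<open>d t\<close>, which is \<open>D\<close> on the
      circle, and replaced by the polynomial \<open>z1\<close>, \<open>z2\<close> or \<open>jac\<close> below.\<close>
    define X where "X t = (mm * t) ^ i * cnj mm ^ j * (of_real (s - 1) * cnj \<alpha> * d t + of_real (R\<^sup>2)) ^ j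
        * (of_real s * cnj \<alpha> * d t + of_real (R\<^sup>2)) ^ n
        * (a1 * d t - cnj \<alpha> * (d t)\<^sup>2 - \<alpha> * of_real (R\<^sup>2)) * of_real R * \<phi> (\<alpha> + t)" for t
    have sub: "\<alpha> + t \<in> cball 0 1" if "t \<in> cball c R" for t
    proof -
      have "norm (line_pt (\<alpha>, 0) (1, mm) t) \<le> 1"
        using pencil_line_disc(1)[OF s(1) s1 R(2,3) nl] that by (simp add: c_def)
      then show ?thesis
        using norm_fst_le[of "\<alpha> + t" "t * mm"] by (simp add: line_pt_def)
    qed
    have sub': "\<alpha> + t \<in> ball 0 1" if "t \<in> ball c R" for t
    proof -
      have "norm (line_pt (\<alpha>, 0) (1, mm) t) < 1"
        using pencil_line_disc(2)[OF s(1) s1 R(2,3) nl] that by (simp add: c_def)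
      then show ?thesis
        using norm_fst_le[of "\<alpha> + t" "t * mm"] by (simp add: line_pt_def)
    qed
    have I0: "circle_int (\<lambda>u. u * (F (line_pt (\<alpha>, 0) (1, mm) (c + of_real R * u)) * X (c + of_real R * u))) = 0"
    proof (rule line_ext_Cauchy[OF _ R(1) F])
      show "line_ext F (\<alpha>, 0) (1, mm)" using ext by (simp add: pencil_ext_def zero_prod_def)
      show "norm (line_pt (\<alpha>, 0) (1, mm) t) \<le> 1 \<longleftrightarrow> t \<in> cball c R" for t
        unfolding c_def by (rule pencil_line_disc[OF s(1) s1 R(2,3) nl])
      show "norm (line_pt (\<alpha>, 0) (1, mm) t) < 1 \<longleftrightarrow> t \<in> ball c R" for t
        unfolding c_def by (rule pencil_line_disc[OF s(1) s1 R(2,3) nl])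
      have "continuous_on (cball c R) (\<lambda>t. \<phi> (\<alpha> + t))"
        by (rule continuous_on_compose2[OF phi(1) _ image_subsetI[OF sub]]) (auto intro!: continuous_intros)
      then show "continuous_on (cball c R) X" unfolding X_def d_def by (intro continuous_intros)
      have "(\<phi> \<circ> (\<lambda>t. \<alpha> + t)) holomorphic_on ball c R"
        by (rule holomorphic_on_compose_gen[OF _ phi(2) image_subsetI[OF sub']]) (auto intro!: holomorphic_intros)
      then show "X holomorphic_on ball c R" unfolding X_def d_def o_def by (intro holomorphic_intros)
    qed
    have HKeq: "H u \<theta> * K u = u * (F (line_pt (\<alpha>, 0) (1, mm) (c + of_real R * u)) * X (c + of_real R * u))"
      if u: "norm u = 1" for u
    proof -
      define t where "t = c + of_real R * u"
      have uu: "u * cnj u = 1" using u complex_norm_square[of u] by simp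
      define D where "D = complex_of_real R * u"
      have DD: "D * cnj D = of_real (R\<^sup>2)" using uu by (simp add: D_def power2_eq_square) 
      have dt: "d t = D" by (simp add: d_def t_def D_def)
      have Zu: "Z u = \<alpha> + t" by (simp add: Zc t_def)
      have Zs: "Z u = of_real s * \<alpha> + D" by (simp add: Z_def pencil_pt_def D_def R_def)
      have tD: "t = of_real (s - 1) * \<alpha> + D" by (simp add: t_def c_def D_def)
      have z1: "D * cnj (Z u) = of_real s * cnj \<alpha> * D + of_real (R\<^sup>2)"
        unfolding Zs using DD by (simp add: algebra_simps)
      have z2: "D * cnj t = of_real (s - 1) * cnj \<alpha> * D + of_real (R\<^sup>2)"
        unfolding tD using DD by (simp add: algebra_simps)
      have jac: "of_real (pencil_jac \<alpha> s u) * D = a1 * D - cnj \<alpha> * D\<^sup>2 - \<alpha> * of_real (R\<^sup>2)"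
      proof -
        have "of_real (pencil_jac \<alpha> s u) = a1 - of_real R * (of_real (2 * Re (cnj \<alpha> * u)))"
          by (simp add: pencil_jac_def a1_def R_def)
        also have "of_real (2 * Re (cnj \<alpha> * u)) = cnj \<alpha> * u + \<alpha> * cnj u"
          using complex_add_cnj[of "cnj \<alpha> * u"] by simp
        finally have "of_real (pencil_jac \<alpha> s u) = a1 - cnj \<alpha> * D - \<alpha> * cnj D"
          by (simp add: D_def algebra_simps)
        then have "of_real (pencil_jac \<alpha> s u) * D = (a1 - cnj \<alpha> * D - \<alpha> * cnj D) * D" by (rule arg_cong)
        also have "\<dots> = a1 * D - cnj \<alpha> * D\<^sup>2 - \<alpha> * (D * cnj D)" by (simp add: algebra_simps power2_eq_square)
        finally show ?thesis unfolding DD .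
      qed
      have "K u = (D * cnj (Z u)) ^ n * (of_real (pencil_jac \<alpha> s u) * D) * D ^ j * D * \<phi> (Z u)"
        unfolding K_def D_def[symmetric] by (simp add: power_add power_mult_distrib power2_eq_square mult_ac)
      moreover have "H u \<theta> = F (\<alpha> + t, mm * t) * (mm * t) ^ i * (cnj mm ^ j * cnj t ^ j)"
        unfolding H_def Zu mm_def by (simp add: power_mult_distrib)
      ultimately have E: "H u \<theta> * K u = F (\<alpha> + t, mm * t) * (mm * t) ^ i * cnj mm ^ j * (D * cnj t) ^ j * (D * cnj (Z u)) ^ n
          * (of_real (pencil_jac \<alpha> s u) * D) * D * \<phi> (Z u)"
        by (simp add: power_mult_distrib mult_ac)
      have regroup: "f * a * b * p * q * k * D * g = u * (f * (a * b * p * q * k * S * g))" if "D = S * u"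
        for f a b p q k D g u S :: complex
        using that by (simp add: mult_ac)
      have LP: "line_pt (\<alpha>, 0) (1, mm) t = (\<alpha> + t, mm * t)" by (simp add: line_pt_def mult.commute)
      show ?thesis
        unfolding E[unfolded z1 z2 jac, unfolded Zu] t_def[symmetric] X_def dt LP by (rule regroup[OF D_def])
    qed
    show "circle_int (\<lambda>u. H u \<theta> * K u) = 0"
      by (rule trans[OF circle_int_cong[OF HKeq] I0])
  qed
  finally show ?thesis by simp
qed simp

definition pencil_coeff :: "complex \<Rightarrow> (complex \<Rightarrow> complex) \<Rightarrow> nat \<Rightarrow> real \<Rightarrow> complex" where
  "pencil_coeff \<alpha> \<psi> q s = circle_int (\<lambda>u. \<psi> (pencil_pt \<alpha> s u) * of_real (pencil_jac \<alpha> s u) * (of_real (pencil_rad \<alpha> s) * u) ^ q)"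

lemma pencil_coeff_continuous:
  assumes "continuous_on (cball 0 1) \<psi>"
  shows "continuous_on {0..pencil_len \<alpha>} (pencil_coeff \<alpha> \<psi> q)"
  unfolding pencil_coeff_def[abs_def]
proof (rule continuous_on_circle_int)
  show "continuous_on ({0..pencil_len \<alpha>} \<times> sphere 0 1)
      (\<lambda>(s, u). \<psi> (pencil_pt \<alpha> s u) * of_real (pencil_jac \<alpha> s u) * (of_real (pencil_rad \<alpha> s) * u) ^ q)"
  proof -
    have a: "continuous_on ({0..pencil_len \<alpha>} \<times> sphere 0 1) (\<lambda>p. \<psi> (pencil_pt \<alpha> (fst p) (snd p)) * of_real (pencil_jac \<alpha> (fst p) (snd p)))"
      using pencil_integrand_continuous[OF assms, of \<alpha>] by (simp add: split_beta)
    have b: "continuous_on ({0..pencil_len \<alpha>} \<times> sphere 0 1) (\<lambda>p. (complex_of_real (pencil_rad \<alpha> (fst p)) * snd p) ^ q)"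
      by (intro continuous_intros)
    show ?thesis using continuous_on_mult[OF a b] by (simp add: split_beta)
  qed
qed

lemma pencil_center_norm:
  assumes "0 \<le> s" "s \<le> pencil_len \<alpha>"
  shows "norm (of_real s * \<alpha>) \<le> 1"
proof (cases "norm \<alpha> \<le> 1")
  case True
  then have "s * norm \<alpha> \<le> 1 * 1" using assms pencil_len_bounds[of \<alpha>] by (intro mult_mono) auto
  then show ?thesis using assms by (simp add: norm_mult)
next
  case False
  have "s * norm \<alpha> \<le> s * (norm \<alpha>)\<^sup>2"
    using False assms self_le_power[of "norm \<alpha>" 2] by (intro mult_left_mono) auto
  also have "\<dots> \<le> pencil_len \<alpha> * (norm \<alpha>)\<^sup>2" using assms by (intro mult_right_mono) auto
  also have "\<dots> \<le> 1" by (rule pencil_len_bounds)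
  finally show ?thesis using assms by (simp add: norm_mult)
qed

lemma geometric_split:
  fixes c y :: complex
  assumes "c \<noteq> 0" "c - y \<noteq> 0"
  shows "1 / (c - y) = (\<Sum>q<N. y ^ q / c ^ Suc q) + (y / c) ^ N / (c - y)"
proof -
  have cy: "1 - y / c \<noteq> 0" using assms by (simp add: field_simps)
  have "(\<Sum>q<N. y ^ q / c ^ Suc q) = (\<Sum>q<N. (y / c) ^ q) / c"
    by (simp add: sum_divide_distrib power_divide mult.commute)
  also have "(\<Sum>q<N. (y / c) ^ q) = (1 - (y / c) ^ N) / (1 - y / c)"
    using cy by (subst sum_gp_strict) auto
  also have "\<dots> / c = (1 - (y / c) ^ N) / (c - y)"
  proof -
    have "(1 - y / c) * c = c - y" using assms(1) by (simp add: field_simps)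
    then show ?thesis by (simp add: divide_divide_eq_left)
  qed
  finally show ?thesis by (simp add: diff_divide_distrib)
qed

text \<open>
  On the circle with parameter \<open>s\<close>, \<open>1 - z * \<xi> = (1 - s * \<alpha> * \<xi>) - D * \<xi>\<close> with \<open>D = pencil_rad \<alpha> s * u\<close>.
  Expand the resolvent in powers of \<open>D\<close>: by \<open>pencil_moment_high_order\<close>, with \<open>\<phi> z = 1 / (1 - z * \<xi>)\<close>, the
  remainder after \<open>n + j + 2\<close> terms integrates to zero.  So the sum is finite, and it makes sense off
  the ray.
\<close>

lemma pencil_area_resolvent:
  fixes n i j :: nat
  assumes F: "continuous_on (sphere 0 1) F" and ext: "pencil_ext F (\<alpha>, 0)" and xi: "norm \<xi> < 1"
  defines "\<psi> \<equiv> (\<lambda>z. cnj z ^ n * fibre_coeff F i j z)"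
  shows "pencil_area \<alpha> (\<lambda>z. \<psi> z / (1 - z * \<xi>)) = ray_int (pencil_coeff \<alpha> \<psi>) \<alpha> (pencil_len \<alpha>) (n + j + 2) \<xi>"
proof -
  define N where "N = n + j + 2"
  have psi: "continuous_on (cball 0 1) \<psi>"
    unfolding \<psi>_def by (intro continuous_intros fibre_coeff_continuous F)
  have nz: "1 - z * \<xi> \<noteq> 0" if "norm z \<le> 1" for z
  proof
    assume "1 - z * \<xi> = 0"
    then have "norm z * norm \<xi> = 1" by (metis eq_iff_diff_eq_0 norm_mult norm_one)
    moreover have "norm z * norm \<xi> \<le> 1 * norm \<xi>" using that by (intro mult_right_mono) auto
    ultimately show False using xi by simp
  qed
  have phi: "continuous_on (cball 0 1) (\<lambda>z. 1 / (1 - z * \<xi>))" "(\<lambda>z. 1 / (1 - z * \<xi>)) holomorphic_on ball 0 1"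
    by (intro continuous_intros, use nz in auto, intro holomorphic_intros, use nz in auto)
  have inner: "circle_int (\<lambda>u. \<psi> (pencil_pt \<alpha> s u) / (1 - pencil_pt \<alpha> s u * \<xi>) * of_real (pencil_jac \<alpha> s u))
      = (\<Sum>q<N. pencil_coeff \<alpha> \<psi> q s * \<xi> ^ q / (1 - of_real s * \<alpha> * \<xi>) ^ Suc q)"
    if s: "s \<in> {0..pencil_len \<alpha>}" for s
  proof -
    have s': "0 \<le> s" "s \<le> pencil_len \<alpha>" using s by auto
    define c where "c = 1 - of_real s * \<alpha> * \<xi>"
    define Y where "Y u = of_real (pencil_rad \<alpha> s) * u * \<xi>" for u
    have c: "c \<noteq> 0" unfolding c_def using nz[OF pencil_center_norm[OF s']] .
    have Z: "1 - pencil_pt \<alpha> s u * \<xi> = c - Y u" for u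
      by (simp add: c_def Y_def pencil_pt_def algebra_simps)
    have cY: "c - Y u \<noteq> 0" if "norm u = 1" for u
      using nz[of "pencil_pt \<alpha> s u"] pencil_pt_in_disc[OF s' that] unfolding Z by simp
    define h where "h u = \<psi> (pencil_pt \<alpha> s u) * of_real (pencil_jac \<alpha> s u)" for u
    have hc: "continuous_on (sphere 0 1) h"
      unfolding h_def using pencil_circle_continuous[OF psi s'] .
    define rest where "rest u = h u * (of_real (pencil_rad \<alpha> s) * u) ^ N * (1 / (1 - pencil_pt \<alpha> s u * \<xi>))" for u
    have rest: "circle_int rest = 0"
      using pencil_moment_high_order[OF F ext s' phi, of n i j] unfolding rest_def h_def \<psi>_def N_def by (simp add: mult_ac)
    have restc: "continuous_on (sphere 0 1) rest"
      unfolding rest_def Z Y_def by (intro continuous_intros hc) (use cY in \<open>auto simp: Y_def\<close>)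
    have "circle_int (\<lambda>u. \<psi> (pencil_pt \<alpha> s u) / (1 - pencil_pt \<alpha> s u * \<xi>) * of_real (pencil_jac \<alpha> s u))
        = circle_int (\<lambda>u. (\<Sum>q<N. \<xi> ^ q / c ^ Suc q * (h u * (of_real (pencil_rad \<alpha> s) * u) ^ q)) + (\<xi> / c) ^ N * rest u)"
    proof (rule circle_int_cong)
      fix u :: complex assume u: "norm u = 1"
      have "\<psi> (pencil_pt \<alpha> s u) / (1 - pencil_pt \<alpha> s u * \<xi>) * of_real (pencil_jac \<alpha> s u) = h u * (1 / (c - Y u))"
        by (simp add: h_def Z)
      also have "\<dots> = (\<Sum>q<N. h u * (Y u ^ q / c ^ Suc q)) + h u * ((Y u / c) ^ N / (c - Y u))"
        unfolding geometric_split[OF c cY[OF u], of N] by (simp only: distrib_left sum_distrib_left)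
      also have "(\<Sum>q<N. h u * (Y u ^ q / c ^ Suc q)) = (\<Sum>q<N. \<xi> ^ q / c ^ Suc q * (h u * (of_real (pencil_rad \<alpha> s) * u) ^ q))"
        by (rule sum.cong) (auto simp: Y_def power_mult_distrib)
      also have "h u * ((Y u / c) ^ N / (c - Y u)) = (\<xi> / c) ^ N * rest u"
        unfolding rest_def Z by (simp add: Y_def power_mult_distrib power_divide)
      finally show "\<psi> (pencil_pt \<alpha> s u) / (1 - pencil_pt \<alpha> s u * \<xi>) * of_real (pencil_jac \<alpha> s u)
         = (\<Sum>q<N. \<xi> ^ q / c ^ Suc q * (h u * (of_real (pencil_rad \<alpha> s) * u) ^ q)) + (\<xi> / c) ^ N * rest u" .
    qed
    also have "\<dots> = circle_int (\<lambda>u. \<Sum>q<N. \<xi> ^ q / c ^ Suc q * (h u * (of_real (pencil_rad \<alpha> s) * u) ^ q)) + circle_int (\<lambda>u. (\<xi> / c) ^ N * rest u)"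
      by (rule circle_int_add) (use c in \<open>auto intro!: continuous_intros hc restc\<close>)
    also have "circle_int (\<lambda>u. (\<xi> / c) ^ N * rest u) = 0" by (simp only: circle_int_cmult rest mult_zero_right)
    also have "circle_int (\<lambda>u. \<Sum>q<N. \<xi> ^ q / c ^ Suc q * (h u * (of_real (pencil_rad \<alpha> s) * u) ^ q))
        = (\<Sum>q<N. circle_int (\<lambda>u. \<xi> ^ q / c ^ Suc q * (h u * (of_real (pencil_rad \<alpha> s) * u) ^ q)))"
      by (rule circle_int_sum) (use c in \<open>auto intro!: continuous_intros hc\<close>)
    finally show ?thesis
      unfolding circle_int_cmult c_def by (simp add: pencil_coeff_def h_def mult.commute)
  qed
  have cont: "continuous_on {0..pencil_len \<alpha>} (\<lambda>s. pencil_coeff \<alpha> \<psi> q s * \<xi> ^ q / (1 - of_real s * \<alpha> * \<xi>) ^ Suc q)" for q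
    by (intro continuous_intros pencil_coeff_continuous psi) (use nz pencil_center_norm in auto)
  have "pencil_area \<alpha> (\<lambda>z. \<psi> z / (1 - z * \<xi>)) = integral {0..pencil_len \<alpha>}
      (\<lambda>s. \<Sum>q<N. pencil_coeff \<alpha> \<psi> q s * \<xi> ^ q / (1 - of_real s * \<alpha> * \<xi>) ^ Suc q)"
    unfolding pencil_area_def by (rule integral_cong) (rule inner)
  also have "\<dots> = ray_int (pencil_coeff \<alpha> \<psi>) \<alpha> (pencil_len \<alpha>) N \<xi>"
    unfolding ray_int_def by (rule integral_sum) (simp_all only: finite_lessThan integrable_continuous_real[OF cont])
  finally show ?thesis by (simp add: N_def)
qed

lemma pencil_area_resolvent_sums:
  assumes psi: "continuous_on (cball 0 1) \<psi>" and xi: "norm \<xi> < 1"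
  shows "(\<lambda>m. pencil_area \<alpha> (\<lambda>z. \<psi> z * z ^ m) * \<xi> ^ m) sums pencil_area \<alpha> (\<lambda>z. \<psi> z / (1 - z * \<xi>))"
proof -
  obtain B where B: "B > 0" "\<And>z. z \<in> cball 0 1 \<Longrightarrow> norm (\<psi> z) \<le> B"
    using compact_imp_bounded[OF compact_continuous_image[OF psi compact_cball]]
    unfolding bounded_pos by auto
  have zx: "norm (z * \<xi>) \<le> norm \<xi>" if "norm z \<le> 1" for z
    using that by (simp add: norm_mult mult_left_le_one_le)
  have nz: "1 - z * \<xi> \<noteq> 0" if "norm z \<le> 1" for z
    using zx[OF that] xi by (metis eq_iff_diff_eq_0 not_less norm_one)
  have lo: "1 - norm \<xi> \<le> norm (1 - z * \<xi>)" if "norm z \<le> 1" for z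
    using zx[OF that] norm_triangle_ineq2[of 1 "z * \<xi>"] by simp
  define C where "C = 2 * pi * (1 + norm \<alpha>)\<^sup>2 * (B / (1 - norm \<xi>))"
  have est: "norm (pencil_area \<alpha> (\<lambda>z. \<psi> z / (1 - z * \<xi>)) - (\<Sum>m<K. pencil_area \<alpha> (\<lambda>z. \<psi> z * z ^ m) * \<xi> ^ m)) \<le> C * norm \<xi> ^ K" for K
  proof -
    have c1: "continuous_on (cball 0 1) (\<lambda>z. \<psi> z / (1 - z * \<xi>))"
      by (intro continuous_intros psi) (use nz in auto)
    have c2: "continuous_on (cball 0 1) (\<lambda>z. \<Sum>m<k. \<xi> ^ m * (\<psi> z * z ^ m))" for k
      by (intro continuous_intros psi)
    have "pencil_area \<alpha> (\<lambda>z. \<Sum>m<k. \<xi> ^ m * (\<psi> z * z ^ m)) = (\<Sum>m<k. pencil_area \<alpha> (\<lambda>z. \<psi> z * z ^ m) * \<xi> ^ m)" for k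
    proof (induction k)
      case 0 show ?case by (simp add: pencil_area_def)
    next
      case (Suc k)
      have "pencil_area \<alpha> (\<lambda>z. \<Sum>m<Suc k. \<xi> ^ m * (\<psi> z * z ^ m)) =
          pencil_area \<alpha> (\<lambda>z. \<Sum>m<k. \<xi> ^ m * (\<psi> z * z ^ m)) + pencil_area \<alpha> (\<lambda>z. \<xi> ^ k * (\<psi> z * z ^ k))"
        unfolding sum.lessThan_Suc by (rule pencil_area_add) (intro continuous_intros psi)+
      then show ?case unfolding pencil_area_cmult Suc by (simp add: mult.commute)
    qed
    then have "pencil_area \<alpha> (\<lambda>z. \<psi> z / (1 - z * \<xi>)) - (\<Sum>m<K. pencil_area \<alpha> (\<lambda>z. \<psi> z * z ^ m) * \<xi> ^ m)
        = pencil_area \<alpha> (\<lambda>z. \<psi> z / (1 - z * \<xi>) - (\<Sum>m<K. \<xi> ^ m * (\<psi> z * z ^ m)))"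
      using pencil_area_diff[OF c1 c2, of \<alpha> K] by simp
    also have "norm \<dots> \<le> 2 * pi * (1 + norm \<alpha>)\<^sup>2 * (B / (1 - norm \<xi>) * norm \<xi> ^ K)"
    proof (rule pencil_area_bound)
      show "continuous_on (cball 0 1) (\<lambda>z. \<psi> z / (1 - z * \<xi>) - (\<Sum>m<K. \<xi> ^ m * (\<psi> z * z ^ m)))"
        by (intro continuous_on_diff c1 c2)
      fix z :: complex assume z: "norm z \<le> 1"
      have "\<psi> z / (1 - z * \<xi>) - (\<Sum>m<K. \<xi> ^ m * (\<psi> z * z ^ m)) = \<psi> z * ((z * \<xi>) ^ K / (1 - z * \<xi>))"
      proof -
        have "1 / (1 - z * \<xi>) = (\<Sum>m<K. (z * \<xi>) ^ m) + (z * \<xi>) ^ K / (1 - z * \<xi>)"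
          using geometric_split[of 1 "z * \<xi>" K] nz[OF z] by simp
        then have "\<psi> z / (1 - z * \<xi>) = \<psi> z * (\<Sum>m<K. (z * \<xi>) ^ m) + \<psi> z * ((z * \<xi>) ^ K / (1 - z * \<xi>))"
          by (metis distrib_left times_divide_eq_right mult.right_neutral)
        then show ?thesis by (simp add: sum_distrib_left power_mult_distrib mult_ac)
      qed
      also have "norm \<dots> \<le> B * (norm \<xi> ^ K / (1 - norm \<xi>))"
        unfolding norm_mult norm_divide norm_power
        using B(2)[of z] z B(1) zx[OF z] lo[OF z] xi
        by (intro mult_mono frac_le power_mono) (auto simp: norm_mult)
      finally show "norm (\<psi> z / (1 - z * \<xi>) - (\<Sum>m<K. \<xi> ^ m * (\<psi> z * z ^ m))) \<le> B / (1 - norm \<xi>) * norm \<xi> ^ K" by simp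
    qed
    finally show ?thesis by (simp add: C_def mult_ac)
  qed
  have "(\<lambda>K. C * norm \<xi> ^ K) \<longlonglongrightarrow> C * 0"
    by (intro tendsto_intros LIMSEQ_realpow_zero) (use xi in auto)
  then have "(\<lambda>K. C * norm \<xi> ^ K) \<longlonglongrightarrow> 0" by simp
  then have "(\<lambda>K. pencil_area \<alpha> (\<lambda>z. \<psi> z / (1 - z * \<xi>)) - (\<Sum>m<K. pencil_area \<alpha> (\<lambda>z. \<psi> z * z ^ m) * \<xi> ^ m)) \<longlonglongrightarrow> 0"
    by (rule Lim_null_comparison[rotated]) (simp add: est)
  from tendsto_diff[OF tendsto_const[of "pencil_area \<alpha> (\<lambda>z. \<psi> z / (1 - z * \<xi>))"] this]
  show ?thesis unfolding sums_def by simp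
qed

text \<open>
  For \<open>k = 1\<close> the factor \<open>sqrt s\<close> reflects the shrinking of the fibres near the unit circle: the one over \<open>z\<close> has radius
  \<open>sqrt (1 - (norm z)\<^sup>2)\<close>, which is at most \<open>sqrt s * (1 + norm \<alpha>)\<close> by \<open>pencil_identities\<close>.
\<close>

lemma pencil_coeff_bound:
  assumes F: "continuous_on (sphere 0 1) F" and B: "\<And>x. x \<in> sphere 0 1 \<Longrightarrow> norm (F x) \<le> B" "B \<ge> 0"
    and k: "k \<le> 1" "k \<le> i + j" and s: "s \<in> {0..pencil_len \<alpha>}"
  shows "norm (pencil_coeff \<alpha> (\<lambda>z. cnj z ^ n * fibre_coeff F i j z) q s) \<le> (4 * pi\<^sup>2 * B * (1 + norm \<alpha>) ^ 3) * sqrt s ^ k"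
proof -
  have s': "0 \<le> s" "s \<le> pencil_len \<alpha>" using s by auto
  have psi: "continuous_on (cball 0 1) (\<lambda>z. cnj z ^ n * fibre_coeff F i j z)"
    by (intro continuous_intros fibre_coeff_continuous F)
  have "norm (pencil_coeff \<alpha> (\<lambda>z. cnj z ^ n * fibre_coeff F i j z) q s) \<le> 2 * pi * (2 * pi * (B * (sqrt s * (1 + norm \<alpha>)) ^ k) * (1 + norm \<alpha>)\<^sup>2)"
    unfolding pencil_coeff_def
  proof (rule circle_int_bound)
    show "continuous_on (sphere 0 1) (\<lambda>u. cnj (pencil_pt \<alpha> s u) ^ n * fibre_coeff F i j (pencil_pt \<alpha> s u) * of_real (pencil_jac \<alpha> s u) * (of_real (pencil_rad \<alpha> s) * u) ^ q)"
      by (intro continuous_intros pencil_circle_continuous[OF psi s'])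
    fix u :: complex assume u: "norm u = 1"
    define z where "z = pencil_pt \<alpha> s u"
    have z: "norm z \<le> 1" using pencil_pt_in_disc[OF s' u] by (simp add: z_def)
    define w where "w = sqrt (1 - (norm z)\<^sup>2)"
    have J: "0 \<le> pencil_jac \<alpha> s u" "pencil_jac \<alpha> s u \<le> (1 + norm \<alpha>)\<^sup>2" using pencil_jac_bounds[OF s' u] .
    have w: "0 \<le> w" "w \<le> 1" using z by (auto simp: w_def power_le_one_iff)
    have "1 - (norm z)\<^sup>2 \<le> s * (1 + norm \<alpha>)\<^sup>2"
      unfolding z_def pencil_identities(1)[OF s' u] using J s' by (intro mult_left_mono) auto
    then have "w \<le> sqrt (s * (1 + norm \<alpha>)\<^sup>2)" unfolding w_def by simp
    then have ws: "w \<le> sqrt s * (1 + norm \<alpha>)" by (simp add: real_sqrt_mult)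
    have "norm (fibre_coeff F i j z) \<le> 2 * pi * (B * w ^ (i + j))"
      unfolding w_def by (rule fibre_coeff_bound[OF F B(1) z])
    also have "\<dots> \<le> 2 * pi * (B * (sqrt s * (1 + norm \<alpha>)) ^ k)"
    proof -
      have "w ^ (i + j) \<le> w ^ k" using w k by (intro power_decreasing) auto
      also have "\<dots> \<le> (sqrt s * (1 + norm \<alpha>)) ^ k" using ws w by (intro power_mono) auto
      finally show ?thesis using B by (intro mult_left_mono) auto
    qed
    finally have f: "norm (fibre_coeff F i j z) \<le> 2 * pi * (B * (sqrt s * (1 + norm \<alpha>)) ^ k)" .
    have r: "norm (of_real (pencil_rad \<alpha> s) * u) ^ q \<le> 1"
      using pencil_rad_sq(2)[OF s'] pencil_rad_le_1[OF s'] u by (intro power_le_one) (auto simp: norm_mult)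
    have "norm (cnj z ^ n * fibre_coeff F i j z * of_real (pencil_jac \<alpha> s u) * (of_real (pencil_rad \<alpha> s) * u) ^ q)
        = norm z ^ n * norm (fibre_coeff F i j z) * pencil_jac \<alpha> s u * norm (of_real (pencil_rad \<alpha> s) * u) ^ q"
      using J by (simp add: norm_mult norm_power)
    also have "\<dots> \<le> 1 * (2 * pi * (B * (sqrt s * (1 + norm \<alpha>)) ^ k)) * (1 + norm \<alpha>)\<^sup>2 * 1"
      using J B s' by (intro mult_mono f r power_le_one z) auto
    finally show "norm (cnj (pencil_pt \<alpha> s u) ^ n * fibre_coeff F i j (pencil_pt \<alpha> s u) * of_real (pencil_jac \<alpha> s u) * (of_real (pencil_rad \<alpha> s) * u) ^ q)
       \<le> 2 * pi * (B * (sqrt s * (1 + norm \<alpha>)) ^ k) * (1 + norm \<alpha>)\<^sup>2"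
      by (simp add: z_def)
  qed
  also have "\<dots> = (4 * pi\<^sup>2 * B * ((1 + norm \<alpha>) ^ k * (1 + norm \<alpha>)\<^sup>2)) * sqrt s ^ k"
    by (simp add: power_mult_distrib power2_eq_square mult_ac)
  also have "\<dots> \<le> (4 * pi\<^sup>2 * B * (1 + norm \<alpha>) ^ 3) * sqrt s ^ k"
  proof -
    have "(1 + norm \<alpha>) ^ k * (1 + norm \<alpha>)\<^sup>2 \<le> (1 + norm \<alpha>) ^ 3"
      unfolding power_add[symmetric] using k by (intro power_increasing) auto
    then show ?thesis using B s' by (intro mult_right_mono mult_left_mono) auto
  qed
  finally show ?thesis .
qed

text \<open>
  By \<open>pencil_area_independent\<close> the moments are the same for both pencils, and by \<open>pencil_area_resolvent\<close>
  their generating function is a \<open>ray_int\<close> for \<open>\<alpha>\<close> and one for \<open>\<beta>\<close>.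
\<close>

theorem two_pencil_moments_vanish:
  assumes F: "continuous_on (sphere 0 1) F"
    and ext: "pencil_ext F (\<alpha>, 0)" "pencil_ext F (\<beta>, 0)" and ab: "Im (\<alpha> * cnj \<beta>) \<noteq> 0"
    and k: "k \<le> 1" "k \<le> i + j" "m + k > n + j"
  shows "pencil_area 0 (\<lambda>z. cnj z ^ n * fibre_coeff F i j z * z ^ m) = 0"
proof -
  define \<psi> where "\<psi> = (\<lambda>z. cnj z ^ n * fibre_coeff F i j z)"
  obtain B where B: "B > 0" "\<And>x. x \<in> sphere 0 1 \<Longrightarrow> norm (F x) \<le> B"
    using compact_imp_bounded[OF compact_continuous_image[OF F compact_sphere]]
    unfolding bounded_pos by auto
  have psi: "continuous_on (cball 0 1) \<psi>"
    unfolding \<psi>_def by (intro continuous_intros fibre_coeff_continuous F)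
  define C where "C = 4 * pi\<^sup>2 * B * (1 + norm \<alpha>) ^ 3 + 4 * pi\<^sup>2 * B * (1 + norm \<beta>) ^ 3"
  have C1: "4 * pi\<^sup>2 * B * (1 + norm \<alpha>) ^ 3 \<le> C" "4 * pi\<^sup>2 * B * (1 + norm \<beta>) ^ 3 \<le> C" "0 \<le> C"
    using B by (auto simp: C_def)
  have bound: "norm (pencil_coeff \<gamma> \<psi> q s) \<le> C * sqrt s ^ k"
    if "4 * pi\<^sup>2 * B * (1 + norm \<gamma>) ^ 3 \<le> C" "s \<in> {0..pencil_len \<gamma>}" for \<gamma> q s
  proof -
    have "norm (pencil_coeff \<gamma> \<psi> q s) \<le> (4 * pi\<^sup>2 * B * (1 + norm \<gamma>) ^ 3) * sqrt s ^ k"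
      unfolding \<psi>_def using B k that(2) by (intro pencil_coeff_bound[OF F]) auto
    also have "\<dots> \<le> C * sqrt s ^ k" using that by (intro mult_right_mono) auto
    finally show ?thesis .
  qed
  have rsum: "(\<lambda>m. pencil_area 0 (\<lambda>z. \<psi> z * z ^ m) * \<xi> ^ m) sums ray_int (pencil_coeff \<gamma> \<psi>) \<gamma> (pencil_len \<gamma>) (n + j + 2) \<xi>"
    if "norm \<xi> < 1" "pencil_ext F (\<gamma>, 0)" for \<xi> \<gamma>
  proof -
    have e: "pencil_area 0 (\<lambda>z. \<psi> z * z ^ m) = pencil_area \<gamma> (\<lambda>z. \<psi> z * z ^ m)" for m
      by (rule pencil_area_independent) (intro continuous_intros psi)
    have R: "ray_int (pencil_coeff \<gamma> \<psi>) \<gamma> (pencil_len \<gamma>) (n + j + 2) \<xi> = pencil_area \<gamma> (\<lambda>z. \<psi> z / (1 - z * \<xi>))"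
      unfolding \<psi>_def by (rule pencil_area_resolvent[OF F that(2,1), symmetric])
    show ?thesis unfolding e R by (rule pencil_area_resolvent_sums[OF psi that(1)])
  qed
  have "pencil_area 0 (\<lambda>z. \<psi> z * z ^ m) = 0"
    by (rule two_ray_coefficients_vanish[OF ab, of "n + j" "pencil_len \<alpha>" "pencil_coeff \<alpha> \<psi>" "pencil_len \<beta>" "pencil_coeff \<beta> \<psi>" C k
          "\<lambda>m. pencil_area 0 (\<lambda>z. \<psi> z * z ^ m)" m])
       (use bound C1 rsum ext k pencil_len_bounds[of \<alpha>] pencil_len_bounds[of \<beta>] pencil_coeff_continuous[OF psi] in auto)
  then show ?thesis by (simp add: \<psi>_def)
qed

lemma pencil_area_at_0:
  "pencil_area 0 \<psi> = integral {0..1} (\<lambda>s. circle_int (\<lambda>u. \<psi> (of_real (sqrt (1 - s)) * u)))"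
  by (simp add: pencil_area_def pencil_len_def pencil_pt_def pencil_rad_def pencil_jac_def)

text \<open>
  With \<open>m = n + l\<close>, the vanishing moments are the moments of order \<open>n\<close> on \<open>{0..1}\<close>, in the variable
  \<open>(norm z)\<^sup>2\<close>, of a Fourier coefficient of \<open>fibre_coeff F i j\<close> on the concentric circles.
\<close>

theorem two_pencil_fourier_vanish:
  assumes F: "continuous_on (sphere 0 1) F"
    and ext: "pencil_ext F (\<alpha>, 0)" "pencil_ext F (\<beta>, 0)" and ab: "Im (\<alpha> * cnj \<beta>) \<noteq> 0"
    and k: "k \<le> 1" "k \<le> i + j" "l + k > j" and r: "0 \<le> r" "r \<le> 1"
  shows "circle_int (\<lambda>u. fibre_coeff F i j (of_real r * u) * (of_real r * u) ^ l) = 0"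
proof -
  define V where "V t = circle_int (\<lambda>u. fibre_coeff F i j (of_real (sqrt t) * u) * (of_real (sqrt t) * u) ^ l)" for t
  have "V (r\<^sup>2) = 0"
  proof (rule interval_moments_zero)
    have "continuous_on ({0..1} \<times> sphere 0 1) (\<lambda>(t, u). fibre_coeff F i j (of_real (sqrt t) * u) * (of_real (sqrt t) * u) ^ l)"
      unfolding split_beta
      by (intro continuous_intros continuous_on_compose2[OF fibre_coeff_continuous[OF F]])
         (auto simp: norm_mult)
    then show "continuous_on {0..1} V"
      unfolding V_def[abs_def] by (rule continuous_on_circle_int)
    show "r\<^sup>2 \<in> {0..1}" using r by (simp add: power_le_one)
    fix n
    have "0 = pencil_area 0 (\<lambda>z. cnj z ^ n * fibre_coeff F i j z * z ^ (n + l))"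
      by (rule two_pencil_moments_vanish[OF F ext ab k(1,2), symmetric]) (use k in auto)
    also have "\<dots> = integral {0..1} (\<lambda>s. of_real ((1 - s) ^ n) * V (1 - s))"
      unfolding pencil_area_at_0
    proof (rule integral_cong)
      fix s :: real assume s: "s \<in> {0..1}"
      show "circle_int (\<lambda>u. cnj (of_real (sqrt (1 - s)) * u) ^ n * fibre_coeff F i j (of_real (sqrt (1 - s)) * u) * (of_real (sqrt (1 - s)) * u) ^ (n + l))
         = of_real ((1 - s) ^ n) * V (1 - s)"
        unfolding V_def circle_int_cmult[symmetric]
      proof (rule circle_int_cong)
        fix u :: complex assume u: "norm u = 1"
        define z where "z = of_real (sqrt (1 - s)) * u"
        have "z * cnj z = of_real ((norm z)\<^sup>2)" by (rule complex_norm_square[symmetric])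
        also have "(norm z)\<^sup>2 = 1 - s" using s u by (simp add: z_def norm_mult)
        finally have "cnj z ^ n * z ^ n = of_real ((1 - s) ^ n)"
          by (simp only: power_mult_distrib[symmetric] mult.commute of_real_power)
        then show "cnj (of_real (sqrt (1 - s)) * u) ^ n * fibre_coeff F i j (of_real (sqrt (1 - s)) * u) * (of_real (sqrt (1 - s)) * u) ^ (n + l)
          = of_real ((1 - s) ^ n) * (fibre_coeff F i j (of_real (sqrt (1 - s)) * u) * (of_real (sqrt (1 - s)) * u) ^ l)"
          unfolding z_def[symmetric] power_add by (metis mult.assoc mult.left_commute)
      qed
    qed
    also have "\<dots> = integral {0..1} (\<lambda>t. of_real (t ^ n) * V t)"
      using Henstock_Kurzweil_Integration.integral_reflect_real[where b=1 and a=0 and f="\<lambda>s. of_real ((1 - s) ^ n) * V (1 - s)", symmetric]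
        integral_shift_real_ivl[of 0 1 1 "\<lambda>t. of_real (t ^ n) * V t"]
      by (simp add: add.commute)
    finally show "integral {0..1} (\<lambda>t. of_real (t ^ n) * V t) = 0" by simp
  qed
  then show ?thesis using r by (simp add: V_def)
qed

section \<open>A third point from two in normalised position\<close>

text \<open>
  The case \<open>k = 1\<close>, \<open>j = l = 0\<close>, \<open>r = 0\<close> of \<open>two_pencil_fourier_vanish\<close>.
\<close>

lemma two_pencil_axis_modes:
  assumes F: "continuous_on (sphere 0 1) F"
    and ext: "pencil_ext F (\<alpha>, 0)" "pencil_ext F (\<beta>, 0)" and ab: "Im (\<alpha> * cnj \<beta>) \<noteq> 0"
    and i: "i \<ge> 1"
  shows "circle_int (\<lambda>\<theta>. F (0, \<theta>) * \<theta> ^ i) = 0"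
  using two_pencil_fourier_vanish[OF F ext ab, of 1 i 0 0 0] i
  by (simp add: fibre_coeff_def)

text \<open>
  The automorphism of the ball that moves \<open>(m, 0)\<close> to the origin and maps the first coordinate axis
  to itself.
\<close>

definition shift_map :: "complex \<Rightarrow> complex \<times> complex \<Rightarrow> complex \<times> complex" where
  "shift_map m = proj_map (1, 0, - m) (0, of_real (sqrt (1 - (norm m)\<^sup>2)), 0) (- cnj m, 0, 1)"

lemma shift_map_eq:
  "shift_map m x = ((fst x - m) / (1 - cnj m * fst x), of_real (sqrt (1 - (norm m)\<^sup>2)) * snd x / (1 - cnj m * fst x))"
  by (simp add: shift_map_def proj_map_def aff_def)

lemma ball_aut_shift:
  assumes m: "norm m < 1"
  shows "ball_aut (1, 0, - m) (0, of_real (sqrt (1 - (norm m)\<^sup>2)), 0) (- cnj m, 0, 1)"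
  unfolding ball_aut_def
proof (intro conjI exI[of _ "1 - (norm m)\<^sup>2"] allI impI)
  have m1: "1 - (norm m)\<^sup>2 > 0" using m by (simp add: power_less_one_iff abs_square_less_1)
  then show "0 < 1 - (norm m)\<^sup>2" .
  fix x :: "complex \<times> complex"
  have "(norm (fst x - m))\<^sup>2 + (1 - (norm m)\<^sup>2) * (norm (snd x))\<^sup>2 - (norm (1 - cnj m * fst x))\<^sup>2
      = (1 - (norm m)\<^sup>2) * ((norm (fst x))\<^sup>2 + (norm (snd x))\<^sup>2 - 1)"
    unfolding cmod_power2 by (simp add: power2_eq_square algebra_simps)
  then show "(norm (aff (1, 0, - m) x))\<^sup>2 + (norm (aff (0, of_real (sqrt (1 - (norm m)\<^sup>2)), 0) x))\<^sup>2 - (norm (aff (- cnj m, 0, 1) x))\<^sup>2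
      = (1 - (norm m)\<^sup>2) * ((norm x)\<^sup>2 - 1)"
    using m1 by (simp add: aff_def norm_pair_sq norm_mult power_mult_distrib)
  assume "norm x \<le> 1"
  then have "norm (fst x) \<le> 1" using norm_fst_le[of "fst x" "snd x"] by simp
  then have "norm m * norm (fst x) \<le> norm m * 1" by (intro mult_left_mono) auto
  then have "norm (cnj m * fst x) < 1" using m by (simp add: norm_mult)
  then have "1 - cnj m * fst x \<noteq> 0" by (metis eq_iff_diff_eq_0 less_irrefl norm_one)
  then show "aff (- cnj m, 0, 1) x \<noteq> 0" by (simp add: aff_def)
qed

lemma shift_den:
  assumes "1 - cnj m * fst x \<noteq> 0"
  shows "1 - cnj (- m) * fst (shift_map m x) = of_real (1 - (norm m)\<^sup>2) / (1 - cnj m * fst x)"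
proof -
  have "of_real ((norm m)\<^sup>2) = m * cnj m" by (rule complex_norm_square)
  then show ?thesis using assms by (simp add: shift_map_eq field_simps)
qed

lemma shift_map_inverse:
  assumes m: "norm m < 1" and x: "1 - cnj m * fst x \<noteq> 0"
  shows "1 - cnj (- m) * fst (shift_map m x) \<noteq> 0" "shift_map (- m) (shift_map m x) = x"
proof -
  define q where "q = 1 - (norm m)\<^sup>2"
  define D where "D = 1 - cnj m * fst x"
  have q: "q > 0" using m by (simp add: q_def power_less_one_iff abs_square_less_1)
  have D: "D \<noteq> 0" using x by (simp add: D_def)
  have den: "1 - cnj (- m) * fst (shift_map m x) = of_real q / D" using shift_den[OF x] by (simp add: q_def D_def)
  then show "1 - cnj (- m) * fst (shift_map m x) \<noteq> 0" using q D by simp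
  have mm: "m * cnj m = 1 - of_real q" by (simp add: q_def complex_norm_square[symmetric])
  have "(fst x - m) / D + m = of_real q * fst x / D"
  proof -
    have "m * D = m - (m * cnj m) * fst x" by (simp add: D_def algebra_simps)
    then have "(fst x - m) + m * D = of_real q * fst x"
      unfolding mm by (simp add: algebra_simps)
    then show ?thesis using D by (simp add: field_simps)
  qed
  then have 1: "((fst x - m) / D + m) / (of_real q / D) = fst x" using q D by simp
  have "of_real (sqrt q) * of_real (sqrt q) = (of_real q :: complex)"
    using q by (simp flip: of_real_mult)
  then have 2: "of_real (sqrt q) * (of_real (sqrt q) * snd x / D) / (of_real q / D) = snd x"
    using q D by (simp add: field_simps)
  have "shift_map (- m) (shift_map m x) = (((fst x - m) / D + m) / (of_real q / D), of_real (sqrt q) * (of_real (sqrt q) * snd x / D) / (of_real q / D))"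
    unfolding shift_map_eq[of "-m"] den by (simp add: shift_map_eq[of m x] q_def D_def)
  then show "shift_map (- m) (shift_map m x) = x" unfolding 1 2 by simp
qed

lemma pencil_ext_shift:
  assumes "norm m < 1" "1 - cnj m * fst x \<noteq> 0" "pencil_ext F (shift_map m x)"
  shows "pencil_ext (F \<circ> shift_map m) x"
  unfolding shift_map_def
  by (rule pencil_ext_transfer[OF ball_aut_shift[OF assms(1)]])
     (use assms in \<open>auto simp: aff_def shift_map_def\<close>)

lemma shift_continuous:
  assumes "norm m < 1" "continuous_on (sphere 0 1) F"
  shows "continuous_on (sphere 0 1) (F \<circ> shift_map m)"
  unfolding shift_map_def by (rule proj_map_continuous[OF ball_aut_shift[OF assms(1)] assms(2)])

text \<open>
  If the imaginary part vanished near \<open>0\<close>, comparing it at \<open>\<plusminus> e\<close> and \<open>\<i> * e\<close> would make the two affine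
  functions proportional.
\<close>

lemma affine_im_dense:
  assumes det: "A0 * B1 - A1 * B0 \<noteq> 0" and d: "\<delta> > 0"
  shows "\<exists>\<sigma>. norm \<sigma> < \<delta> \<and> Im ((A0 + A1 * \<sigma>) * cnj (B0 + B1 * \<sigma>)) \<noteq> 0"
proof (rule ccontr)
  assume "\<not> ?thesis"
  then have z: "Im ((A0 + A1 * \<sigma>) * cnj (B0 + B1 * \<sigma>)) = 0" if "norm \<sigma> < \<delta>" for \<sigma> using that by blast
  define e where "e = \<delta> / 2"
  have e: "e > 0" "e < \<delta>" using d by (simp_all add: e_def)
  have 0: "Im (A0 * cnj B0) = 0" using z[of 0] d by simp
  have ex: "(A0 + A1 * \<sigma>) * cnj (B0 + B1 * \<sigma>) = A0 * cnj B0 + (A1 * cnj B0 * \<sigma> + A0 * cnj B1 * cnj \<sigma>) + A1 * cnj B1 * (\<sigma> * cnj \<sigma>)" for \<sigma>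
    by (simp add: algebra_simps)
  define X where "X = A1 * cnj B0"
  define Y where "Y = A0 * cnj B1"
  define Z where "Z = A1 * cnj B1"
  have q: "Im (X * \<sigma> + Y * cnj \<sigma>) + Im (Z * (\<sigma> * cnj \<sigma>)) = 0" if "norm \<sigma> < \<delta>" for \<sigma>
    using z[OF that] 0 unfolding ex X_def Y_def Z_def by (simp only: plus_complex.sel)
  have p1: "e * Im (X + Y) + e\<^sup>2 * Im Z = 0" using q[of "of_real e"] e by (simp add: power2_eq_square algebra_simps)
  have p2: "- (e * Im (X + Y)) + e\<^sup>2 * Im Z = 0" using q[of "- of_real e"] e by (simp add: power2_eq_square algebra_simps)
  have p3: "e * Re (X - Y) + e\<^sup>2 * Im Z = 0" using q[of "\<i> * of_real e"] e by (simp add: norm_mult power2_eq_square algebra_simps)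
  have Z0: "Im Z = 0" using p1 p2 e by simp
  have XY: "Im X = - Im Y" "Re X = Re Y" using p1 p3 Z0 e by auto
  then have c: "A0 * cnj B1 = cnj A1 * B0" by (simp add: X_def Y_def complex_eq_iff algebra_simps)
  have r: "A1 * cnj B1 = cnj A1 * B1" using Z0 by (simp add: Z_def complex_eq_iff algebra_simps)
  have "cnj B1 * (A0 * B1 - A1 * B0) = (A0 * cnj B1) * B1 - (A1 * cnj B1) * B0" by (simp add: algebra_simps)
  also have "\<dots> = 0" unfolding c r by (simp add: algebra_simps)
  finally have "B1 = 0" using det by simp
  then have "cnj A1 * B0 = 0" using c by simp
  then show False using det \<open>B1 = 0\<close> by auto
qed

text \<open>
  The invariance of the Hermitian form \<open>1 - \<langle>a|b\<rangle>\<close> under automorphisms of the ball, up to the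
  denominators.
\<close>

lemma shift_herm:
  assumes "1 - herm a (m, 0) \<noteq> 0" "1 - herm b (m, 0) \<noteq> 0" "norm m < 1"
  shows "1 - herm (shift_map m a) (shift_map m b) = of_real (1 - (norm m)\<^sup>2) * (1 - herm a b) / ((1 - herm a (m, 0)) * (1 - herm (m, 0) b))"
proof -
  define D where "D = 1 - cnj m * fst a"
  define E where "E = 1 - m * cnj (fst b)"
  have D: "1 - herm a (m, 0) = D" and E: "1 - herm (m, 0) b = E" by (simp_all add: herm_def D_def E_def mult.commute)
  have D0: "D \<noteq> 0" using assms(1) D by simp
  have "1 - herm b (m, 0) = cnj E" by (simp add: herm_def E_def mult.commute)
  then have E0: "E \<noteq> 0" using assms(2) by auto
  define q where "q = 1 - (norm m)\<^sup>2"
  have q: "q > 0" using assms(3) by (simp add: q_def power_less_one_iff abs_square_less_1)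
  have sq: "of_real (sqrt q) * of_real (sqrt q) = (of_real q :: complex)"
    using q by (simp flip: of_real_mult)
  have qm: "of_real q = 1 - m * cnj m" by (simp add: q_def complex_norm_square[symmetric])
  have "herm (shift_map m a) (shift_map m b)
      = ((fst a - m) * (cnj (fst b) - cnj m) + (of_real (sqrt q) * of_real (sqrt q)) * (snd a * cnj (snd b))) / (D * E)"
    by (simp add: herm_def shift_map_eq q_def D_def E_def add_divide_distrib mult_ac)
  then have "1 - herm (shift_map m a) (shift_map m b) = (D * E - ((fst a - m) * (cnj (fst b) - cnj m) + of_real q * (snd a * cnj (snd b)))) / (D * E)"
    unfolding sq using D0 E0 by (simp add: diff_divide_distrib)
  also have "D * E - ((fst a - m) * (cnj (fst b) - cnj m) + of_real q * (snd a * cnj (snd b))) = of_real q * (1 - herm a b)"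
    unfolding qm by (simp add: D_def E_def herm_def algebra_simps)
  finally show ?thesis by (simp add: D E q_def)
qed

text \<open>
  Cartan's triple product; its argument is the angular invariant of three points, an invariant of
  projective automorphisms of the ball.
\<close>

definition tri :: "complex \<times> complex \<Rightarrow> complex \<times> complex \<Rightarrow> complex \<times> complex \<Rightarrow> complex" where
  "tri a b p = (1 - herm a b) * (1 - herm b p) * (1 - herm p a)"

lemma cnj_herm: "cnj (herm a b) = herm b a"
  by (simp add: herm_def mult.commute)

text \<open>
  With \<open>(m, 0)\<close> moved to the origin the triple product becomes \<open>1 - \<langle>a|b\<rangle>\<close>, and by \<open>shift_herm\<close> it changes by
  a positive factor.
\<close>

lemma tri_shift:
  assumes t: "Im (tri a b (m, 0)) \<noteq> 0" and m: "norm m < 1"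
  shows "1 - cnj m * fst a \<noteq> 0" "1 - cnj m * fst b \<noteq> 0" "Im (herm (shift_map m a) (shift_map m b)) \<noteq> 0"
proof -
  have nz: "1 - herm b (m, 0) \<noteq> 0" "1 - herm (m, 0) a \<noteq> 0" using t by (auto simp: tri_def)
  have "1 - herm a (m, 0) = cnj (1 - herm (m, 0) a)" by (simp add: cnj_herm)
  then have nz': "1 - herm a (m, 0) \<noteq> 0" using nz(2) by (metis complex_cnj_zero_iff)
  show "1 - cnj m * fst a \<noteq> 0" "1 - cnj m * fst b \<noteq> 0"
    using nz' nz(1) by (simp_all add: herm_def mult.commute)
  define q where "q = 1 - (norm m)\<^sup>2"
  have q: "q > 0" using m by (simp add: q_def power_less_one_iff abs_square_less_1)
  define x where "x = 1 - herm (m, 0) a"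
  define y where "y = 1 - herm b (m, 0)"
  have xy: "x \<noteq> 0" "y \<noteq> 0" using nz by (auto simp: x_def y_def)
  have ca: "1 - herm a (m, 0) = cnj x" and cb: "1 - herm (m, 0) b = cnj y" by (simp_all add: x_def y_def cnj_herm)
  have "1 - herm (shift_map m a) (shift_map m b) = of_real q * (1 - herm a b) / (cnj x * cnj y)"
    using shift_herm[OF nz' nz(1) m] unfolding ca cb by (simp add: q_def)
  also have "\<dots> = of_real (q / ((norm x)\<^sup>2 * (norm y)\<^sup>2)) * tri a b (m, 0)"
  proof -
    have "of_real ((norm x)\<^sup>2 * (norm y)\<^sup>2) = (x * cnj x) * (y * cnj y)"
      by (simp only: of_real_mult complex_norm_square)
    then show ?thesis
      unfolding tri_def x_def[symmetric] y_def[symmetric] of_real_divide using xy by (simp add: field_simps)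
  qed
  finally have e: "1 - herm (shift_map m a) (shift_map m b) = of_real (q / ((norm x)\<^sup>2 * (norm y)\<^sup>2)) * tri a b (m, 0)" .
  have "Im (1 - herm (shift_map m a) (shift_map m b)) = q / ((norm x)\<^sup>2 * (norm y)\<^sup>2) * Im (tri a b (m, 0))"
    unfolding e by (simp only: Im_complex_of_real times_complex.sel Re_complex_of_real mult_zero_left add_0_right)
  then show "Im (herm (shift_map m a) (shift_map m b)) \<noteq> 0" using t q xy by auto
qed

text \<open>
  An automorphism that moves \<open>(z, 0)\<close> to the origin turns this into the statement for the fibre over
  \<open>0\<close>, provided that the triple product for \<open>z\<close> is not real.  Such \<open>z\<close> are dense, and the
  coefficient is continuous.
\<close>

lemma two_pencil_fibre_modes:
  assumes F: "continuous_on (sphere 0 1) F"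
    and ext: "pencil_ext F (\<alpha>, 0)" "pencil_ext F (\<beta>, 0)" and ab: "Im (\<alpha> * cnj \<beta>) \<noteq> 0"
    and i: "i \<ge> 1" and z: "norm z \<le> 1"
  shows "fibre_coeff F i 0 z = 0"
proof -
  have gen: "fibre_coeff F i 0 m = 0" if m: "norm m < 1" and t: "Im (tri (\<alpha>, 0) (\<beta>, 0) (m, 0)) \<noteq> 0" for m
  proof -
    have m': "norm (- m) < 1" using m by simp
    define G where "G = F \<circ> shift_map (- m)"
    define \<alpha>' where "\<alpha>' = fst (shift_map m (\<alpha>, 0))"
    define \<beta>' where "\<beta>' = fst (shift_map m (\<beta>, 0))"
    have a': "shift_map m (\<alpha>, 0) = (\<alpha>', 0)" and b': "shift_map m (\<beta>, 0) = (\<beta>', 0)"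
      by (simp_all add: \<alpha>'_def \<beta>'_def shift_map_eq)
    note ts = tri_shift[OF t m]
    have "pencil_ext G (\<alpha>', 0)"
      unfolding G_def using shift_map_inverse[OF m ts(1)] ext(1) a' m' by (intro pencil_ext_shift) auto
    moreover have "pencil_ext G (\<beta>', 0)"
      unfolding G_def using shift_map_inverse[OF m ts(2)] ext(2) b' m' by (intro pencil_ext_shift) auto
    moreover have "continuous_on (sphere 0 1) G" unfolding G_def by (rule shift_continuous[OF m' F])
    moreover have "Im (\<alpha>' * cnj \<beta>') \<noteq> 0" using ts(3) unfolding a' b' by (simp add: herm_def)
    ultimately have "circle_int (\<lambda>\<theta>. G (0, \<theta>) * \<theta> ^ i) = 0"
      using two_pencil_axis_modes i by blast
    then have "circle_int (\<lambda>\<theta>. F (m, of_real (sqrt (1 - (norm m)\<^sup>2)) * \<theta>) * \<theta> ^ i) = 0"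
      by (simp add: G_def shift_map_eq)
    then have "of_real (sqrt (1 - (norm m)\<^sup>2)) ^ i * circle_int (\<lambda>\<theta>. F (m, of_real (sqrt (1 - (norm m)\<^sup>2)) * \<theta>) * \<theta> ^ i) = 0"
      by simp
    then show ?thesis
      unfolding circle_int_cmult[symmetric] by (simp add: fibre_coeff_def power_mult_distrib mult_ac)
  qed
  have ab1: "\<alpha> * cnj \<beta> \<noteq> 1" using ab by (metis one_complex.sel(2))
  have ab2: "\<alpha> \<noteq> \<beta>" using ab by (auto simp: complex_mult_cnj)
  define K where "K = 1 - \<alpha> * cnj \<beta>"
  \<comment> \<open>Here the points lie on one axis, and the triple product is a product of an affine function of \<open>m\<close>
    and the conjugate of another one.\<close>
  have dense: "\<exists>m. norm (m - x) < \<delta> \<and> Im (tri (\<alpha>, 0) (\<beta>, 0) (m, 0)) \<noteq> 0" if "\<delta> > 0" for x \<delta>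
  proof -
    have "(K * (1 - x * cnj \<alpha>)) * (- cnj \<beta>) - (- K * cnj \<alpha>) * (1 - x * cnj \<beta>) = K * (cnj \<alpha> - cnj \<beta>)"
      by (simp add: algebra_simps)
    also have "\<dots> \<noteq> 0" using ab1 ab2 by (simp add: K_def)
    finally have "(K * (1 - x * cnj \<alpha>)) * (- cnj \<beta>) - (- K * cnj \<alpha>) * (1 - x * cnj \<beta>) \<noteq> 0" .
    from affine_im_dense[OF this that] obtain \<sigma> where s: "norm \<sigma> < \<delta>" "Im ((K * (1 - x * cnj \<alpha>) + (- K * cnj \<alpha>) * \<sigma>) * cnj ((1 - x * cnj \<beta>) + (- cnj \<beta>) * \<sigma>)) \<noteq> 0"
      by blast
    have "(K * (1 - x * cnj \<alpha>) + (- K * cnj \<alpha>) * \<sigma>) * cnj ((1 - x * cnj \<beta>) + (- cnj \<beta>) * \<sigma>) = tri (\<alpha>, 0) (\<beta>, 0) (x + \<sigma>, 0)"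
      by (simp add: tri_def herm_def K_def algebra_simps)
    then show ?thesis using s by (intro exI[of _ "x + \<sigma>"]) auto
  qed
  have c: "continuous_on (cball 0 1) (fibre_coeff F i 0)" by (rule fibre_coeff_continuous[OF F])
  have "norm (fibre_coeff F i 0 z) \<le> 0 + e" if e: "e > 0" for e
  proof -
    obtain d where d: "d > 0" "\<And>y. y \<in> cball 0 1 \<Longrightarrow> dist y z < d \<Longrightarrow> dist (fibre_coeff F i 0 y) (fibre_coeff F i 0 z) < e"
      using c z e unfolding continuous_on_iff by (metis mem_cball_0)
    \<comment> \<open>The point \<open>z\<close> may lie on the unit circle, so it is first moved slightly inwards to \<open>x\<close>, and then to a point
      \<open>m\<close> with nonreal triple product.\<close>
    define d' where "d' = min (d / 2) (1/2)"
    define x where "x = of_real (1 - d' / 2) * z"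
    have d': "d' > 0" "d' \<le> 1/2" "d' < d" using d(1) by (auto simp: d'_def)
    obtain m where m: "norm (m - x) < d' / 4" "Im (tri (\<alpha>, 0) (\<beta>, 0) (m, 0)) \<noteq> 0"
      using dense[of "d' / 4" x] d' by auto
    have "norm x = (1 - d' / 2) * norm z" using d' by (simp add: x_def norm_mult del: of_real_diff)
    also have "\<dots> \<le> (1 - d' / 2) * 1" using z d' by (intro mult_left_mono) auto
    finally have "norm x \<le> 1 - d' / 2" by simp
    then have m1: "norm m < 1" using m(1) d' norm_triangle_sub[of m x] by linarith
    have "norm (x - z) = d' / 2 * norm z"
    proof -
      have "x - z = - (of_real (d' / 2) * z)" by (simp add: x_def algebra_simps)
      then show ?thesis using d' by (simp add: norm_mult)
    qed
    also have "\<dots> \<le> d' / 2 * 1" using z d' by (intro mult_left_mono) auto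
    finally have "norm (x - z) \<le> d' / 2" by simp
    then have "dist m z < d" using m(1) d' norm_triangle_ineq[of "m - x" "x - z"] by (simp add: dist_norm)
    then have "dist (fibre_coeff F i 0 m) (fibre_coeff F i 0 z) < e" using d(2)[of m] m1 by simp
    then show ?thesis using gen[OF m1 m(2)] by (simp add: dist_norm)
  qed
  then have "norm (fibre_coeff F i 0 z) \<le> 0" by (rule field_le_epsilon)
  then show ?thesis by simp
qed

lemma pencil_ext_cong:
  assumes "\<And>x. x \<in> sphere 0 1 \<Longrightarrow> F x = G x" "pencil_ext F p"
  shows "pencil_ext G p"
  using assms unfolding pencil_ext_def line_ext_def by auto

text \<open>
  On a line through the origin \<open>F\<close> is \<open>u \<mapsto> F (r * u, sqrt (1 - r\<^sup>2) * \<theta> * u)\<close>, up to rotation, and its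
  moment of order \<open>p \<ge> 1\<close> must vanish.  As a function \<open>Y\<close> of \<open>\<theta>\<close>, this moment has Fourier
  coefficients that are double Fourier coefficients of \<open>F\<close>.  Those with a nonnegative power of \<open>cnj \<theta>\<close>
  vanish by \<open>two_pencil_fourier_vanish\<close>, the others by \<open>two_pencil_fibre_modes\<close>.
\<close>

theorem two_pencils_centre:
  assumes F: "continuous_on (sphere 0 1) F"
    and ext: "pencil_ext F (\<alpha>, 0)" "pencil_ext F (\<beta>, 0)" and ab: "Im (\<alpha> * cnj \<beta>) \<noteq> 0"
  shows "pencil_ext F (0, 0)"
proof -
  have sph: "(u * of_real r, \<theta> * of_real (sqrt (1 - r\<^sup>2))) \<in> sphere 0 1"
    if "0 \<le> r" "r \<le> 1" "norm u = 1" "norm \<theta> = 1" for r and u \<theta> :: complex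
    using sphere_fibre[of "u * of_real r" \<theta>] that by (simp add: norm_mult mult.commute)
  have mom: "circle_int (\<lambda>u. F (u * of_real r, u * \<theta> * of_real (sqrt (1 - r\<^sup>2))) * u ^ p) = 0"
    if r: "0 \<le> r" "r \<le> 1" and p: "p \<ge> 1" and th: "norm \<theta> = 1" for r p \<theta>
  proof -
    define w where "w = sqrt (1 - r\<^sup>2)"
    have w: "w \<ge> 0" "w\<^sup>2 = 1 - r\<^sup>2" using r by (simp_all add: w_def power_le_one_iff)
    have Fc: "continuous_on (sphere 0 1 \<times> sphere 0 1) (\<lambda>p. F (snd p * of_real r, snd p * fst p * of_real w))"
      by (rule continuous_on_compose2[OF F])
         (use sph[OF r] in \<open>auto intro!: continuous_intros simp: w_def norm_mult\<close>)
    have Fc2: "continuous_on (sphere 0 1) (\<lambda>\<theta>. F (u * of_real r, \<theta> * of_real w))" if "norm u = 1" for u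
      by (rule continuous_on_compose2[OF F])
         (use sph[OF r] that in \<open>auto intro!: continuous_intros simp: w_def\<close>)
    define Y where "Y \<theta> = circle_int (\<lambda>u. F (u * of_real r, u * \<theta> * of_real w) * u ^ p)" for \<theta>
    have Yc: "continuous_on (sphere 0 1) Y"
      unfolding Y_def[abs_def]
      by (rule continuous_on_circle_int) (use Fc in \<open>unfold split_beta, intro continuous_intros\<close>)
    \<comment> \<open>Interchange the integrals and rotate \<open>\<theta>\<close> by \<open>u\<close>, which separates the two arguments of \<open>F\<close>.\<close>
    have swap: "circle_int (\<lambda>\<theta>. Y \<theta> * g \<theta>) = circle_int (\<lambda>u. circle_int (\<lambda>\<theta>. F (u * of_real r, \<theta> * of_real w) * g (cnj u * \<theta>)) * u ^ p)"
      if g: "continuous_on UNIV g" for g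
    proof -
      have gc: "continuous_on A (\<lambda>p. g (f p))" if "continuous_on A f" for A and f :: "complex \<times> complex \<Rightarrow> complex"
        by (rule continuous_on_compose2[OF g that]) auto
      have gc1: "continuous_on A (\<lambda>p. g (f p))" if "continuous_on A f" for A and f :: "complex \<Rightarrow> complex"
        by (rule continuous_on_compose2[OF g that]) auto
      have "circle_int (\<lambda>\<theta>. Y \<theta> * g \<theta>) = circle_int (\<lambda>\<theta>. circle_int (\<lambda>u. F (u * of_real r, u * \<theta> * of_real w) * u ^ p * g \<theta>))"
        unfolding Y_def circle_int_multc ..
      also have "\<dots> = circle_int (\<lambda>u. circle_int (\<lambda>\<theta>. F (u * of_real r, u * \<theta> * of_real w) * u ^ p * g \<theta>))"
        by (rule circle_int_swap) (unfold split_beta, intro continuous_intros Fc gc)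
      also have "\<dots> = circle_int (\<lambda>u. circle_int (\<lambda>\<theta>. F (u * of_real r, \<theta> * of_real w) * g (cnj u * \<theta>)) * u ^ p)"
      proof (rule circle_int_cong)
        fix u :: complex assume u: "norm u = 1"
        have uu: "cnj u * (u * \<theta>) = \<theta>" for \<theta>
          using u complex_norm_square[of u] by (simp add: mult.commute[of u] flip: mult.assoc)
        have "circle_int (\<lambda>\<theta>. F (u * of_real r, u * \<theta> * of_real w) * u ^ p * g \<theta>)
            = circle_int (\<lambda>\<theta>. (\<lambda>\<eta>. F (u * of_real r, \<eta> * of_real w) * g (cnj u * \<eta>) * u ^ p) (u * \<theta>))"
          by (simp only: uu) (simp only: mult_ac)
        also have "\<dots> = circle_int (\<lambda>\<eta>. F (u * of_real r, \<eta> * of_real w) * g (cnj u * \<eta>) * u ^ p)"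
          by (rule circle_int_rotate[OF _ u]) (intro continuous_intros Fc2[OF u] gc1)
        finally show "circle_int (\<lambda>\<theta>. F (u * of_real r, u * \<theta> * of_real w) * u ^ p * g \<theta>)
           = circle_int (\<lambda>\<theta>. F (u * of_real r, \<theta> * of_real w) * g (cnj u * \<theta>)) * u ^ p"
          by (simp add: circle_int_multc)
      qed
      finally show ?thesis .
    qed
    \<comment> \<open>If \<open>r = 0\<close> or \<open>sqrt (1 - r\<^sup>2) = 0\<close>, then \<open>F\<close> is constant in one of the variables, and the integral of a
      nontrivial power is zero.\<close>
    have cA: "circle_int (\<lambda>u. circle_int (\<lambda>\<theta>. F (u * of_real r, \<theta> * of_real w) * cnj \<theta> ^ b) * u ^ (p + b)) = 0" for b
    proof (cases "r = 0")
      case True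
      then show ?thesis using p circle_int_power[of "p + b"] by (simp add: circle_int_cmult)
    next
      case r0: False
      show ?thesis
      proof (cases "w = 0 \<and> b \<noteq> 0")
        case True
        then show ?thesis using circle_int_cnj_power[of b] by (simp add: circle_int_cmult)
      next
        case False
        have "circle_int (\<lambda>u. fibre_coeff F 0 b (of_real r * u) * (of_real r * u) ^ (p + b)) = 0"
          by (rule two_pencil_fourier_vanish[OF F ext ab, of 0]) (use p r in auto)
        also have "circle_int (\<lambda>u. fibre_coeff F 0 b (of_real r * u) * (of_real r * u) ^ (p + b))
            = circle_int (\<lambda>u. of_real (w ^ b * r ^ (p + b)) * (circle_int (\<lambda>\<theta>. F (u * of_real r, \<theta> * of_real w) * cnj \<theta> ^ b) * u ^ (p + b)))"
        proof (rule circle_int_cong)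
          fix u :: complex assume u: "norm u = 1"
          have "fibre_coeff F 0 b (of_real r * u) = of_real (w ^ b) * circle_int (\<lambda>\<theta>. F (u * of_real r, \<theta> * of_real w) * cnj \<theta> ^ b)"
            unfolding circle_int_cmult[symmetric] fibre_coeff_def Let_def
            using u r by (simp add: norm_mult w_def power_mult_distrib mult_ac)
          then show "fibre_coeff F 0 b (of_real r * u) * (of_real r * u) ^ (p + b)
             = of_real (w ^ b * r ^ (p + b)) * (circle_int (\<lambda>\<theta>. F (u * of_real r, \<theta> * of_real w) * cnj \<theta> ^ b) * u ^ (p + b))"
            by (simp add: power_mult_distrib mult_ac)
        qed
        finally have "of_real (w ^ b * r ^ (p + b)) * circle_int (\<lambda>u. circle_int (\<lambda>\<theta>. F (u * of_real r, \<theta> * of_real w) * cnj \<theta> ^ b) * u ^ (p + b)) = 0"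
          by (simp only: circle_int_cmult)
        moreover have "w ^ b * r ^ (p + b) \<noteq> 0" using r0 False by auto
        ultimately show ?thesis by (simp only: mult_eq_0_iff of_real_eq_0_iff) blast
      qed
    qed
    have cB: "circle_int (\<lambda>\<theta>. F (u * of_real r, \<theta> * of_real w) * \<theta> ^ b) = 0" if u: "norm u = 1" and b: "b \<ge> 1" for u b
    proof (cases "w = 0")
      case True
      then show ?thesis using circle_int_power[of b] b by (simp add: circle_int_cmult)
    next
      case False
      have "fibre_coeff F b 0 (of_real r * u) = 0"
        by (rule two_pencil_fibre_modes[OF F ext ab b]) (use u r in \<open>simp add: norm_mult\<close>)
      also have "fibre_coeff F b 0 (of_real r * u) = of_real (w ^ b) * circle_int (\<lambda>\<theta>. F (u * of_real r, \<theta> * of_real w) * \<theta> ^ b)"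
        unfolding circle_int_cmult[symmetric] fibre_coeff_def Let_def
        using u r by (simp add: norm_mult w_def power_mult_distrib mult_ac)
      finally show ?thesis using False by simp
    qed
    have neg: "circle_int (\<lambda>\<theta>. Y \<theta> * cnj \<theta> ^ b) = 0" for b
    proof -
      have "circle_int (\<lambda>\<theta>. Y \<theta> * cnj \<theta> ^ b) = circle_int (\<lambda>u. circle_int (\<lambda>\<theta>. F (u * of_real r, \<theta> * of_real w) * cnj (cnj u * \<theta>) ^ b) * u ^ p)"
        by (rule swap) (intro continuous_intros)
      also have "\<dots> = circle_int (\<lambda>u. circle_int (\<lambda>\<theta>. F (u * of_real r, \<theta> * of_real w) * cnj \<theta> ^ b) * u ^ (p + b))"
      proof (rule circle_int_cong)
        fix u :: complex
        have "circle_int (\<lambda>\<theta>. F (u * of_real r, \<theta> * of_real w) * cnj (cnj u * \<theta>) ^ b)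
            = circle_int (\<lambda>\<theta>. F (u * of_real r, \<theta> * of_real w) * cnj \<theta> ^ b * u ^ b)"
          by (simp add: power_mult_distrib mult_ac)
        then show "circle_int (\<lambda>\<theta>. F (u * of_real r, \<theta> * of_real w) * cnj (cnj u * \<theta>) ^ b) * u ^ p
            = circle_int (\<lambda>\<theta>. F (u * of_real r, \<theta> * of_real w) * cnj \<theta> ^ b) * u ^ (p + b)"
          by (simp add: circle_int_multc power_add)
      qed
      also have "\<dots> = 0" by (rule cA)
      finally show ?thesis .
    qed
    have pos: "circle_int (\<lambda>\<theta>. Y \<theta> * \<theta> ^ b) = 0" for b
    proof (cases "b = 0")
      case True
      then show ?thesis using neg[of 0] by simp
    next
      case False
      have "circle_int (\<lambda>\<theta>. Y \<theta> * \<theta> ^ b) = circle_int (\<lambda>u. circle_int (\<lambda>\<theta>. F (u * of_real r, \<theta> * of_real w) * (cnj u * \<theta>) ^ b) * u ^ p)"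
        by (rule swap) (intro continuous_intros)
      also have "\<dots> = circle_int (\<lambda>u. 0)"
      proof (rule circle_int_cong)
        fix u :: complex assume u: "norm u = 1"
        have "circle_int (\<lambda>\<theta>. F (u * of_real r, \<theta> * of_real w) * (cnj u * \<theta>) ^ b)
            = circle_int (\<lambda>\<theta>. F (u * of_real r, \<theta> * of_real w) * \<theta> ^ b * cnj u ^ b)"
          by (simp add: power_mult_distrib mult_ac)
        then show "circle_int (\<lambda>\<theta>. F (u * of_real r, \<theta> * of_real w) * (cnj u * \<theta>) ^ b) * u ^ p = 0"
          using cB[OF u, of b] False by (simp add: circle_int_multc)
      qed
      finally show ?thesis by simp
    qed
    have "Y \<theta> = 0" by (rule circle_fourier_unique[OF Yc pos neg th])
    then show ?thesis by (simp add: Y_def w_def)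
  qed
  show ?thesis
    unfolding pencil_ext_def
  proof (intro allI impI)
    fix v :: "complex \<times> complex" assume v: "v \<noteq> 0"
    define n where "n = norm v"
    have n: "n > 0" using v by (simp add: n_def)
    define r where "r = norm (fst v) / n"
    have r: "0 \<le> r" "r \<le> 1" using n norm_fst_le[of "fst v" "snd v"] by (simp_all add: r_def n_def)
    have n2: "n\<^sup>2 = (norm (fst v))\<^sup>2 + (norm (snd v))\<^sup>2" unfolding n_def by (rule norm_pair_sq)
    have w: "sqrt (1 - r\<^sup>2) = norm (snd v) / n"
    proof (rule real_sqrt_unique)
      have "(norm (snd v))\<^sup>2 = n\<^sup>2 - (norm (fst v))\<^sup>2" using n2 by simp
      then show "(norm (snd v) / n)\<^sup>2 = 1 - r\<^sup>2"
        unfolding power_divide r_def using n by (simp add: diff_divide_distrib)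
    qed (use n in simp)
    \<comment> \<open>The phases of the two components of \<open>v\<close>; for a zero component any phase will do.\<close>
    define dir where "dir z = (if z = 0 then 1 else z / of_real (norm z))" for z :: complex
    have dir: "norm (dir z) = 1" "of_real (norm z) * dir z = z" for z by (simp_all add: dir_def norm_divide)
    define g where "g u = F (line_pt (0, 0) v (u / of_real n))" for u
    have line_n: "norm (line_pt (0, 0) v t) = norm t * n" for t
    proof -
      have "(norm (line_pt (0, 0) v t))\<^sup>2 = (norm t * n)\<^sup>2"
        unfolding norm_pair_sq by (simp add: line_pt_def norm_mult power_mult_distrib n2 distrib_left)
      then show ?thesis using n by (simp add: power2_eq_iff_nonneg)
    qed
    have gc: "continuous_on (sphere 0 1) g"
      unfolding g_def
    proof (rule continuous_on_compose2[OF F])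
      show "continuous_on (sphere 0 1) (\<lambda>u. line_pt (0, 0) v (u / of_real n))"
        unfolding line_pt_def using n by (auto intro!: continuous_intros)
      show "(\<lambda>u. line_pt (0, 0) v (u / of_real n)) ` sphere 0 1 \<subseteq> sphere 0 1"
        using n line_n by (auto simp: norm_divide)
    qed
    have gm: "circle_int (\<lambda>u. g u * u ^ p) = 0" if p: "p \<ge> 1" for p
    proof -
      define e1 where "e1 = dir (fst v)"
      define e2 where "e2 = dir (snd v)"
      have e: "norm e1 = 1" "norm e2 = 1" "fst v = of_real (norm (fst v)) * e1" "snd v = of_real (norm (snd v)) * e2"
        by (simp_all add: e1_def e2_def dir)
      have ee: "cnj e1 * (e1 * u) = u" for u
        using e(1) complex_norm_square[of e1] by (simp add: mult.commute[of e1] flip: mult.assoc)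
      define h where "h u = F (u * of_real r, u * (e2 * cnj e1) * of_real (sqrt (1 - r\<^sup>2))) * (cnj e1 * u) ^ p" for u
      have hc: "continuous_on (sphere 0 1) h"
        unfolding h_def
        by (intro continuous_intros continuous_on_compose2[OF F])
           (use sph[OF r] e in \<open>auto simp: norm_mult\<close>)
      have "circle_int (\<lambda>u. g u * u ^ p) = circle_int (\<lambda>u. h (e1 * u))"
      proof (rule circle_int_cong)
        fix u :: complex assume "norm u = 1"
        have 1: "u / of_real n * fst v = e1 * u * of_real r"
          by (subst e(3)) (simp add: r_def)
        have "e1 * u * (e2 * cnj e1) = (cnj e1 * (e1 * u)) * e2" by (simp add: mult_ac)
        then have "e1 * u * (e2 * cnj e1) * of_real (sqrt (1 - r\<^sup>2)) = u * e2 * of_real (norm (snd v) / n)"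
          unfolding ee w by simp
        moreover have "u / of_real n * snd v = u * e2 * of_real (norm (snd v) / n)"
          by (subst e(4)) simp
        ultimately have 2: "u / of_real n * snd v = e1 * u * (e2 * cnj e1) * of_real (sqrt (1 - r\<^sup>2))" by simp
        show "g u * u ^ p = h (e1 * u)"
          unfolding g_def h_def ee line_pt_def using 1 2 by simp
      qed
      also have "\<dots> = circle_int h" by (rule circle_int_rotate[OF hc e(1)])
      also have "\<dots> = cnj e1 ^ p * circle_int (\<lambda>u. F (u * of_real r, u * (e2 * cnj e1) * of_real (sqrt (1 - r\<^sup>2))) * u ^ p)"
        unfolding circle_int_cmult[symmetric] h_def by (simp add: power_mult_distrib mult_ac)
      also have "\<dots> = 0" using mom[OF r p, of "e2 * cnj e1"] e by (simp add: norm_mult)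
      finally show ?thesis .
    qed
    show "line_ext F (0, 0) v"
      unfolding line_ext_def
    proof (intro allI impI)
      fix \<epsilon> :: real assume "\<epsilon> > 0"
      then obtain c N where cN: "\<And>w. norm w = 1 \<Longrightarrow> norm (g w - (\<Sum>j\<le>(N::nat). c j * w ^ j)) \<le> \<epsilon>"
        using circle_polynomial_approx[OF gc gm] by metis
      define \<phi> where "\<phi> t = (\<Sum>j\<le>N. c j * (of_real n * t) ^ j)" for t
      have "norm (F (line_pt (0, 0) v t) - \<phi> t) \<le> \<epsilon>" if "norm (line_pt (0, 0) v t) = 1" for t
      proof -
        have "norm (of_real n * t) = 1" using that n unfolding line_n by (simp add: norm_mult mult.commute)
        from cN[OF this] show ?thesis using n by (simp add: g_def \<phi>_def)
      qed
      moreover have "continuous_on A \<phi>" for A unfolding \<phi>_def by (intro continuous_intros)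
      moreover have "\<phi> holomorphic_on A" for A unfolding \<phi>_def by (intro holomorphic_intros)
      ultimately show "\<exists>\<phi>. continuous_on {t. norm (line_pt (0, 0) v t) \<le> 1} \<phi> \<and>
          \<phi> holomorphic_on {t. norm (line_pt (0, 0) v t) < 1} \<and>
          (\<forall>t. norm (line_pt (0, 0) v t) = 1 \<longrightarrow> norm (F (line_pt (0, 0) v t) - \<phi> t) \<le> \<epsilon>)"
        by blast
    qed
  qed
qed

section \<open>A third point from two in general position\<close>

definition cdet :: "complex \<times> complex \<Rightarrow> complex \<times> complex \<Rightarrow> complex" where
  "cdet x y = fst x * snd y - snd x * fst y"

text \<open>
  The unitary map with determinant \<open>1\<close> that sends the unit vector \<open>(u, v)\<close> to \<open>(1, 0)\<close>.
\<close>

definition rot_map :: "complex \<Rightarrow> complex \<Rightarrow> complex \<times> complex \<Rightarrow> complex \<times> complex" where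
  "rot_map u v = proj_map (cnj u, cnj v, 0) (- v, u, 0) (0, 0, 1)"

lemma rot_map_eq: "rot_map u v x = (cnj u * fst x + cnj v * snd x, u * snd x - v * fst x)"
  by (simp add: rot_map_def proj_map_def aff_def)

lemma unit_pair:
  assumes "(norm u)\<^sup>2 + (norm v)\<^sup>2 = 1"
  shows "u * cnj u + v * cnj v = 1"
  using assms by (metis complex_norm_square of_real_1 of_real_add)

lemma rot_map_herm:
  assumes "(norm u)\<^sup>2 + (norm v)\<^sup>2 = 1"
  shows "herm (rot_map u v x) (rot_map u v y) = herm x y"
proof -
  have "herm (rot_map u v x) (rot_map u v y) = (u * cnj u + v * cnj v) * herm x y"
    by (simp add: herm_def rot_map_eq algebra_simps)
  then show ?thesis unfolding unit_pair[OF assms] by simp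
qed

lemma rot_map_cdet:
  assumes "(norm u)\<^sup>2 + (norm v)\<^sup>2 = 1"
  shows "cdet (rot_map u v x) (rot_map u v y) = cdet x y"
proof -
  have "cdet (rot_map u v x) (rot_map u v y) = (u * cnj u + v * cnj v) * cdet x y"
    by (simp add: cdet_def rot_map_eq algebra_simps)
  then show ?thesis unfolding unit_pair[OF assms] by simp
qed

lemma rot_map_diff: "rot_map u v x - rot_map u v y = rot_map u v (x - y)"
  by (simp add: rot_map_eq algebra_simps)

lemma norm_eq_herm: "norm x = sqrt (Re (herm x x))"
  by (simp add: herm_self)

lemma rot_map_norm:
  assumes "(norm u)\<^sup>2 + (norm v)\<^sup>2 = 1"
  shows "norm (rot_map u v x) = norm x"
  unfolding norm_eq_herm rot_map_herm[OF assms] ..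

lemma rot_map_inverse:
  assumes "(norm u)\<^sup>2 + (norm v)\<^sup>2 = 1"
  shows "rot_map (cnj u) (- v) (rot_map u v x) = x"
proof -
  have "rot_map (cnj u) (- v) (rot_map u v x) = ((u * cnj u + v * cnj v) * fst x, (u * cnj u + v * cnj v) * snd x)"
    by (simp add: rot_map_eq algebra_simps)
  then show ?thesis unfolding unit_pair[OF assms] by simp
qed

lemma ball_aut_rot:
  assumes "(norm u)\<^sup>2 + (norm v)\<^sup>2 = 1"
  shows "ball_aut (cnj u, cnj v, 0) (- v, u, 0) (0, 0, 1)"
  unfolding ball_aut_def
proof (intro conjI exI[of _ 1] allI impI)
  fix x :: "complex \<times> complex"
  have "(norm (rot_map u v x))\<^sup>2 = (norm x)\<^sup>2" by (simp add: rot_map_norm[OF assms])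
  then show "(norm (aff (cnj u, cnj v, 0) x))\<^sup>2 + (norm (aff (- v, u, 0) x))\<^sup>2 - (norm (aff (0, 0, 1) x))\<^sup>2 = 1 * ((norm x)\<^sup>2 - 1)"
    unfolding norm_pair_sq[of "rot_map u v x"] by (simp add: rot_map_def proj_map_def aff_def)
qed (simp_all add: aff_def)

lemma pencil_ext_rot:
  assumes "(norm u)\<^sup>2 + (norm v)\<^sup>2 = 1" "pencil_ext F (rot_map u v x)"
  shows "pencil_ext (F \<circ> rot_map u v) x"
  unfolding rot_map_def
  by (rule pencil_ext_transfer[OF ball_aut_rot[OF assms(1)]])
     (use assms in \<open>auto simp: aff_def rot_map_def\<close>)

lemma rot_continuous:
  assumes "(norm u)\<^sup>2 + (norm v)\<^sup>2 = 1" "continuous_on (sphere 0 1) F"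
  shows "continuous_on (sphere 0 1) (F \<circ> rot_map u v)"
  unfolding rot_map_def by (rule proj_map_continuous[OF ball_aut_rot[OF assms(1)] assms(2)])

lemma pencil_ext_unrot:
  assumes u: "(norm u)\<^sup>2 + (norm v)\<^sup>2 = 1" and e: "pencil_ext (F \<circ> rot_map (cnj u) (- v)) (rot_map u v x)"
  shows "pencil_ext F x"
  by (rule pencil_ext_cong[OF _ pencil_ext_rot[OF u e]]) (simp add: rot_map_inverse[OF u])

lemma pencil_ext_rotated:
  assumes u: "(norm u)\<^sup>2 + (norm v)\<^sup>2 = 1" and e: "pencil_ext F x"
  shows "pencil_ext (F \<circ> rot_map (cnj u) (- v)) (rot_map u v x)"
  by (rule pencil_ext_rot) (use u e in \<open>simp_all add: rot_map_inverse\<close>)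

lemma unit_direction:
  assumes "x \<noteq> 0"
  obtains u v where "(norm u)\<^sup>2 + (norm v)\<^sup>2 = 1" "rot_map u v x = (of_real (norm x), 0)"
    "fst x = of_real (norm x) * u" "snd x = of_real (norm x) * v"
proof -
  have n: "norm x > 0" using assms by simp
  define u where "u = fst x / of_real (norm x)"
  define v where "v = snd x / of_real (norm x)"
  have uv: "fst x = of_real (norm x) * u" "snd x = of_real (norm x) * v" using n by (simp_all add: u_def v_def)
  have 1: "(norm u)\<^sup>2 + (norm v)\<^sup>2 = 1"
  proof -
    have "(norm u)\<^sup>2 + (norm v)\<^sup>2 = ((norm (fst x))\<^sup>2 + (norm (snd x))\<^sup>2) / (norm x)\<^sup>2"
      by (simp add: u_def v_def norm_divide power_divide add_divide_distrib)
    also have "\<dots> = 1" using n by (simp add: norm_pair_sq[symmetric])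
    finally show ?thesis .
  qed
  have "rot_map u v x = ((u * cnj u + v * cnj v) * of_real (norm x), 0)"
    unfolding rot_map_eq uv by (simp add: algebra_simps)
  then have "rot_map u v x = (of_real (norm x), 0)" unfolding unit_pair[OF 1] by simp
  then show ?thesis using that 1 uv by blast
qed

text \<open>
  A rotation moves the line through \<open>a\<close>, \<open>b\<close> and the origin to the first coordinate axis.
\<close>

lemma two_pencils_origin:
  assumes F: "continuous_on (sphere 0 1) F" and ext: "pencil_ext F a" "pencil_ext F b"
    and col: "cdet a b = 0" and h: "Im (herm a b) \<noteq> 0"
  shows "pencil_ext F (0, 0)"
proof -
  have "a \<noteq> 0" using h by (auto simp: herm_def)
  then obtain u v where uv: "(norm u)\<^sup>2 + (norm v)\<^sup>2 = 1" and ra: "rot_map u v a = (of_real (norm a), 0)"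
    and a: "fst a = of_real (norm a) * u" "snd a = of_real (norm a) * v"
    using unit_direction by blast
  define G where "G = F \<circ> rot_map (cnj u) (- v)"
  have uv': "(norm (cnj u))\<^sup>2 + (norm (- v))\<^sup>2 = 1" using uv by simp
  have "of_real (norm a) * (u * snd b - v * fst b) = cdet a b"
    unfolding cdet_def a by (simp add: algebra_simps)
  then have "u * snd b - v * fst b = 0" using col \<open>a \<noteq> 0\<close> by simp
  then obtain \<beta> where rb: "rot_map u v b = (\<beta>, 0)" by (simp add: rot_map_eq)
  have "pencil_ext G (0, 0)"
  proof (rule two_pencils_centre)
    show "continuous_on (sphere 0 1) G" unfolding G_def by (rule rot_continuous[OF uv' F])
    show "pencil_ext G (of_real (norm a), 0)" "pencil_ext G (\<beta>, 0)"
      using pencil_ext_rotated[OF uv] ext unfolding G_def ra[symmetric] rb[symmetric] by auto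
    have "of_real (norm a) * cnj \<beta> = herm (rot_map u v a) (rot_map u v b)" unfolding ra rb by (simp add: herm_def)
    then show "Im (of_real (norm a) * cnj \<beta>) \<noteq> 0" using h rot_map_herm[OF uv] by metis
  qed
  moreover have "rot_map u v (0, 0) = (0, 0)" by (simp add: rot_map_eq)
  ultimately show ?thesis using pencil_ext_unrot[OF uv, of F "(0, 0)"] by (simp add: G_def)
qed

text \<open>
  The map \<open>shift_map m\<close> reduces this to \<open>two_pencils_origin\<close>: collinearity is preserved and the triple
  product becomes the Hermitian product of the images.
\<close>

lemma two_pencils_axis_point:
  assumes F: "continuous_on (sphere 0 1) F" and ext: "pencil_ext F a" "pencil_ext F b"
    and m: "norm m < 1" and col: "cdet (a - (m, 0)) (b - (m, 0)) = 0" and t: "Im (tri a b (m, 0)) \<noteq> 0"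
  shows "pencil_ext F (m, 0)"
proof -
  have m': "norm (- m) < 1" using m by simp
  note ts = tri_shift[OF t m]
  define G where "G = F \<circ> shift_map (- m)"
  have Gc: "continuous_on (sphere 0 1) G" unfolding G_def by (rule shift_continuous[OF m' F])
  have ea: "pencil_ext G (shift_map m a)"
    unfolding G_def using shift_map_inverse[OF m ts(1)] ext(1) m' by (intro pencil_ext_shift) auto
  have eb: "pencil_ext G (shift_map m b)"
    unfolding G_def using shift_map_inverse[OF m ts(2)] ext(2) m' by (intro pencil_ext_shift) auto
  have "cdet (shift_map m a) (shift_map m b) =
      of_real (sqrt (1 - (norm m)\<^sup>2)) * cdet (a - (m, 0)) (b - (m, 0)) / ((1 - cnj m * fst a) * (1 - cnj m * fst b))"
  proof -
    have "(p / D) * (k * q' / E) - (k * p' / D) * (q / E) = k * (p * q' - p' * q) / (D * E)" for p q p' q' k D E :: complex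
      by (simp add: divide_inverse algebra_simps)
    then show ?thesis unfolding cdet_def shift_map_eq by simp
  qed
  then have "cdet (shift_map m a) (shift_map m b) = 0" using col by simp
  from two_pencils_origin[OF Gc ea eb this ts(3)] have G0: "pencil_ext G (0, 0)" .
  have "1 - cnj m * m \<noteq> 0"
  proof
    assume "1 - cnj m * m = 0"
    then have "m * cnj m = 1" by (simp add: mult.commute)
    then have "of_real ((norm m)\<^sup>2) = (1::complex)" unfolding complex_norm_square .
    then have "(norm m)\<^sup>2 = 1" by (simp only: of_real_eq_1_iff)
    then show False using m by (simp add: abs_square_eq_1)
  qed
  then have "pencil_ext (G \<circ> shift_map m) (m, 0)"
    using G0 by (intro pencil_ext_shift[OF m]) (auto simp: shift_map_eq)
  moreover have "(G \<circ> shift_map m) x = F x" if "x \<in> sphere 0 1" for x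
  proof -
    have "1 - cnj m * fst x \<noteq> 0"
      using ball_aut_den[OF ball_aut_shift[OF m], of x] that by (simp add: aff_def)
    then show ?thesis by (simp add: G_def shift_map_inverse(2)[OF m])
  qed
  ultimately show ?thesis by (rule pencil_ext_cong[rotated])
qed

theorem two_pencils_third:
  assumes F: "continuous_on (sphere 0 1) F" and ext: "pencil_ext F a" "pencil_ext F b"
    and p: "norm p < 1" and col: "cdet (a - p) (b - p) = 0" and t: "Im (tri a b p) \<noteq> 0"
  shows "pencil_ext F p"
proof (cases "p = 0")
  case True
  then show ?thesis using two_pencils_axis_point[OF F ext, of 0] col t by (simp add: zero_prod_def)
next
  case False
  then obtain u v where uv: "(norm u)\<^sup>2 + (norm v)\<^sup>2 = 1" and rp: "rot_map u v p = (of_real (norm p), 0)"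
    using unit_direction by blast
  have uv': "(norm (cnj u))\<^sup>2 + (norm (- v))\<^sup>2 = 1" using uv by simp
  define G where "G = F \<circ> rot_map (cnj u) (- v)"
  have "pencil_ext G (of_real (norm p), 0)"
  proof (rule two_pencils_axis_point)
    show "continuous_on (sphere 0 1) G" unfolding G_def by (rule rot_continuous[OF uv' F])
    show "pencil_ext G (rot_map u v a)" "pencil_ext G (rot_map u v b)"
      using pencil_ext_rotated[OF uv] ext unfolding G_def by auto
    show "cdet (rot_map u v a - (of_real (norm p), 0)) (rot_map u v b - (of_real (norm p), 0)) = 0"
      unfolding rp[symmetric] rot_map_diff rot_map_cdet[OF uv] by (rule col)
    show "Im (tri (rot_map u v a) (rot_map u v b) (of_real (norm p), 0)) \<noteq> 0"
      unfolding rp[symmetric] tri_def rot_map_herm[OF uv] using t[unfolded tri_def] .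
  qed (use p in simp)
  then show ?thesis using pencil_ext_unrot[OF uv, of F p] by (simp add: G_def rp)
qed

section \<open>Three pencils reach the whole ball\<close>

lemma lagrange_herm: "(norm (cdet x y))\<^sup>2 + (norm (herm x y))\<^sup>2 = (norm x)\<^sup>2 * (norm y)\<^sup>2"
  unfolding norm_pair_sq cmod_power2 cdet_def herm_def
  by (simp add: power2_eq_square algebra_simps)

lemma norm_diff_herm: "(norm (a - b))\<^sup>2 = (norm a)\<^sup>2 + (norm b)\<^sup>2 - 2 * Re (herm a b)"
  unfolding norm_pair_sq cmod_power2 herm_def by (simp add: power2_eq_square algebra_simps)

text \<open>
  On the left is, up to sign, the Gram determinant of \<open>a\<close> and \<open>b\<close> for the form \<open>1 - \<langle>x|y\<rangle>\<close>.
\<close>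

lemma herm_gram:
  "(norm (1 - herm a b))\<^sup>2 - (1 - (norm a)\<^sup>2) * (1 - (norm b)\<^sup>2) = (norm (a - b))\<^sup>2 - (norm (cdet a b))\<^sup>2"
proof -
  have "(norm (1 - herm a b))\<^sup>2 = 1 - 2 * Re (herm a b) + (norm (herm a b))\<^sup>2"
    unfolding cmod_power2 by (simp add: power2_eq_square algebra_simps)
  then show ?thesis using lagrange_herm[of a b] norm_diff_herm[of a b] by (simp add: algebra_simps)
qed

text \<open>
  The number \<open>norm (cdet a b) / norm (b - a)\<close> is the distance of the line from the origin, so the right-hand
  side of \<open>herm_gram\<close> is positive exactly for lines that meet the ball.
\<close>

lemma line_meets_ball_gram:
  assumes ab: "a \<noteq> b" and p: "norm (line_pt a (b - a) \<tau>) < 1"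
  shows "(1 - (norm a)\<^sup>2) * (1 - (norm b)\<^sup>2) < (norm (1 - herm a b))\<^sup>2"
proof -
  define p where "p = line_pt a (b - a) \<tau>"
  have "cdet a b = cdet p (b - a)" by (simp add: p_def cdet_def line_pt_def algebra_simps)
  then have "(norm (cdet a b))\<^sup>2 \<le> (norm p)\<^sup>2 * (norm (b - a))\<^sup>2"
    using lagrange_herm[of p "b - a"] by (metis le_add_same_cancel1 zero_le_power2)
  also have "\<dots> < 1 * (norm (b - a))\<^sup>2"
    using ab p by (intro mult_strict_right_mono) (auto simp: p_def power_less_one_iff abs_square_less_1)
  finally show ?thesis using herm_gram[of a b] by (simp add: norm_minus_commute)
qed

text \<open>
  Along the line the triple product is \<open>(1 - \<langle>a|b\<rangle>) * A * cnj B\<close> with affine functions \<open>A\<close> and \<open>B\<close> of the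
  parameter.  The determinant that \<open>affine_im_dense\<close> requires to be nonzero is \<open>1 - \<langle>a|b\<rangle>\<close> times the Gram
  determinant from \<open>line_meets_ball_gram\<close>.
\<close>

lemma tri_dense:
  assumes ab: "a \<noteq> b" and h: "herm a b \<noteq> 1" and p: "norm (line_pt a (b - a) \<tau>\<^sub>0) < 1" and d: "\<delta> > 0"
  obtains \<sigma> where "norm (\<sigma> - \<tau>) < \<delta>" "Im (tri a b (line_pt a (b - a) \<sigma>)) \<noteq> 0"
proof -
  define K where "K = 1 - herm a b"
  define A where "A = complex_of_real (1 - (norm a)\<^sup>2)"
  define B where "B = complex_of_real (1 - (norm b)\<^sup>2)"
  have haa: "herm a a = 1 - A" "herm b b = 1 - B" by (simp_all add: herm_self A_def B_def)
  have hab: "herm a b = 1 - K" "herm b a = 1 - cnj K" by (simp_all add: K_def cnj_herm)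
  define A1 where "A1 = cnj K - A"
  define B1 where "B1 = B - K"
  have hp: "1 - herm (line_pt a (b - a) s) a = A + A1 * s" "1 - herm (line_pt a (b - a) s) b = K + B1 * s" for s
  proof -
    have L: "herm (line_pt a (b - a) s) c = herm a c + s * (herm b c - herm a c)" for c
      by (simp add: herm_def line_pt_def algebra_simps)
    show "1 - herm (line_pt a (b - a) s) a = A + A1 * s" "1 - herm (line_pt a (b - a) s) b = K + B1 * s"
      unfolding L haa hab by (simp_all add: A1_def B1_def algebra_simps)
  qed
  have "K * (A + A1 * \<tau>) * B1 - K * A1 * (K + B1 * \<tau>) = K * (A * B - K * cnj K)"
    by (simp add: A1_def B1_def algebra_simps)
  also have "A * B - K * cnj K = of_real ((1 - (norm a)\<^sup>2) * (1 - (norm b)\<^sup>2) - (norm K)\<^sup>2)"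
    by (simp only: A_def B_def complex_norm_square of_real_mult of_real_diff)
  finally have "K * (A + A1 * \<tau>) * B1 - K * A1 * (K + B1 * \<tau>) \<noteq> 0"
    using line_meets_ball_gram[OF ab p] h by (simp add: K_def del: of_real_diff of_real_mult)
  from affine_im_dense[OF this d] obtain \<sigma> where s: "norm \<sigma> < \<delta>"
    "Im ((K * (A + A1 * \<tau>) + K * A1 * \<sigma>) * cnj (K + B1 * \<tau> + B1 * \<sigma>)) \<noteq> 0" by blast
  have "tri a b (line_pt a (b - a) (\<tau> + \<sigma>)) = K * cnj (1 - herm (line_pt a (b - a) (\<tau> + \<sigma>)) b) * (1 - herm (line_pt a (b - a) (\<tau> + \<sigma>)) a)"
    by (simp add: tri_def K_def cnj_herm)
  also have "\<dots> = (K * (A + A1 * \<tau>) + K * A1 * \<sigma>) * cnj (K + B1 * \<tau> + B1 * \<sigma>)"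
    unfolding hp by (simp add: algebra_simps)
  finally show ?thesis using s by (intro that[of "\<tau> + \<sigma>"]) auto
qed

lemma line_pt_continuous: "continuous_on A f \<Longrightarrow> continuous_on A g \<Longrightarrow> continuous_on A h \<Longrightarrow> continuous_on A (\<lambda>x. line_pt (f x) (g x) (h x))"
  unfolding line_pt_def by (intro continuous_intros)

lemma herm_continuous: "continuous_on A f \<Longrightarrow> continuous_on A g \<Longrightarrow> continuous_on A (\<lambda>x. herm (f x) (g x))"
  unfolding herm_def by (intro continuous_intros)

lemma tri_continuous: "continuous_on A f \<Longrightarrow> continuous_on A g \<Longrightarrow> continuous_on A h \<Longrightarrow> continuous_on A (\<lambda>x. tri (f x) (g x) (h x))"
  unfolding tri_def by (intro continuous_intros herm_continuous)

lemma cdet_line_pt: "cdet (a - line_pt a (b - a) s) (b - line_pt a (b - a) s) = 0"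
  by (simp add: cdet_def line_pt_def algebra_simps)

text \<open>
  First a point \<open>p1\<close> on the line through \<open>a\<close> and \<open>b\<close>, then a point \<open>q0\<close> on the line through \<open>p1\<close> and \<open>c\<close> are reached by
  \<open>two_pencils_third\<close>.  Moving \<open>q\<close> near \<open>q0\<close> moves the intersection point \<open>R q\<close> of the line through \<open>c\<close> and \<open>q\<close>
  with the line through \<open>a\<close> and \<open>b\<close> continuously, and the conditions are open, so a whole ball around \<open>q0\<close> is
  reached.  An arbitrary \<open>x\<close> is then treated with \<open>q0\<close> and a second point of that ball on the line through
  \<open>x\<close> and \<open>q0\<close>.
\<close>

theorem three_pencils_everywhere:
  assumes F: "continuous_on (sphere 0 1) F"
    and ext: "pencil_ext F a" "pencil_ext F b" "pencil_ext F c"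
    and meet: "norm (line_pt a (b - a) \<tau>\<^sub>0) < 1" and h: "herm a b \<noteq> 1"
    and nc: "cdet (b - a) (c - a) \<noteq> 0" and hc: "herm a c \<noteq> 1 \<or> herm b c \<noteq> 1" and x: "norm x < 1"
  shows "pencil_ext F x"
proof -
  have ab: "a \<noteq> b" using nc by (auto simp: cdet_def)
  define P where "P = line_pt a (b - a)"
  have Pc: "continuous_on UNIV P" unfolding P_def by (intro line_pt_continuous continuous_intros)
  define U where "U = {\<tau>. norm (P \<tau>) < 1} \<inter> {\<tau>. herm (P \<tau>) c \<noteq> 1}"
  have oU: "open U"
    unfolding U_def by (intro open_Int open_Collect_less open_Collect_neq continuous_intros herm_continuous Pc)
  \<comment> \<open>On the line, \<open>\<langle>p|c\<rangle>\<close> is an affine function of the parameter.  If it is \<open>1\<close> at \<open>\<tau>\<^sub>0\<close>, it is not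
    constant, because \<open>\<langle>a|c\<rangle>\<close> and \<open>\<langle>b|c\<rangle>\<close> are not both \<open>1\<close>.\<close>
  have neU: "U \<noteq> {}"
  proof (cases "herm (P \<tau>\<^sub>0) c = 1")
    case False
    then show ?thesis using meet by (auto simp: U_def P_def)
  next
    case True
    have hP: "herm (P \<tau>) c = herm a c + \<tau> * (herm b c - herm a c)" for \<tau>
      by (simp add: P_def herm_def line_pt_def algebra_simps)
    have ne: "herm b c - herm a c \<noteq> 0" using True hc hP[of \<tau>\<^sub>0] by auto
    have "open {\<tau>. norm (P \<tau>) < 1}" by (intro open_Collect_less continuous_intros Pc)
    moreover have "\<tau>\<^sub>0 \<in> {\<tau>. norm (P \<tau>) < 1}" using meet by (simp add: P_def)
    ultimately obtain e where e: "e > 0" "ball \<tau>\<^sub>0 e \<subseteq> {\<tau>. norm (P \<tau>) < 1}" by (rule openE)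
    define \<tau> where "\<tau> = \<tau>\<^sub>0 + of_real (e / 2)"
    have "\<tau> \<in> ball \<tau>\<^sub>0 e" using e by (simp add: \<tau>_def dist_norm)
    moreover have "herm (P \<tau>) c = 1 + of_real (e / 2) * (herm b c - herm a c)"
      using True unfolding hP by (simp add: \<tau>_def algebra_simps)
    then have "herm (P \<tau>) c \<noteq> 1" using ne e by simp
    ultimately show ?thesis using e by (auto simp: U_def)
  qed
  obtain \<tau>\<^sub>1 where t1: "\<tau>\<^sub>1 \<in> U" "Im (tri a b (P \<tau>\<^sub>1)) \<noteq> 0"
  proof -
    obtain \<tau> where "\<tau> \<in> U" using neU by blast
    with oU obtain e where e: "e > 0" "ball \<tau> e \<subseteq> U" by (rule openE)
    obtain \<sigma> where "norm (\<sigma> - \<tau>) < e" "Im (tri a b (line_pt a (b - a) \<sigma>)) \<noteq> 0"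
      using tri_dense[OF ab h meet e(1)] by blast
    moreover have "\<sigma> \<in> ball \<tau> e" using calculation by (simp add: dist_norm norm_minus_commute)
    ultimately show ?thesis using that[of \<sigma>] e unfolding P_def by blast
  qed
  define p1 where "p1 = P \<tau>\<^sub>1"
  have p1: "norm p1 < 1" "herm p1 c \<noteq> 1" using t1 by (auto simp: U_def p1_def)
  define D where "D = cdet (b - a) (c - a)"
  have D: "D \<noteq> 0" using nc by (simp add: D_def)
  have "p1 \<noteq> c"
  proof
    assume "p1 = c"
    then have "D = 0" unfolding D_def p1_def[symmetric] by (simp add: p1_def P_def cdet_def line_pt_def algebra_simps flip: \<open>p1 = c\<close>)
    then show False using D by simp
  qed
  define Q where "Q = line_pt p1 (c - p1)"
  have Qc: "continuous_on UNIV Q" unfolding Q_def by (intro line_pt_continuous continuous_intros)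
  have Q0: "Q 0 = p1" by (simp add: Q_def line_pt_def)
  have "open {\<sigma>. norm (Q \<sigma>) < 1}" by (intro open_Collect_less continuous_intros Qc)
  moreover have "0 \<in> {\<sigma>. norm (Q \<sigma>) < 1}" using p1 Q0 by simp
  ultimately obtain e where e: "e > 0" "ball 0 e \<subseteq> {\<sigma>. norm (Q \<sigma>) < 1}" by (rule openE)
  \<comment> \<open>The bound \<open>1/2\<close> keeps the new point away from \<open>c\<close>, which has parameter \<open>1\<close>.\<close>
  obtain \<sigma>\<^sub>0 where s0: "norm (\<sigma>\<^sub>0 - 0) < min e (1/2)" "Im (tri p1 c (line_pt p1 (c - p1) \<sigma>\<^sub>0)) \<noteq> 0"
  proof -
    have "norm (line_pt p1 (c - p1) 0) < 1" "min e (1/2) > 0" using p1(1) e(1) by (simp_all add: line_pt_def)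
    from tri_dense[OF \<open>p1 \<noteq> c\<close> p1(2) this, of 0] that show ?thesis by blast
  qed
  define q0 where "q0 = Q \<sigma>\<^sub>0"
  have q0: "norm q0 < 1" "Im (tri p1 c q0) \<noteq> 0" using s0 e by (auto simp: q0_def Q_def dist_norm)
  have s1: "\<sigma>\<^sub>0 \<noteq> 1" using s0(1) by auto
  \<comment> \<open>Affine coordinates with origin \<open>a\<close> and basis \<open>b - a\<close>, \<open>c - a\<close>.  The projection from \<open>c\<close> to the line
    through \<open>a\<close> and \<open>b\<close> has parameter \<open>X / (1 - Y)\<close>.\<close>
  define X where "X q = cdet (q - a) (c - a) / D" for q
  define Y where "Y q = cdet (b - a) (q - a) / D" for q
  have Yq0: "Y q0 = \<sigma>\<^sub>0"
  proof -
    have "cdet (b - a) (q0 - a) = \<sigma>\<^sub>0 * D"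
      by (simp add: q0_def Q_def p1_def P_def D_def cdet_def line_pt_def algebra_simps)
    then show ?thesis using D by (simp add: Y_def)
  qed
  have Xq0: "X q0 = (1 - \<sigma>\<^sub>0) * \<tau>\<^sub>1"
  proof -
    have "cdet (q0 - a) (c - a) = (1 - \<sigma>\<^sub>0) * \<tau>\<^sub>1 * D"
      by (simp add: q0_def Q_def p1_def P_def D_def cdet_def line_pt_def algebra_simps)
    then show ?thesis using D by (simp add: X_def)
  qed
  define R where "R q = P (X q / (1 - Y q))" for q
  have XYc: "continuous_on A X" "continuous_on A Y" for A
    unfolding X_def Y_def cdet_def using D by (intro continuous_intros; simp)+
  define W where "W = {q. Y q \<noteq> 1}"
  have oW: "open W" unfolding W_def by (intro open_Collect_neq XYc continuous_intros)
  have Rc: "continuous_on W R"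
    unfolding R_def
    by (rule continuous_on_compose2[OF Pc]) (auto intro!: continuous_intros XYc simp: W_def)
  define N where "N = {q \<in> W. norm (R q) < 1 \<and> Im (tri a b (R q)) \<noteq> 0 \<and> norm q < 1 \<and> Im (tri (R q) c q) \<noteq> 0}"
  have "open N"
  proof -
    define f where "f q = (norm (R q), Im (tri a b (R q)), norm q, Im (tri (R q) c q))" for q
    have fc: "continuous_on W f"
      unfolding f_def by (intro continuous_intros tri_continuous Rc)
    have "open ({..<1::real} \<times> (- {0::real}) \<times> {..<1::real} \<times> (- {0::real}))"
      by (intro open_Times open_lessThan open_Compl closed_singleton)
    then have "open (f -` ({..<1} \<times> (- {0}) \<times> {..<1} \<times> (- {0})) \<inter> W)"
      using fc oW by (metis continuous_on_open_vimage inf_commute)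
    also have "f -` ({..<1} \<times> (- {0}) \<times> {..<1} \<times> (- {0})) \<inter> W = N" by (auto simp: N_def f_def)
    finally show ?thesis .
  qed
  moreover have "q0 \<in> N"
  proof -
    have "R q0 = p1" using s1 by (simp add: R_def Xq0 Yq0 p1_def)
    then show ?thesis using q0 p1 t1 s1 by (simp add: N_def W_def Yq0 p1_def)
  qed
  ultimately obtain \<delta> where dl: "\<delta> > 0" "ball q0 \<delta> \<subseteq> N" by (rule openE)
  have extN: "pencil_ext F q" if q: "q \<in> N" for q
  proof -
    have R: "norm (R q) < 1" "Im (tri a b (R q)) \<noteq> 0" "norm q < 1" "Im (tri (R q) c q) \<noteq> 0" "Y q \<noteq> 1"
      using q by (auto simp: N_def W_def)
    have eR: "pencil_ext F (R q)"
      by (rule two_pencils_third[OF F ext(1,2) R(1) _ R(2)]) (simp add: R_def P_def cdet_line_pt)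
    have "cdet (R q - q) (c - q) = 0"
    proof -
      define k where "k = 1 - Y q"
      have k: "k \<noteq> 0" using R(5) by (simp add: k_def)
      have kD: "k * D = D - cdet (b - a) (q - a)" using D by (simp add: k_def Y_def field_simps)
      have xD: "X q * D = cdet (q - a) (c - a)" using D by (simp add: X_def)
      define y where "y = X q / k"
      have ky: "X q = k * y" using k by (simp add: y_def)
      have Rq: "R q = line_pt a (b - a) y" by (simp add: R_def P_def y_def k_def)
      have "k * D * cdet (R q - q) (c - q) = k * D * cdet (a - q) (c - q) + X q * D * cdet (b - a) (c - q)"
        unfolding Rq ky by (simp add: cdet_def line_pt_def algebra_simps)
      also have "\<dots> = 0" unfolding kD xD unfolding D_def by (simp add: cdet_def algebra_simps)
      finally show ?thesis using k D by simp
    qed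
    then show ?thesis by (rule two_pencils_third[OF F eR ext(3) R(3) _ R(4)])
  qed
  have eq0: "pencil_ext F q0"
    by (rule extN, rule subsetD[OF dl(2)]) (simp add: dl(1))
  show ?thesis
  proof (cases "x = q0")
    case True
    then show ?thesis using eq0 by simp
  next
    case False
    have hx: "herm x q0 \<noteq> 1"
    proof
      assume "herm x q0 = 1"
      then have "1 \<le> norm x * norm q0" using herm_bound[of x q0] by simp
      also have "\<dots> < 1 * 1" using x q0(1) by (intro mult_strict_mono') auto
      finally show False by simp
    qed
    have nx: "norm (q0 - x) > 0" using False by simp
    obtain \<tau> where t: "norm (\<tau> - 1) < \<delta> / norm (q0 - x)" "Im (tri x q0 (line_pt x (q0 - x) \<tau>)) \<noteq> 0"
    proof -
      have "norm (line_pt x (q0 - x) 0) < 1" "\<delta> / norm (q0 - x) > 0" using x dl(1) nx by (simp_all add: line_pt_def)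
      from tri_dense[OF False hx this, of 1] that show ?thesis by blast
    qed
    define q where "q = line_pt x (q0 - x) \<tau>"
    have "q - q0 = line_pt 0 (q0 - x) (\<tau> - 1)" by (simp add: q_def line_pt_def prod_eq_iff algebra_simps)
    then have "(norm (q - q0))\<^sup>2 = (norm (\<tau> - 1) * norm (q0 - x))\<^sup>2"
      unfolding norm_pair_sq power_mult_distrib by (simp add: line_pt_def norm_mult power_mult_distrib distrib_left)
    then have "norm (q - q0) = norm (\<tau> - 1) * norm (q0 - x)" by (simp add: power2_eq_iff_nonneg)
    also have "\<dots> < \<delta>" using t(1) nx by (simp add: field_simps)
    finally have "q \<in> ball q0 \<delta>" by (simp add: dist_norm norm_minus_commute)
    then have eq: "pencil_ext F q" using dl extN by blast
    show ?thesis
    proof (rule two_pencils_third[OF F eq0 eq x])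
      show "cdet (q0 - x) (q - x) = 0" by (simp add: q_def cdet_def line_pt_def algebra_simps)
      have "tri q0 q x = tri x q0 q" by (simp add: tri_def mult_ac)
      then show "Im (tri q0 q x) \<noteq> 0" using t(2) by (simp add: q_def)
    qed
  qed
qed

section \<open>Fourier coefficients over tori\<close>

text \<open>
  The weight is taken with the point \<open>(u * z, v * w)\<close>, not with \<open>(u, v)\<close>: only then is it
  holomorphic along lines, off the coordinate axes, and the coefficient can be independent of the torus.
\<close>

definition torus_coeff :: "(complex \<times> complex \<Rightarrow> complex) \<Rightarrow> int \<Rightarrow> int \<Rightarrow> complex \<Rightarrow> complex \<Rightarrow> complex" where
  "torus_coeff F a b z w = circle_int (\<lambda>u. circle_int (\<lambda>v. F (u * z, v * w) * ((u * z) powi a * (v * w) powi b)))"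

lemma continuous_on_slice:
  assumes "continuous_on (A \<times> B) (\<lambda>(x, y). H x y)" "x \<in> A"
  shows "continuous_on B (H x)"
proof -
  have "continuous_on B ((\<lambda>(x, y). H x y) \<circ> (\<lambda>y. (x, y)))"
    by (rule continuous_on_compose)
       (use assms(2) in \<open>auto intro!: continuous_intros intro: continuous_on_subset[OF assms(1)]\<close>)
  then show ?thesis by (simp add: o_def)
qed

lemma rotated_in_sphere:
  fixes z w u v :: complex
  assumes "(z, w) \<in> sphere 0 1" "norm u = 1" "norm v = 1"
  shows "(u * z, v * w) \<in> sphere 0 1"
  using assms by (simp add: norm_prod_def norm_mult)

lemma torus_continuous:
  fixes F :: "complex \<times> complex \<Rightarrow> complex"
  assumes F: "continuous_on (sphere 0 1) F" and zw: "(z, w) \<in> sphere 0 1" "z \<noteq> 0" "w \<noteq> 0"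
  shows "continuous_on (sphere 0 1 \<times> sphere 0 1) (\<lambda>(u, v). F (u * z, v * w) * ((u * z) powi a * (v * w) powi b))"
proof -
  have "continuous_on (sphere 0 1 \<times> sphere 0 1) (\<lambda>p. F (fst p * z, snd p * w))"
    by (rule continuous_on_compose2[OF F]) (use rotated_in_sphere[OF zw(1)] in \<open>auto intro!: continuous_intros\<close>)
  moreover have "continuous_on (sphere 0 1 \<times> sphere 0 1) (\<lambda>p. (fst p * z) powi a * (snd p * w) powi b)"
    by (intro continuous_intros) (use zw in auto)
  ultimately show ?thesis unfolding split_beta by (rule continuous_on_mult)
qed

lemma torus_coeff_rotate:
  assumes F: "continuous_on (sphere 0 1) F" and zw: "(z, w) \<in> sphere 0 1" "z \<noteq> 0" "w \<noteq> 0"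
    and e: "norm \<eta> = 1" "norm \<zeta> = 1"
  shows "torus_coeff F a b (\<eta> * z) (\<zeta> * w) = torus_coeff F a b z w"
proof -
  define H where "H u v = F (u * z, v * w) * ((u * z) powi a * (v * w) powi b)" for u v
  have Hc: "continuous_on (sphere 0 1 \<times> sphere 0 1) (\<lambda>(u, v). H u v)"
    unfolding H_def by (rule torus_continuous[OF F zw])
  have Hc1: "continuous_on (sphere 0 1) (H u)" if "norm u = 1" for u
    using continuous_on_slice[OF Hc] that by simp
  have "torus_coeff F a b (\<eta> * z) (\<zeta> * w) = circle_int (\<lambda>u. circle_int (\<lambda>v. H (\<eta> * u) (\<zeta> * v)))"
    unfolding torus_coeff_def H_def by (simp only: mult.assoc mult.left_commute[of _ \<eta>] mult.left_commute[of _ \<zeta>])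
  also have "\<dots> = circle_int (\<lambda>u. circle_int (H (\<eta> * u)))"
    by (rule circle_int_cong, rule circle_int_rotate) (use e Hc1 in \<open>simp_all add: norm_mult\<close>)
  also have "\<dots> = circle_int (\<lambda>u. circle_int (H u))"
    by (rule circle_int_rotate[of "\<lambda>u. circle_int (H u)", OF _ e(1)]) (rule continuous_on_circle_int[OF Hc])
  also have "\<dots> = torus_coeff F a b z w" by (simp add: torus_coeff_def H_def[abs_def])
  finally show ?thesis .
qed

lemma torus_coeff_modulus:
  assumes F: "continuous_on (sphere 0 1) F" and zw: "(z, w) \<in> sphere 0 1" "z \<noteq> 0" "w \<noteq> 0"
  shows "torus_coeff F a b z w = torus_coeff F a b (of_real (norm z)) (of_real (norm w))"
proof -
  define \<eta> where "\<eta> = z / of_real (norm z)"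
  define \<zeta> where "\<zeta> = w / of_real (norm w)"
  have e: "norm \<eta> = 1" "norm \<zeta> = 1" "z = \<eta> * of_real (norm z)" "w = \<zeta> * of_real (norm w)"
    using zw by (simp_all add: \<eta>_def \<zeta>_def norm_divide)
  have s: "(of_real (norm z), of_real (norm w)) \<in> sphere (0 :: complex \<times> complex) 1"
    using zw(1) by (simp add: norm_prod_def)
  show ?thesis
    using torus_coeff_rotate[OF F s _ _ e(1,2), of a b] zw e(3,4) by simp
qed

text \<open>
  The line \<open>t \<mapsto> (Z t, W t)\<close> meets the ball in the unit disc, has both coordinates nonzero there, and passes
  through the two given tori at \<open>t = -1\<close> and \<open>t = 1\<close>.  Along it, and along all its rotations, the weight is
  holomorphic, so the coefficient \<open>\<Theta> t\<close> has vanishing moments of positive order.  It depends on the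
  moduli of \<open>Z t\<close> and \<open>W t\<close> only, hence \<open>\<Theta> (cnj t) = \<Theta> t\<close>, and the moments of negative order vanish too.
\<close>

lemma torus_coeff_const:
  assumes F: "continuous_on (sphere 0 1) F" and ext: "\<And>x. norm x < 1 \<Longrightarrow> pencil_ext F x"
    and r: "0 < r\<^sub>1" "r\<^sub>1 < r\<^sub>2" "r\<^sub>2 < 1"
  shows "torus_coeff F a b (of_real r\<^sub>1) (of_real (sqrt (1 - r\<^sub>1\<^sup>2))) = torus_coeff F a b (of_real r\<^sub>2) (of_real (sqrt (1 - r\<^sub>2\<^sup>2)))"
proof -
  define p where "p = sqrt (1 - r\<^sub>1\<^sup>2)"
  define q where "q = sqrt (1 - r\<^sub>2\<^sup>2)"
  have sq: "r\<^sub>1\<^sup>2 < r\<^sub>2\<^sup>2" "r\<^sub>2\<^sup>2 < 1" using r by (auto simp: power_strict_mono abs_square_less_1)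
  have pq: "0 < q" "q < p" "p\<^sup>2 = 1 - r\<^sub>1\<^sup>2" "q\<^sup>2 = 1 - r\<^sub>2\<^sup>2" using sq by (auto simp: p_def q_def)
  \<comment> \<open>The midpoints and half differences of the radii; \<open>unit\<close> and \<open>cross\<close> say that \<open>(Z t, W t)\<close> is on the
    sphere exactly for \<open>norm t = 1\<close>.\<close>
  define c where "c = (r\<^sub>1 + r\<^sub>2) / 2"
  define \<rho> where "\<rho> = (r\<^sub>2 - r\<^sub>1) / 2"
  define \<mu> where "\<mu> = (p + q) / 2"
  define d where "d = (p - q) / 2"
  have pos: "0 < \<rho>" "\<rho> < c" "0 < d" "d < \<mu>" using r pq by (simp_all add: c_def \<rho>_def \<mu>_def d_def)
  have unit: "c\<^sup>2 + \<rho>\<^sup>2 + \<mu>\<^sup>2 + d\<^sup>2 = 1"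
  proof -
    have "c\<^sup>2 + \<rho>\<^sup>2 + \<mu>\<^sup>2 + d\<^sup>2 = (r\<^sub>1\<^sup>2 + r\<^sub>2\<^sup>2 + p\<^sup>2 + q\<^sup>2) / 2"
      by (simp add: c_def \<rho>_def \<mu>_def d_def power2_eq_square field_simps)
    then show ?thesis using pq by simp
  qed
  have cross: "c * \<rho> = \<mu> * d"
  proof -
    have "c * \<rho> = (r\<^sub>2\<^sup>2 - r\<^sub>1\<^sup>2) / 4" "\<mu> * d = (p\<^sup>2 - q\<^sup>2) / 4"
      by (simp_all add: c_def \<rho>_def \<mu>_def d_def power2_eq_square field_simps)
    then show ?thesis using pq by simp
  qed
  define Z where "Z t = of_real c + of_real \<rho> * t" for t :: complex
  define W where "W t = of_real \<mu> - of_real d * t" for t :: complex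
  have key: "(norm (Z t))\<^sup>2 + (norm (W t))\<^sup>2 - 1 = (\<rho>\<^sup>2 + d\<^sup>2) * ((norm t)\<^sup>2 - 1)" for t
  proof -
    have e: "(norm (Z t))\<^sup>2 + (norm (W t))\<^sup>2 = c\<^sup>2 + \<mu>\<^sup>2 + (\<rho>\<^sup>2 + d\<^sup>2) * (norm t)\<^sup>2 + 2 * (c * \<rho> - \<mu> * d) * Re t"
      unfolding Z_def W_def cmod_power2 by (simp add: power2_eq_square algebra_simps)
    show ?thesis unfolding e cross right_diff_distrib using unit by simp
  qed
  have kpos: "\<rho>\<^sup>2 + d\<^sup>2 > 0" using pos by (simp add: add_pos_pos)
  have ZW0: "Z t \<noteq> 0" "W t \<noteq> 0" if "norm t \<le> 1" for t
  proof -
    have "\<rho> * norm t \<le> \<rho> * 1" "d * norm t \<le> d * 1" using that pos by (auto intro!: mult_left_mono)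
    moreover have "norm (of_real \<rho> * t) = \<rho> * norm t" "norm (of_real d * t) = d * norm t" using pos by (simp_all add: norm_mult)
    ultimately have "norm (of_real \<rho> * t) < c" "norm (of_real d * t) < \<mu>" using pos by linarith+
    then have "norm (- (of_real \<rho> * t)) \<noteq> norm (complex_of_real c)" "norm (of_real d * t) \<noteq> norm (complex_of_real \<mu>)"
      using pos by auto
    then show "Z t \<noteq> 0" "W t \<noteq> 0" unfolding Z_def W_def by (metis add_eq_0_iff norm_minus_cancel, metis eq_iff_diff_eq_0)
  qed
  have ZWs: "(Z t, W t) \<in> sphere 0 1" if "norm t = 1" for t
    using key[of t] that by (simp add: norm_prod_def)
  have Zc: "continuous_on A Z" and Wc: "continuous_on A W" for A unfolding Z_def W_def by (intro continuous_intros)+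
  define \<Theta> where "\<Theta> t = torus_coeff F a b (Z t) (W t)" for t
  define H where "H t u v = F (u * Z t, v * W t) * ((u * Z t) powi a * (v * W t) powi b)" for t u v
  have Hc: "continuous_on ((sphere 0 1 \<times> sphere 0 1) \<times> sphere 0 1) (\<lambda>p. H (fst (fst p)) (snd (fst p)) (snd p))"
  proof -
    have ZWc: "continuous_on ((sphere 0 1 \<times> sphere 0 1) \<times> sphere 0 1) (\<lambda>p. Z (fst (fst p)))"
      "continuous_on ((sphere 0 1 \<times> sphere 0 1) \<times> sphere 0 1) (\<lambda>p. W (fst (fst p)))"
      unfolding Z_def W_def by (intro continuous_intros)+
    have 1: "continuous_on ((sphere 0 1 \<times> sphere 0 1) \<times> sphere 0 1) (\<lambda>p. F (snd (fst p) * Z (fst (fst p)), snd p * W (fst (fst p))))"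
      by (rule continuous_on_compose2[OF F])
         (use rotated_in_sphere[OF ZWs] in \<open>auto intro!: continuous_intros ZWc\<close>)
    have 2: "continuous_on ((sphere 0 1 \<times> sphere 0 1) \<times> sphere 0 1)
        (\<lambda>p. (snd (fst p) * Z (fst (fst p))) powi a * (snd p * W (fst (fst p))) powi b)"
      by (intro continuous_intros ZWc) (use ZW0 in auto)
    show ?thesis unfolding H_def by (intro continuous_on_mult 1 2)
  qed
  have H2c: "continuous_on (sphere 0 1 \<times> sphere 0 1) (\<lambda>(t, u). circle_int (\<lambda>v. H t u v))"
    using continuous_on_circle_int[of "sphere 0 1 \<times> sphere 0 1" "\<lambda>q v. H (fst q) (snd q) v"] Hc
    by (simp add: split_beta)
  have \<Theta>c: "continuous_on (sphere 0 1) \<Theta>"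
    unfolding \<Theta>_def torus_coeff_def by (rule continuous_on_circle_int) (use H2c in \<open>simp add: H_def\<close>)
  have line: "circle_int (\<lambda>t. H t u v * t ^ l) = 0" if u: "norm u = 1" and v: "norm v = 1" and l: "l \<ge> 1" for u v l
  proof -
    define x where "x = (u * of_real c, v * of_real \<mu>)"
    define y where "y = (u * of_real \<rho>, - (v * of_real d))"
    have lp: "line_pt x y t = (u * Z t, v * W t)" for t
      by (simp add: line_pt_def x_def y_def Z_def W_def algebra_simps)
    have nl: "(norm (line_pt x y t))\<^sup>2 - 1 = (\<rho>\<^sup>2 + d\<^sup>2) * ((norm t)\<^sup>2 - 1)" for t
      unfolding lp norm_pair_sq using key[of t] u v by (simp add: norm_mult)
    have cmp: "norm (line_pt x y t) \<le> 1 \<longleftrightarrow> norm t \<le> 1" "norm (line_pt x y t) < 1 \<longleftrightarrow> norm t < 1" for t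
    proof -
      have "norm (line_pt x y t) \<le> 1 \<longleftrightarrow> (norm (line_pt x y t))\<^sup>2 - 1 \<le> 0" using abs_square_le_1[of "norm (line_pt x y t)"] by simp
      also have "\<dots> \<longleftrightarrow> (norm t)\<^sup>2 - 1 \<le> 0" unfolding nl using kpos by (simp add: mult_le_0_iff)
      also have "\<dots> \<longleftrightarrow> norm t \<le> 1" using abs_square_le_1[of "norm t"] by simp
      finally show "norm (line_pt x y t) \<le> 1 \<longleftrightarrow> norm t \<le> 1" .
      have "norm (line_pt x y t) < 1 \<longleftrightarrow> (norm (line_pt x y t))\<^sup>2 - 1 < 0" using abs_square_less_1[of "norm (line_pt x y t)"] by simp
      also have "\<dots> \<longleftrightarrow> (norm t)\<^sup>2 - 1 < 0" unfolding nl using kpos by (simp add: mult_less_0_iff)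
      also have "\<dots> \<longleftrightarrow> norm t < 1" using abs_square_less_1[of "norm t"] by simp
      finally show "norm (line_pt x y t) < 1 \<longleftrightarrow> norm t < 1" .
    qed
    have "norm x < 1" using cmp(2)[of 0] by (simp add: line_pt_def)
    moreover have "y \<noteq> 0" using u pos by (auto simp: y_def zero_prod_def)
    ultimately have le: "line_ext F x y" using ext[of x] unfolding pencil_ext_def by blast
    define X where "X t = (u * Z t) powi a * (v * W t) powi b * t ^ (l - 1)" for t
    have "circle_int (\<lambda>t. t * (F (line_pt x y (0 + of_real 1 * t)) * X (0 + of_real 1 * t))) = 0"
    proof (rule line_ext_Cauchy[OF le _ F])
      show "continuous_on (cball 0 1) X"
        unfolding X_def by (intro continuous_intros Zc Wc) (use ZW0 u v in auto)
      show "X holomorphic_on ball 0 1"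
        unfolding X_def Z_def W_def by (intro holomorphic_intros) (use ZW0 u v in \<open>auto simp: Z_def W_def\<close>)
    qed (simp_all add: cmp)
    moreover have "t * (F (line_pt x y (0 + of_real 1 * t)) * X (0 + of_real 1 * t)) = H t u v * t ^ l" for t
      using l by (cases l) (simp_all add: lp X_def H_def mult_ac)
    ultimately show ?thesis by simp
  qed
  have mom: "circle_int (\<lambda>t. \<Theta> t * t ^ l) = 0" if l: "l \<ge> 1" for l
  proof -
    have "circle_int (\<lambda>t. \<Theta> t * t ^ l) = circle_int (\<lambda>t. circle_int (\<lambda>u. circle_int (\<lambda>v. H t u v) * t ^ l))"
      unfolding \<Theta>_def torus_coeff_def H_def circle_int_multc ..
    also have "\<dots> = circle_int (\<lambda>u. circle_int (\<lambda>t. circle_int (\<lambda>v. H t u v) * t ^ l))"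
      by (rule circle_int_swap) (use H2c in \<open>unfold split_beta, intro continuous_intros\<close>)
    also have "\<dots> = circle_int (\<lambda>u. 0)"
    proof (rule circle_int_cong)
      fix u :: complex assume u: "norm u = 1"
      have "continuous_on (sphere 0 1 \<times> sphere 0 1) (\<lambda>p. H (fst p) u (snd p))"
      proof -
        have "continuous_on (sphere 0 1 \<times> sphere 0 1) ((\<lambda>p. H (fst (fst p)) (snd (fst p)) (snd p)) \<circ> (\<lambda>p. ((fst p, u), snd p)))"
        proof (rule continuous_on_compose)
          show "continuous_on (sphere 0 1 \<times> sphere 0 1) (\<lambda>p. ((fst p, u), snd p))" by (intro continuous_intros)
          show "continuous_on ((\<lambda>p. ((fst p, u), snd p)) ` (sphere 0 1 \<times> sphere 0 1)) (\<lambda>p. H (fst (fst p)) (snd (fst p)) (snd p))"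
            by (rule continuous_on_subset[OF Hc]) (use u in auto)
        qed
        then show ?thesis by (simp add: o_def)
      qed
      then have c1: "continuous_on (sphere 0 1 \<times> sphere 0 1) (\<lambda>p. H (fst p) u (snd p) * fst p ^ l)"
        by (intro continuous_intros)
      have "circle_int (\<lambda>t. circle_int (\<lambda>v. H t u v) * t ^ l) = circle_int (\<lambda>t. circle_int (\<lambda>v. H t u v * t ^ l))"
        by (simp only: circle_int_multc)
      also have "\<dots> = circle_int (\<lambda>v. circle_int (\<lambda>t. H t u v * t ^ l))"
        by (rule circle_int_swap) (use c1 in \<open>simp add: split_beta\<close>)
      also have "\<dots> = circle_int (\<lambda>v. 0)"
        by (rule circle_int_cong) (rule line[OF u _ l])
      finally show "circle_int (\<lambda>t. circle_int (\<lambda>v. H t u v) * t ^ l) = 0" by simp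
    qed
    finally show ?thesis by simp
  qed
  have sym: "\<Theta> (cnj t) = \<Theta> t" if t: "norm t = 1" for t
  proof -
    have "Z (cnj t) = cnj (Z t)" "W (cnj t) = cnj (W t)" by (simp_all add: Z_def W_def)
    then have n: "norm (Z (cnj t)) = norm (Z t)" "norm (W (cnj t)) = norm (W t)" by simp_all
    show ?thesis
      unfolding \<Theta>_def
      using torus_coeff_modulus[OF F ZWs[of t], of a b] torus_coeff_modulus[OF F ZWs[of "cnj t"], of a b] ZW0[of t] ZW0[of "cnj t"] t n
      by simp
  qed
  have momc: "circle_int (\<lambda>t. \<Theta> t * cnj t ^ l) = 0" if l: "l \<ge> 1" for l
  proof -
    have "circle_int (\<lambda>t. \<Theta> t * cnj t ^ l) = circle_int (\<lambda>t. (\<lambda>s. \<Theta> s * s ^ l) (cnj t))"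
      by (rule circle_int_cong) (simp add: sym)
    also have "\<dots> = circle_int (\<lambda>s. \<Theta> s * s ^ l)"
      by (rule circle_int_cnj) (intro continuous_intros \<Theta>c)
    finally show ?thesis using mom[OF l] by simp
  qed
  define K where "K = circle_int \<Theta> / of_real (2 * pi)"
  have const: "\<Theta> t - K = 0" if "norm t = 1" for t
  proof (rule circle_fourier_unique[of "\<lambda>t. \<Theta> t - K", OF _ _ _ that])
    show "continuous_on (sphere 0 1) (\<lambda>t. \<Theta> t - K)" by (intro continuous_intros \<Theta>c)
    have K0: "circle_int (\<lambda>t. \<Theta> t - K) = 0" by (subst circle_int_diff) (simp_all add: \<Theta>c K_def)
    show "circle_int (\<lambda>t. (\<Theta> t - K) * t ^ n) = 0" for n
    proof (cases "n = 0")
      case False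
      then show ?thesis unfolding left_diff_distrib
        by (subst circle_int_diff) (auto intro!: continuous_intros \<Theta>c simp: mom circle_int_cmult circle_int_power)
    qed (use K0 in simp)
    show "circle_int (\<lambda>t. (\<Theta> t - K) * cnj t ^ n) = 0" for n
    proof (cases "n = 0")
      case False
      then show ?thesis unfolding left_diff_distrib
        by (subst circle_int_diff) (auto intro!: continuous_intros \<Theta>c simp: momc circle_int_cmult circle_int_cnj_power)
    qed (use K0 in simp)
  qed
  have "\<Theta> (-1) = \<Theta> 1" using const[of 1] const[of "-1"] by simp
  moreover have "Z (-1) = of_real r\<^sub>1" "W (-1) = of_real p" "Z 1 = of_real r\<^sub>2" "W 1 = of_real q"
    unfolding Z_def W_def c_def \<rho>_def \<mu>_def d_def by (simp_all add: field_simps flip: of_real_add of_real_diff of_real_minus)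
  ultimately show ?thesis by (simp add: \<Theta>_def p_def q_def)
qed

lemma torus_coeff_bound:
  assumes F: "continuous_on (sphere 0 1) F" and B: "\<And>x. x \<in> sphere 0 1 \<Longrightarrow> norm (F x) \<le> B"
    and zw: "(z, w) \<in> sphere 0 1" "z \<noteq> 0" "w \<noteq> 0"
  shows "norm (torus_coeff F a b z w) \<le> 2 * pi * (2 * pi * (B * (norm z powi a * norm w powi b)))"
proof -
  have c: "continuous_on (sphere 0 1 \<times> sphere 0 1) (\<lambda>(u, v). F (u * z, v * w) * ((u * z) powi a * (v * w) powi b))"
    by (rule torus_continuous[OF F zw])
  show ?thesis
    unfolding torus_coeff_def
  proof (rule circle_int_bound, rule continuous_on_circle_int[OF c], rule circle_int_bound)
    fix u :: complex assume u: "norm u = 1"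
    show "continuous_on (sphere 0 1) (\<lambda>v. F (u * z, v * w) * ((u * z) powi a * (v * w) powi b))"
      using continuous_on_slice[OF c] u by simp
    fix v :: complex assume v: "norm v = 1"
    have "norm (F (u * z, v * w)) * (norm z powi a * norm w powi b) \<le> B * (norm z powi a * norm w powi b)"
      using B[OF rotated_in_sphere[OF zw(1) u v]] by (intro mult_right_mono) auto
    then show "norm (F (u * z, v * w) * ((u * z) powi a * (v * w) powi b)) \<le> B * (norm z powi a * norm w powi b)"
      using u v by (simp add: norm_mult norm_power_int)
  qed
qed

text \<open>
  If \<open>a > 0\<close>, then the weight tends to zero as the torus degenerates to \<open>z = 0\<close>; if \<open>b > 0\<close>, then the same happens
  at \<open>w = 0\<close>.
\<close>

theorem torus_coeff_structure:
  assumes F: "continuous_on (sphere 0 1) F" and ext: "\<And>x. norm x < 1 \<Longrightarrow> pencil_ext F x"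
  shows "\<exists>C. (\<forall>z w. (z, w) \<in> sphere 0 1 \<longrightarrow> z \<noteq> 0 \<longrightarrow> w \<noteq> 0 \<longrightarrow> torus_coeff F a b z w = C) \<and> (a > 0 \<or> b > 0 \<longrightarrow> C = 0)"
proof -
  obtain B where B: "B > 0" "\<And>x. x \<in> sphere 0 1 \<Longrightarrow> norm (F x) \<le> B"
    using compact_imp_bounded[OF compact_continuous_image[OF F compact_sphere]]
    unfolding bounded_pos by auto
  define T where "T r = torus_coeff F a b (of_real r) (of_real (sqrt (1 - r\<^sup>2)))" for r
  define C where "C = T (1/2)"
  have TC: "T r = C" if "0 < r" "r < 1" for r
  proof (cases r "1/2 :: real" rule: linorder_cases)
    case less
    then show ?thesis unfolding C_def T_def using that by (intro torus_coeff_const[OF F ext]) auto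
  next
    case equal
    then show ?thesis by (simp only: C_def)
  next
    case greater
    then show ?thesis unfolding C_def T_def using that by (intro torus_coeff_const[OF F ext, symmetric]) auto
  qed
  have all: "torus_coeff F a b z w = C" if zw: "(z, w) \<in> sphere 0 1" "z \<noteq> 0" "w \<noteq> 0" for z w
  proof -
    have e: "(norm z)\<^sup>2 + (norm w)\<^sup>2 = 1" using zw(1) by (simp add: norm_prod_def)
    then have "(norm z)\<^sup>2 < 1" using zw by (smt (verit) zero_less_norm_iff zero_less_power)
    then have "norm z < 1" by (simp add: abs_square_less_1)
    moreover have "sqrt (1 - (norm z)\<^sup>2) = norm w" using e by (intro real_sqrt_unique) auto
    ultimately show ?thesis
      using TC[of "norm z"] zw torus_coeff_modulus[OF F zw, of a b] by (simp add: T_def)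
  qed
  have bd: "norm C \<le> 2 * pi * (2 * pi * (B * (r powi a * sqrt (1 - r\<^sup>2) powi b)))" if r: "0 < r" "r < 1" for r
  proof -
    have r2: "r\<^sup>2 < 1" using r by (simp add: abs_square_less_1)
    have s: "(of_real r, of_real (sqrt (1 - r\<^sup>2))) \<in> sphere (0 :: complex \<times> complex) 1"
      using r2 by (simp add: norm_prod_def)
    show ?thesis
      using torus_coeff_bound[OF F B(2) s, of a b] r r2 TC[OF r] by (simp add: T_def)
  qed
  have "C = 0" if "a > 0 \<or> b > 0"
  proof -
    have "norm C \<le> 0"
    proof (cases "a > 0")
      case True
      have "((\<lambda>r. 2 * pi * (2 * pi * (B * (r powi a * sqrt (1 - r\<^sup>2) powi b)))) \<longlongrightarrow> 2 * pi * (2 * pi * (B * (0 powi a * sqrt (1 - 0\<^sup>2) powi b)))) (at_right 0)"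
        by (intro tendsto_intros) (use True in auto)
      then have "((\<lambda>r. 2 * pi * (2 * pi * (B * (r powi a * sqrt (1 - r\<^sup>2) powi b)))) \<longlongrightarrow> 0) (at_right 0)"
        using True by simp
      moreover have "eventually (\<lambda>r::real. 0 < r \<and> r < 1) (at_right 0)"
        by (auto simp: eventually_at_right_field intro!: exI[of _ 1])
      then have "eventually (\<lambda>r. norm C \<le> 2 * pi * (2 * pi * (B * (r powi a * sqrt (1 - r\<^sup>2) powi b)))) (at_right 0)"
        by eventually_elim (use bd in auto)
      ultimately show ?thesis by (rule tendsto_lowerbound) simp
    next
      case False
      then have b: "b > 0" using that by simp
      have "((\<lambda>r. 2 * pi * (2 * pi * (B * (r powi a * sqrt (1 - r\<^sup>2) powi b)))) \<longlongrightarrow> 2 * pi * (2 * pi * (B * (1 powi a * sqrt (1 - 1\<^sup>2) powi b)))) (at_left 1)"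
        by (intro tendsto_intros) (use b in auto)
      then have "((\<lambda>r. 2 * pi * (2 * pi * (B * (r powi a * sqrt (1 - r\<^sup>2) powi b)))) \<longlongrightarrow> 0) (at_left 1)"
        using b by simp
      moreover have "eventually (\<lambda>r::real. 0 < r \<and> r < 1) (at_left 1)"
        by (auto simp: eventually_at_left_field intro!: exI[of _ 0])
      then have "eventually (\<lambda>r. norm C \<le> 2 * pi * (2 * pi * (B * (r powi a * sqrt (1 - r\<^sup>2) powi b)))) (at_left 1)"
        by eventually_elim (use bd in auto)
      ultimately show ?thesis by (rule tendsto_lowerbound) simp
    qed
    then show ?thesis by simp
  qed
  then show ?thesis using all by blast
qed

section \<open>Polynomial approximation on the sphere\<close>

lemma vp_mean_diff:
  assumes "continuous_on (sphere 0 1) f" "continuous_on (sphere 0 1) g"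
  shows "vp_mean N (\<lambda>u. f u - g u) = vp_mean N f - vp_mean N g"
  using continuous_on_vp_kernel[OF continuous_on_id, of "sphere 0 1" N] assms
  unfolding vp_mean_def left_diff_distrib
  by (subst circle_int_diff) (auto intro!: continuous_intros simp: diff_divide_distrib)

lemma vp_mean_norm_le:
  assumes g: "continuous_on (sphere 0 1) g" and B: "\<And>u. norm u = 1 \<Longrightarrow> norm (g u) \<le> B"
  shows "norm (vp_mean N g) \<le> B"
proof -
  obtain c where c: "c > 0" "circle_int (vp_kernel N) = of_real c" using vp_kernel_int_pos by blast
  define h where "h t = norm (1 + cis t) ^ (2 * N)" for t
  have hi: "h integrable_on {0..2*pi}" unfolding h_def by (intro integrable_continuous_real continuous_intros)
  have hc: "integral {0..2*pi} h = c"
  proof -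
    have "((\<lambda>t. of_real (h t) :: complex) has_integral of_real (integral {0..2*pi} h)) {0..2*pi}"
      by (intro has_integral_of_real integrable_integral hi)
    then have "of_real (integral {0..2*pi} h) = (of_real c :: complex)"
      unfolding c(2)[symmetric] circle_int_def vp_kernel_def h_def by (simp add: integral_unique)
    then show ?thesis by simp
  qed
  have K: "continuous_on (sphere 0 1) (vp_kernel N)" using continuous_on_vp_kernel[of _ "\<lambda>x. x"] by simp
  have "norm (circle_int (\<lambda>u. g u * vp_kernel N u)) \<le> integral {0..2*pi} (\<lambda>t. B * h t)"
    unfolding circle_int_def
  proof (rule integral_norm_bound_integral)
    show "(\<lambda>t. g (cis t) * vp_kernel N (cis t)) integrable_on {0..2*pi}"
      by (rule circle_int_integrable) (intro continuous_intros g K)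
    show "(\<lambda>t. B * h t) integrable_on {0..2*pi}" by (intro integrable_on_mult_right hi)
    show "norm (g (cis t) * vp_kernel N (cis t)) \<le> B * h t" for t
      using B[of "cis t"] by (simp add: norm_mult vp_kernel_def h_def norm_power mult_right_mono)
  qed
  also have "\<dots> = B * c" by (simp add: hc)
  finally show ?thesis using c by (simp add: vp_mean_def norm_divide divide_le_eq)
qed

text \<open>
  The mean of \<open>F\<close> over torus orbits against the product kernel is uniformly close to \<open>F\<close>.  Expanding
  the kernel expresses it through the coefficients \<open>torus_coeff F a b\<close>, and by \<open>torus_coeff_structure\<close> only
  nonnegative powers of \<open>z\<close> and \<open>w\<close>, with constant coefficients, remain.  This covers the points with
  \<open>z \<noteq> 0\<close> and \<open>w \<noteq> 0\<close>; the remaining points are limits of such points.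
\<close>

theorem sphere_polynomial_approx:
  assumes F: "continuous_on (sphere 0 1) F" and ext: "\<And>x. norm x < 1 \<Longrightarrow> pencil_ext F x"
    and e: "\<epsilon> > 0"
  shows "\<exists>c N. \<forall>z w. (z, w) \<in> sphere 0 1 \<longrightarrow> norm (F (z, w) - (\<Sum>i\<le>(N::nat). \<Sum>j\<le>N. c i j * (z ^ i * w ^ j))) \<le> \<epsilon>"
proof -
  obtain B where B: "B > 0" "\<And>x. x \<in> sphere 0 1 \<Longrightarrow> norm (F x) \<le> B"
    using compact_imp_bounded[OF compact_continuous_image[OF F compact_sphere]]
    unfolding bounded_pos by auto
  have "uniformly_continuous_on (sphere 0 1) F"
    using F by (intro compact_uniformly_continuous) auto
  then obtain d where d: "d > 0" "\<And>x y. x \<in> sphere 0 1 \<Longrightarrow> y \<in> sphere 0 1 \<Longrightarrow> dist x y < d \<Longrightarrow> dist (F x) (F y) < \<epsilon>/4"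
    unfolding uniformly_continuous_on_def using e by (metis zero_less_divide_iff zero_less_numeral)
  obtain N where N: "\<And>g::complex \<Rightarrow> complex. continuous_on (sphere 0 1) g \<Longrightarrow> (\<And>u. norm u = 1 \<Longrightarrow> norm (g u) \<le> B) \<Longrightarrow>
            (\<And>u. norm u = 1 \<Longrightarrow> norm (u - 1) < d \<Longrightarrow> norm (g u - g 1) \<le> \<epsilon>/4) \<Longrightarrow>
            norm (vp_mean N g - g 1) \<le> 2 * (\<epsilon>/4)"
    using vp_mean_approx[of "\<epsilon>/4" d B] e d B by auto
  have K: "continuous_on A (vp_kernel N)" for A using continuous_on_vp_kernel[of _ "\<lambda>x. x"] by simp
  define M where "M z w = vp_mean N (\<lambda>u. vp_mean N (\<lambda>v. F (u * z, v * w)))" for z w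
  have approx: "norm (M z w - F (z, w)) \<le> \<epsilon>" if zw: "(z, w) \<in> sphere 0 1" for z w
  proof -
    have n1: "norm z \<le> 1" "norm w \<le> 1" using zw norm_fst_le[of z w] norm_snd_le[of w z] by simp_all
    have Fc: "continuous_on (sphere 0 1 \<times> sphere 0 1) (\<lambda>(u, v). F (u * z, v * w))"
      unfolding split_beta
      by (rule continuous_on_compose2[OF F]) (use rotated_in_sphere[OF zw] in \<open>auto intro!: continuous_intros\<close>)
    have Fc1: "continuous_on (sphere 0 1) (\<lambda>v. F (u * z, v * w))" if "norm u = 1" for u
      using continuous_on_slice[OF Fc] that by simp
    have Fc2: "continuous_on (sphere 0 1) (\<lambda>u. F (u * z, w))"
      by (rule continuous_on_compose2[OF F]) (use rotated_in_sphere[OF zw, of _ 1] in \<open>auto intro!: continuous_intros\<close>)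
    have Mc: "continuous_on (sphere 0 1) (\<lambda>u. vp_mean N (\<lambda>v. F (u * z, v * w)))"
      unfolding vp_mean_def divide_inverse
      by (rule continuous_on_mult_right, rule continuous_on_circle_int)
         (use Fc in \<open>unfold split_beta, intro continuous_intros K\<close>)
    have 1: "norm (vp_mean N (\<lambda>v. F (u * z, v * w)) - F (u * z, w)) \<le> 2 * (\<epsilon>/4)" if u: "norm u = 1" for u
    proof -
      have "norm (vp_mean N (\<lambda>v. F (u * z, v * w)) - F (u * z, 1 * w)) \<le> 2 * (\<epsilon>/4)"
      proof (rule N[OF Fc1[OF u]])
        show "norm (F (u * z, v * w)) \<le> B" if "norm v = 1" for v by (intro B rotated_in_sphere zw u that)
        show "norm (F (u * z, v * w) - F (u * z, 1 * w)) \<le> \<epsilon>/4" if v: "norm v = 1" "norm (v - 1) < d" for v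
        proof -
          have "dist (u * z, v * w) (u * z, 1 * w) = norm (v - 1) * norm w"
            by (simp add: dist_prod_def dist_norm left_diff_distrib flip: norm_mult)
          also have "\<dots> \<le> norm (v - 1) * 1" using n1 by (intro mult_left_mono) auto
          finally have "dist (u * z, v * w) (u * z, 1 * w) < d" using v by simp
          then show ?thesis
            using d(2)[OF rotated_in_sphere[OF zw u v(1)] rotated_in_sphere[OF zw u, of 1]] by (simp add: dist_norm)
        qed
      qed
      then show ?thesis by simp
    qed
    have 2: "norm (vp_mean N (\<lambda>u. F (u * z, w)) - F (z, w)) \<le> 2 * (\<epsilon>/4)"
    proof -
      have "norm (vp_mean N (\<lambda>u. F (u * z, w)) - F (1 * z, w)) \<le> 2 * (\<epsilon>/4)"
      proof (rule N[OF Fc2])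
        show "norm (F (u * z, w)) \<le> B" if "norm u = 1" for u using B(2)[OF rotated_in_sphere[OF zw that, of 1]] by simp
        show "norm (F (u * z, w) - F (1 * z, w)) \<le> \<epsilon>/4" if v: "norm u = 1" "norm (u - 1) < d" for u
        proof -
          have "dist (u * z, 1 * w) (1 * z, 1 * w) = norm (u - 1) * norm z"
            by (simp add: dist_prod_def dist_norm left_diff_distrib flip: norm_mult)
          also have "\<dots> \<le> norm (u - 1) * 1" using n1 by (intro mult_left_mono) auto
          finally have "dist (u * z, 1 * w) (1 * z, 1 * w) < d" using v by simp
          then show ?thesis
            using d(2)[OF rotated_in_sphere[OF zw v(1), of 1] rotated_in_sphere[OF zw, of 1 1]] by (simp add: dist_norm)
        qed
      qed
      then show ?thesis by simp
    qed
    have "norm (M z w - vp_mean N (\<lambda>u. F (u * z, w))) \<le> 2 * (\<epsilon>/4)"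
      unfolding M_def vp_mean_diff[OF Mc Fc2, symmetric]
      by (rule vp_mean_norm_le) (use 1 in \<open>auto intro!: continuous_intros Mc Fc2\<close>)
    then show ?thesis using 2 norm_triangle_ineq[of "M z w - vp_mean N (\<lambda>u. F (u * z, w))" "vp_mean N (\<lambda>u. F (u * z, w)) - F (z, w)"] by simp
  qed
  obtain C where C: "\<And>a b z w. (z, w) \<in> sphere 0 1 \<Longrightarrow> z \<noteq> 0 \<Longrightarrow> w \<noteq> 0 \<Longrightarrow> torus_coeff F a b z w = C a b"
    "\<And>a b. a > 0 \<or> b > 0 \<Longrightarrow> C a b = 0"
    using torus_coeff_structure[OF F ext] by metis
  define k where "k = circle_int (vp_kernel N)"
  define bn where "bn j = complex_of_nat (2 * N choose (N - j))" for j
  \<comment> \<open>Weights with exponents \<open>- i\<close>, \<open>- j\<close> pick out the coefficient of \<open>z ^ i * w ^ j\<close>.\<close>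
  define c where "c i j = bn i * bn j * C (- int i) (- int j) / k\<^sup>2" for i j
  define P where "P z w = (\<Sum>i\<le>N. \<Sum>j\<le>N. c i j * (z ^ i * w ^ j))" for z w
  have poly: "M z w = P z w" if zw: "(z, w) \<in> sphere 0 1" "z \<noteq> 0" "w \<noteq> 0" for z w
  proof -
    have Fc: "continuous_on (sphere 0 1 \<times> sphere 0 1) (\<lambda>p. F (fst p * z, snd p * w))"
      by (rule continuous_on_compose2[OF F]) (use rotated_in_sphere[OF zw(1)] in \<open>auto intro!: continuous_intros\<close>)
    have Fcs: "continuous_on (sphere 0 1) (\<lambda>v. F (u * z, v * w))" if "norm u = 1" for u
      using continuous_on_slice[of "sphere 0 1" "sphere 0 1" "\<lambda>u v. F (u * z, v * w)" u] Fc that by (simp add: split_beta)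
    define J where "J i j = circle_int (\<lambda>u. circle_int (\<lambda>v. F (u * z, v * w) * ((u ^ i * cnj u ^ N) * (v ^ j * cnj v ^ N))))" for i j
    \<comment> \<open>The Fourier mode \<open>u ^ i * cnj u ^ N\<close> is \<open>u powi (i - N)\<close>; the factors \<open>z powi (- a)\<close> and \<open>w powi (- b)\<close>
      restore the weight of \<open>torus_coeff\<close>.\<close>
    have Jv: "J i j = (if i \<le> N \<and> j \<le> N then C (- int (N - i)) (- int (N - j)) * (z ^ (N - i) * w ^ (N - j)) else 0)" for i j
    proof -
      define a where "a = int i - int N"
      define b where "b = int j - int N"
      have pw: "u ^ i * cnj u ^ N = u powi (int i - int N)" if "norm u = 1" for u and i :: nat
      proof -
        have u0: "u \<noteq> 0" using that by auto
        have "cnj u = inverse u" using that complex_norm_square[of u] by (simp add: inverse_eq_divide nonzero_eq_divide_eq u0 mult.commute)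
        then have "u ^ i * cnj u ^ N = u powi int i / u powi int N" by (simp add: power_inverse divide_inverse)
        then show ?thesis using u0 by (simp add: power_int_diff)
      qed
      have "J i j = circle_int (\<lambda>u. circle_int (\<lambda>v. (z powi (-a) * w powi (-b)) * (F (u * z, v * w) * ((u * z) powi a * (v * w) powi b))))"
        unfolding J_def
      proof (intro circle_int_cong)
        fix u v :: complex assume uv: "norm u = 1" "norm v = 1"
        have regroup: "z' * w' * (F' * ((u' * zp) * (v' * wp))) = (z' * zp) * (w' * wp) * (F' * (u' * v'))"
          for z' w' F' u' v' zp wp :: complex by (simp add: mult_ac)
        have inv: "z powi (-a) * z powi a = 1" "w powi (-b) * w powi b = 1" using zw by (simp_all add: power_int_minus)
        then show "F (u * z, v * w) * (u ^ i * cnj u ^ N * (v ^ j * cnj v ^ N)) =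
           z powi (-a) * w powi (-b) * (F (u * z, v * w) * ((u * z) powi a * (v * w) powi b))"
          unfolding pw[OF uv(1)] pw[OF uv(2)] a_def[symmetric] b_def[symmetric] power_int_mult_distrib
          unfolding regroup by (simp only: inv mult_1_left)
      qed
      also have "\<dots> = z powi (-a) * w powi (-b) * torus_coeff F a b z w"
        by (simp only: circle_int_cmult torus_coeff_def)
      also have "\<dots> = z powi (-a) * w powi (-b) * C a b" by (simp only: C(1)[OF zw])
      finally have Jab: "J i j = z powi (-a) * w powi (-b) * C a b" .
      show ?thesis
      proof (cases "i \<le> N \<and> j \<le> N")
        case True
        then have "-a = int (N - i)" "-b = int (N - j)" by (auto simp: a_def b_def)
        moreover from this have "a = - int (N - i)" "b = - int (N - j)" by linarith+
        ultimately have "J i j = z powi int (N - i) * w powi int (N - j) * C (- int (N - i)) (- int (N - j))"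
          using Jab by metis
        then have "J i j = C (- int (N - i)) (- int (N - j)) * (z ^ (N - i) * w ^ (N - j))"
          unfolding power_int_of_nat by (simp only: mult_ac)
        then show ?thesis using True by (simp only: simp_thms if_True)
      next
        case False
        then have "a > 0 \<or> b > 0" by (auto simp: a_def b_def)
        then have "C a b = 0" by (rule C(2))
        then show ?thesis unfolding Jab if_not_P[OF False] by simp
      qed
    qed
    have in1: "circle_int (\<lambda>v. F (u * z, v * w) * vp_kernel N v) = (\<Sum>j\<le>2*N. of_nat (2*N choose j) * circle_int (\<lambda>v. F (u * z, v * w) * (v ^ j * cnj v ^ N)))"
      if "norm u = 1" for u by (rule circle_int_vp_expand[OF Fcs[OF that]])
    have inc: "continuous_on (sphere 0 1) (\<lambda>u. circle_int (\<lambda>v. F (u * z, v * w) * (v ^ j * cnj v ^ N)))" for j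
      by (rule continuous_on_circle_int) (unfold split_beta, intro continuous_intros Fc)
    have "k\<^sup>2 * M z w = circle_int (\<lambda>u. circle_int (\<lambda>v. F (u * z, v * w) * vp_kernel N v) * vp_kernel N u)"
    proof -
      have k0: "k \<noteq> 0" using vp_kernel_int_pos[of N] by (auto simp: k_def)
      have "M z w = circle_int (\<lambda>u. circle_int (\<lambda>v. F (u * z, v * w) * vp_kernel N v) * vp_kernel N u * (1 / k)) / k"
        unfolding M_def vp_mean_def k_def[symmetric] by simp
      then show ?thesis using k0 unfolding circle_int_multc by (simp add: power2_eq_square)
    qed
    also have "\<dots> = circle_int (\<lambda>u. (\<Sum>j\<le>2*N. of_nat (2*N choose j) * circle_int (\<lambda>v. F (u * z, v * w) * (v ^ j * cnj v ^ N))) * vp_kernel N u)"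
      by (rule circle_int_cong) (simp only: in1)
    also have "\<dots> = (\<Sum>i\<le>2*N. of_nat (2*N choose i) * circle_int (\<lambda>u. (\<Sum>j\<le>2*N. of_nat (2*N choose j) * circle_int (\<lambda>v. F (u * z, v * w) * (v ^ j * cnj v ^ N))) * (u ^ i * cnj u ^ N)))"
      by (rule circle_int_vp_expand) (intro continuous_intros inc)
    also have "\<dots> = (\<Sum>i\<le>2*N. \<Sum>j\<le>2*N. of_nat (2*N choose i) * of_nat (2*N choose j) * J i j)"
    proof (rule sum.cong[OF refl])
      fix i
      have "circle_int (\<lambda>u. (\<Sum>j\<le>2*N. of_nat (2*N choose j) * circle_int (\<lambda>v. F (u * z, v * w) * (v ^ j * cnj v ^ N))) * (u ^ i * cnj u ^ N))
         = circle_int (\<lambda>u. \<Sum>j\<le>2*N. of_nat (2*N choose j) * (circle_int (\<lambda>v. F (u * z, v * w) * (v ^ j * cnj v ^ N)) * (u ^ i * cnj u ^ N)))"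
        by (simp only: sum_distrib_right mult.assoc)
      also have "\<dots> = (\<Sum>j\<le>2*N. circle_int (\<lambda>u. of_nat (2*N choose j) * (circle_int (\<lambda>v. F (u * z, v * w) * (v ^ j * cnj v ^ N)) * (u ^ i * cnj u ^ N))))"
        by (rule circle_int_sum) (auto intro!: continuous_intros inc)
      also have "\<dots> = (\<Sum>j\<le>2*N. of_nat (2*N choose j) * J i j)"
        unfolding J_def circle_int_cmult circle_int_multc[symmetric]
        by (simp only: mult_ac)
      finally show "of_nat (2*N choose i) * circle_int (\<lambda>u. (\<Sum>j\<le>2*N. of_nat (2*N choose j) * circle_int (\<lambda>v. F (u * z, v * w) * (v ^ j * cnj v ^ N))) * (u ^ i * cnj u ^ N))
         = (\<Sum>j\<le>2*N. of_nat (2*N choose i) * of_nat (2*N choose j) * J i j)"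
        by (simp only: sum_distrib_left mult.assoc)
    qed
    also have "\<dots> = (\<Sum>i\<le>N. \<Sum>j\<le>N. of_nat (2*N choose i) * of_nat (2*N choose j) * J i j)"
    proof -
      have "(\<Sum>j\<le>2*N. of_nat (2*N choose i) * of_nat (2*N choose j) * J i j) = (\<Sum>j\<le>N. of_nat (2*N choose i) * of_nat (2*N choose j) * J i j)" for i
        by (rule sum.mono_neutral_right) (auto simp: Jv)
      moreover have "(\<Sum>i\<le>2*N. \<Sum>j\<le>N. of_nat (2*N choose i) * of_nat (2*N choose j) * J i j) = (\<Sum>i\<le>N. \<Sum>j\<le>N. of_nat (2*N choose i) * of_nat (2*N choose j) * J i j)"
        by (rule sum.mono_neutral_right) (auto simp: Jv)
      ultimately show ?thesis by (simp only:)
    qed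
    also have "\<dots> = (\<Sum>i\<le>N. \<Sum>j\<le>N. k\<^sup>2 * (c (N - i) (N - j) * (z ^ (N - i) * w ^ (N - j))))"
    proof (intro sum.cong refl)
      fix i j assume "i \<in> {..N}" "j \<in> {..N}"
      moreover have "k \<noteq> 0" using vp_kernel_int_pos[of N] by (auto simp: k_def)
      ultimately show "of_nat (2*N choose i) * of_nat (2*N choose j) * J i j = k\<^sup>2 * (c (N - i) (N - j) * (z ^ (N - i) * w ^ (N - j)))"
        by (simp add: Jv c_def bn_def)
    qed
    also have "\<dots> = (\<Sum>i\<le>N. \<Sum>j\<le>N. k\<^sup>2 * (c (N - i) j * (z ^ (N - i) * w ^ j)))"
      by (rule sum.cong[OF refl], rule sum.reindex_bij_witness[of _ "\<lambda>j. N - j" "\<lambda>j. N - j"]) auto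
    also have "\<dots> = (\<Sum>i\<le>N. \<Sum>j\<le>N. k\<^sup>2 * (c i j * (z ^ i * w ^ j)))"
      by (rule sum.reindex_bij_witness[of _ "\<lambda>j. N - j" "\<lambda>j. N - j"]) auto
    also have "\<dots> = k\<^sup>2 * P z w" by (simp only: P_def sum_distrib_left)
    finally show ?thesis using vp_kernel_int_pos[of N] by (auto simp: k_def)
  qed
  have Pc: "continuous_on A (\<lambda>x. P (fst x) (snd x))" for A unfolding P_def by (intro continuous_intros)
  define h where "h x = norm (F x - P (fst x) (snd x))" for x
  have hc: "continuous_on (sphere 0 1) h" unfolding h_def by (intro continuous_intros F Pc)
  have hle: "h (z, w) \<le> \<epsilon>" if "(z, w) \<in> sphere 0 1" "z \<noteq> 0" "w \<noteq> 0" for z w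
    using approx[OF that(1)] poly[OF that] by (simp add: h_def norm_minus_commute)
  \<comment> \<open>A point on a coordinate axis is approached along a curve on which both coordinates are nonzero.\<close>
  have path: "h (\<gamma> 0) \<le> \<epsilon>" if g: "continuous_on {0..1/2} \<gamma>" "\<And>s. s \<in> {0..1/2::real} \<Longrightarrow> \<gamma> s \<in> sphere 0 1"
      "\<And>s. s \<in> {0<..1/2} \<Longrightarrow> fst (\<gamma> s) \<noteq> 0 \<and> snd (\<gamma> s) \<noteq> 0" for \<gamma>
  proof -
    have "continuous_on {0..1/2} (\<lambda>s. h (\<gamma> s))"
      by (rule continuous_on_compose2[OF hc g(1)]) (use g(2) in auto)
    then have "continuous_on (closure {0<..<1/2}) (\<lambda>s. h (\<gamma> s))" by simp
    then show ?thesis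
    proof (rule continuous_le_on_closure)
      show "0 \<in> closure {0<..<1/2::real}" by simp
      show "h (\<gamma> s) \<le> \<epsilon>" if "s \<in> {0<..<1/2}" for s
        using hle[of "fst (\<gamma> s)" "snd (\<gamma> s)"] g(2)[of s] g(3)[of s] that by simp
    qed
  qed
  have sq: "sqrt (1 - s\<^sup>2) \<noteq> 0" "(sqrt (1 - s\<^sup>2))\<^sup>2 = 1 - s\<^sup>2" if "s \<in> {0..1/2}" for s :: real
  proof -
    have "s\<^sup>2 \<le> (1/2)\<^sup>2" using that by (intro power_mono) auto
    then have "1 - s\<^sup>2 > 0" by (simp add: power2_eq_square)
    then show "sqrt (1 - s\<^sup>2) \<noteq> 0" "(sqrt (1 - s\<^sup>2))\<^sup>2 = 1 - s\<^sup>2" by simp_all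
  qed
  have "h (z, w) \<le> \<epsilon>" if zw: "(z, w) \<in> sphere 0 1" for z w
  proof -
    have n: "(norm z)\<^sup>2 + (norm w)\<^sup>2 = 1" using zw by (simp add: norm_prod_def)
    consider "z = 0" | "w = 0" | "z \<noteq> 0" "w \<noteq> 0" by blast
    then show ?thesis
    proof cases
      case 1
      then have w: "norm w = 1" using n by (simp add: abs_square_eq_1)
      have "h ((\<lambda>s. (complex_of_real s, complex_of_real (sqrt (1 - s\<^sup>2)) * w)) 0) \<le> \<epsilon>"
        by (rule path) (use w sq in \<open>auto intro!: continuous_intros simp: norm_prod_def norm_mult\<close>)
      then show ?thesis using 1 by simp
    next
      case 2
      then have z: "norm z = 1" using n by (simp add: abs_square_eq_1)
      have "h ((\<lambda>s. (complex_of_real (sqrt (1 - s\<^sup>2)) * z, complex_of_real s)) 0) \<le> \<epsilon>"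
        by (rule path) (use z sq in \<open>auto intro!: continuous_intros simp: norm_prod_def norm_mult\<close>)
      then show ?thesis using 2 by simp
    next
      case 3
      then show ?thesis using hle[OF zw] by simp
    qed
  qed
  then show ?thesis unfolding h_def P_def by auto
qed

section \<open>From the sphere to the ball\<close>

definition to_pair :: "complex ^ 2 \<Rightarrow> complex \<times> complex" where
  "to_pair x = (x $ 1, x $ 2)"

lemma norm_to_pair [simp]: "norm (to_pair x) = norm x"
  by (simp add: to_pair_def norm_prod_def norm_vec_def L2_set_def sum_2)

lemma norm_scalar_vec: "norm (t *s x) = norm t * norm (x :: complex ^ 2)"
proof -
  have sq: "(norm y)\<^sup>2 = (norm (y $ 1))\<^sup>2 + (norm (y $ 2))\<^sup>2" for y :: "complex ^ 2"
    using norm_pair_sq[of "to_pair y"] unfolding norm_to_pair by (simp add: to_pair_def)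
  have "(norm (t *s x))\<^sup>2 = (norm t * norm x)\<^sup>2"
    unfolding power_mult_distrib sq by (simp add: power_mult_distrib norm_mult distrib_left)
  then show ?thesis by (simp add: power2_eq_iff_nonneg)
qed

text \<open>
  The derivative is carried along because the limit argument needs estimates for it.
\<close>

definition entire_with :: "(complex ^ 2 \<Rightarrow> complex) \<Rightarrow> (complex ^ 2 \<Rightarrow> complex ^ 2 \<Rightarrow> complex) \<Rightarrow> bool" where
  "entire_with p D \<longleftrightarrow> (\<forall>x. (p has_derivative D x) (at x) \<and> (\<forall>c v. D x (c *s v) = c * D x v))"

lemma entire_with_diff:
  assumes "entire_with p D" "entire_with q E"
  shows "entire_with (\<lambda>x. p x - q x) (\<lambda>x h. D x h - E x h)"
  using assms unfolding entire_with_def by (auto intro!: has_derivative_diff simp: right_diff_distrib)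

lemma entire_with_line:
  assumes "entire_with p D"
  shows "((\<lambda>t. p (x + t *s v)) has_field_derivative D (x + t *s v) v) (at t)"
proof -
  have 1: "((\<lambda>t. x + t *s v) has_derivative (\<lambda>t. t *s v)) (at t)"
  proof -
    have "linear (\<lambda>t::complex. t *s v)"
      by (rule linearI) (simp_all add: vec_eq_iff distrib_right)
    then have "((\<lambda>t. t *s v) has_derivative (\<lambda>t. t *s v)) (at t)"
      by (rule linear_imp_has_derivative)
    then show ?thesis by (auto intro!: derivative_eq_intros)
  qed
  have 2: "(p has_derivative D (x + t *s v)) (at (x + t *s v))"
    using assms by (simp add: entire_with_def)
  have "((\<lambda>t. p (x + t *s v)) has_derivative (\<lambda>s. D (x + t *s v) (s *s v))) (at t)"
    using has_derivative_compose[OF 1 2] .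
  moreover have "(\<lambda>s. D (x + t *s v) (s *s v)) = (*) (D (x + t *s v) v)"
    using assms by (simp add: entire_with_def fun_eq_iff mult.commute)
  ultimately show ?thesis by (simp add: has_field_derivative_def)
qed

lemma entire_with_line_holomorphic: "entire_with p D \<Longrightarrow> (\<lambda>t. p (x + t *s v)) holomorphic_on S"
  using entire_with_line unfolding holomorphic_on_def field_differentiable_def by (blast intro: has_field_derivative_at_within)

text \<open>
  The maximum principle in one variable, on the disc through \<open>x\<close> and the origin.
\<close>

lemma entire_maximum_principle:
  assumes p: "entire_with p D" and B: "\<And>y. norm y = 1 \<Longrightarrow> norm (p y) \<le> B" and x: "norm x \<le> 1"
  shows "norm (p x) \<le> B"
proof -
  obtain v where v: "norm v = 1" "x = of_real (norm x) *s v"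
  proof (cases "x = 0")
    case True
    obtain v :: "complex ^ 2" where "norm v = 1" using vector_choose_size[of 1] by auto
    then show ?thesis using that True by (simp add: vec_eq_iff)
  next
    case False
    have "norm (of_real (inverse (norm x)) *s x) = 1" using False by (simp add: norm_scalar_vec norm_inverse)
    moreover have "x = of_real (norm x) *s (of_real (inverse (norm x)) *s x)"
      using False by (simp add: vec_eq_iff of_real_inverse)
    ultimately show ?thesis using that by blast
  qed
  have "norm (p (0 + of_real (norm x) *s v)) \<le> B"
  proof (rule maximum_modulus_frontier[where S = "cball 0 1" and f = "\<lambda>t. p (0 + t *s v)"])
    show "(\<lambda>t. p (0 + t *s v)) holomorphic_on interior (cball 0 1)"
      by (rule entire_with_line_holomorphic[OF p])
    show "continuous_on (closure (cball 0 1)) (\<lambda>t. p (0 + t *s v))"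
      by (rule holomorphic_on_imp_continuous_on[OF entire_with_line_holomorphic[OF p]])
    show "norm (p (0 + t *s v)) \<le> B" if "t \<in> frontier (cball 0 1)" for t
      by (rule B) (use that v(1) in \<open>simp add: norm_scalar_vec\<close>)
  qed (use x in auto)
  then show ?thesis using v(2) by simp
qed

text \<open>
  Cauchy's inequality on the disc around \<open>x\<close> in direction \<open>h\<close> that stays in the ball.
\<close>

lemma entire_Cauchy_estimate:
  assumes p: "entire_with p D" and B: "\<And>y. norm y \<le> 1 \<Longrightarrow> norm (p y) \<le> B" and x: "norm x \<le> \<rho>" "\<rho> < 1"
  shows "norm (D x h) \<le> B * norm h / (1 - \<rho>)"
proof (cases "h = 0")
  case True
  have "D x (0 *s h) = 0 * D x h" using p unfolding entire_with_def by blast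
  then show ?thesis using True by simp
next
  case False
  define r where "r = (1 - \<rho>) / norm h"
  have r: "r > 0" using x False by (simp add: r_def)
  have "norm ((deriv ^^ 1) (\<lambda>t. p (x + t *s h)) 0) \<le> fact 1 * B / r ^ 1"
  proof (rule Cauchy_inequality)
    show "(\<lambda>t. p (x + t *s h)) holomorphic_on ball 0 r"
      by (rule entire_with_line_holomorphic[OF p])
    show "continuous_on (cball 0 r) (\<lambda>t. p (x + t *s h))"
      by (rule holomorphic_on_imp_continuous_on[OF entire_with_line_holomorphic[OF p]])
    show "norm (p (x + t *s h)) \<le> B" if "norm (0 - t) = r" for t
    proof (rule B)
      have "norm (x + t *s h) \<le> norm x + norm (t *s h)" by (rule norm_triangle_ineq)
      also have "norm (t *s h) = 1 - \<rho>" using that False by (simp add: norm_scalar_vec r_def)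
      finally show "norm (x + t *s h) \<le> 1" using x by simp
    qed
  qed (rule r)
  moreover have "deriv (\<lambda>t. p (x + t *s h)) 0 = D x h"
    using DERIV_imp_deriv[OF entire_with_line[OF p, of x h 0]] by simp
  ultimately show ?thesis by (simp add: r_def)
qed

lemma entire_with_monomial:
  "\<exists>D. entire_with (\<lambda>x. k * ((x $ 1) ^ i * (x $ 2) ^ j)) D"
proof -
  have d: "((\<lambda>x :: complex ^ 2. x $ l) has_derivative (\<lambda>h. h $ l)) (at x)" for l x
    by (rule bounded_linear_imp_has_derivative) (rule bounded_linear_vec_nth)
  have "entire_with (\<lambda>x. k * ((x $ 1) ^ i * (x $ 2) ^ j))
    (\<lambda>x h. k * ((x $ 1) ^ i * (of_nat j * h $ 2 * (x $ 2) ^ (j - 1)) + of_nat i * h $ 1 * (x $ 1) ^ (i - 1) * (x $ 2) ^ j))"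
    unfolding entire_with_def
  proof (intro allI conjI)
    fix x :: "complex ^ 2"
    show "((\<lambda>x. k * ((x $ 1) ^ i * (x $ 2) ^ j)) has_derivative
       (\<lambda>h. k * ((x $ 1) ^ i * (of_nat j * h $ 2 * (x $ 2) ^ (j - 1)) + of_nat i * h $ 1 * (x $ 1) ^ (i - 1) * (x $ 2) ^ j))) (at x)"
      by (intro has_derivative_mult_right has_derivative_mult has_derivative_power d)
  qed (simp add: algebra_simps)
  then show ?thesis by blast
qed

lemma entire_with_sum:
  assumes "finite I" "\<And>i. i \<in> I \<Longrightarrow> \<exists>D. entire_with (p i) D"
  shows "\<exists>D. entire_with (\<lambda>x. \<Sum>i\<in>I. p i x) D"
proof -
  obtain D where D: "\<And>i. i \<in> I \<Longrightarrow> entire_with (p i) (D i)" using assms(2) by metis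
  have "entire_with (\<lambda>x. \<Sum>i\<in>I. p i x) (\<lambda>x h. \<Sum>i\<in>I. D i x h)"
    using D unfolding entire_with_def by (auto intro!: has_derivative_sum simp: sum_distrib_left)
  then show ?thesis by blast
qed

text \<open>
  By the maximum principle the sequence is uniformly Cauchy on the closed ball, and by the Cauchy
  estimates its derivatives are uniformly Cauchy on smaller balls.  The limit of the derivatives is
  complex-linear and is the derivative of the limit.
\<close>

theorem sphere_limit_extends:
  assumes p: "\<And>n. entire_with (p n) (D n)" and e: "e \<longlonglongrightarrow> 0"
    and close: "\<And>n x. norm x = 1 \<Longrightarrow> norm (f x - p n x) \<le> e n"
  shows "extends_holomorphically_through_ball f"
proof -
  have diff: "norm (p n x - p m x) \<le> e n + e m" if "norm x \<le> 1" for n m x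
  proof (rule entire_maximum_principle[OF entire_with_diff[OF p p] _ that])
    show "norm (p n y - p m y) \<le> e n + e m" if "norm y = 1" for y
      using norm_triangle_ineq4[of "f y - p m y" "f y - p n y"] close[OF that, of n] close[OF that, of m] by simp
  qed
  have small: "\<exists>N. \<forall>n\<ge>N. e n < \<delta>" if "\<delta> > 0" for \<delta>
    using order_tendstoD(2)[OF e that] by (simp add: eventually_sequentially)
  have "uniformly_Cauchy_on (cball 0 1) p"
  proof (rule uniformly_Cauchy_onI)
    fix \<delta> :: real assume "\<delta> > 0"
    then obtain N where N: "\<And>n. n \<ge> N \<Longrightarrow> e n < \<delta> / 2" using small[of "\<delta> / 2"] by auto
    have "dist (p m x) (p n x) < \<delta>" if "x \<in> cball 0 1" "m \<ge> N" "n \<ge> N" for x m n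
      using diff[of x m n] N[of n] N[of m] that by (simp add: dist_norm)
    then show "\<exists>M. \<forall>x\<in>cball 0 1. \<forall>m\<ge>M. \<forall>n\<ge>M. dist (p m x) (p n x) < \<delta>" by blast
  qed
  then obtain G where G: "uniform_limit (cball 0 1) p G sequentially"
    using Cauchy_uniformly_convergent uniformly_convergent_on_def by blast
  have lim: "(\<lambda>n. p n x) \<longlonglongrightarrow> G x" if "norm x \<le> 1" for x
    using tendsto_uniform_limitI[OF G, of x] that by simp
  have cont: "continuous_on (cball 0 1) G"
  proof (rule uniform_limit_theorem[OF _ G])
    have "continuous_on (cball 0 1) (p n)" for n
      using p[of n] unfolding entire_with_def
      by (intro continuous_at_imp_continuous_on ballI) (blast intro: has_derivative_continuous)
    then show "\<forall>\<^sub>F n in sequentially. continuous_on (cball 0 1) (p n)" by simp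
  qed simp
  have bdry: "G x = f x" if "norm x = 1" for x
  proof -
    have "(\<lambda>n. f x - p n x) \<longlonglongrightarrow> 0"
      by (rule Lim_null_comparison[OF _ e]) (simp add: close[OF that])
    then have "(\<lambda>n. f x - (f x - p n x)) \<longlonglongrightarrow> f x - 0" by (intro tendsto_intros)
    then show ?thesis using lim[of x] that LIMSEQ_unique by force
  qed
  have "\<exists>A. (G has_derivative A) (at x) \<and> (\<forall>c v. A (c *s v) = c * A v)" if x: "norm x < 1" for x
  proof -
    \<comment> \<open>On \<open>ball 0 \<rho>\<close> the Cauchy estimates are uniform, as \<open>1 - \<rho> > 0\<close>.\<close>
    define \<rho> where "\<rho> = (norm x + 1) / 2"
    have \<rho>: "norm x < \<rho>" "\<rho> < 1" using x by (simp_all add: \<rho>_def)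
    have Dd: "norm (D n y h - D m y h) \<le> (e n + e m) * norm h / (1 - \<rho>)" if "norm y \<le> \<rho>" for n m y h
      by (rule entire_Cauchy_estimate[OF entire_with_diff[OF p p] diff that \<rho>(2)])
    define A where "A y h = lim (\<lambda>n. D n y h)" for y h
    have Dlim: "(\<lambda>n. D n y h) \<longlonglongrightarrow> A y h" if y: "norm y \<le> \<rho>" for y h
    proof -
      have "Cauchy (\<lambda>n. D n y h)"
        unfolding Cauchy_def
      proof (intro allI impI)
        fix \<delta> :: real assume "\<delta> > 0"
        define \<eta> where "\<eta> = \<delta> * (1 - \<rho>) / (2 * (norm h + 1))"
        have "\<eta> > 0" using \<open>\<delta> > 0\<close> \<rho>(2) by (simp add: \<eta>_def add_nonneg_pos)
        then obtain N where N: "\<And>n. n \<ge> N \<Longrightarrow> e n < \<eta>" using small[of \<eta>] by auto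
        have "dist (D m y h) (D n y h) < \<delta>" if "m \<ge> N" "n \<ge> N" for m n
        proof -
          have "dist (D m y h) (D n y h) \<le> (e m + e n) * norm h / (1 - \<rho>)"
            using Dd[OF y] by (simp add: dist_norm)
          also have "\<dots> \<le> (2 * \<eta>) * norm h / (1 - \<rho>)"
            using N[OF that(1)] N[OF that(2)] \<rho>(2) by (intro divide_right_mono mult_right_mono) auto
          also have "\<dots> < (2 * \<eta>) * (norm h + 1) / (1 - \<rho>)"
            using \<open>\<eta> > 0\<close> \<rho>(2) by (intro divide_strict_right_mono mult_strict_left_mono) auto
          also have "\<dots> = \<delta>"
          proof -
            have "norm h + 1 \<noteq> 0" "1 - \<rho> \<noteq> 0" using \<rho>(2) norm_ge_zero[of h] by linarith+
            moreover have "2 * (\<delta> * R / (2 * K)) * K / R = \<delta>" if "K \<noteq> 0" "R \<noteq> 0" for K R :: real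
              using that by simp
            ultimately show ?thesis unfolding \<eta>_def by blast
          qed
          finally show ?thesis .
        qed
        then show "\<exists>M. \<forall>m\<ge>M. \<forall>n\<ge>M. dist (D m y h) (D n y h) < \<delta>" by blast
      qed
      then show ?thesis unfolding A_def by (simp add: Cauchy_convergent_iff convergent_LIMSEQ_iff)
    qed
    have DA: "norm (D n y h - A y h) \<le> e n * norm h / (1 - \<rho>)" if y: "norm y \<le> \<rho>" for n y h
    proof (rule LIMSEQ_le[OF _ _ exI[of _ 0]])
      show "(\<lambda>m. norm (D n y h - D m y h)) \<longlonglongrightarrow> norm (D n y h - A y h)"
        by (intro tendsto_intros Dlim y)
      have "(\<lambda>m. (e n + e m) * norm h / (1 - \<rho>)) \<longlonglongrightarrow> (e n + 0) * norm h / (1 - \<rho>)"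
        using \<rho>(2) by (intro tendsto_intros e) auto
      then show "(\<lambda>m. (e n + e m) * norm h / (1 - \<rho>)) \<longlonglongrightarrow> e n * norm h / (1 - \<rho>)" by simp
    qed (simp add: Dd[OF y])
    have "\<exists>g. \<forall>y\<in>ball 0 \<rho>. (\<lambda>n. p n y) \<longlonglongrightarrow> g y \<and> (g has_derivative A y) (at y within ball 0 \<rho>)"
    proof (rule has_derivative_sequence)
      show "(p n has_derivative D n y) (at y within ball 0 \<rho>)" for n y
        using p[of n] unfolding entire_with_def by (blast intro: has_derivative_at_withinI)
      show "\<forall>\<^sub>F n in sequentially. \<forall>y\<in>ball 0 \<rho>. \<forall>h. norm (D n y h - A y h) \<le> \<delta> * norm h" if "\<delta> > 0" for \<delta>
      proof -
        have "\<delta> * (1 - \<rho>) > 0" using that \<rho>(2) by simp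
        then obtain N where N: "\<And>n. n \<ge> N \<Longrightarrow> e n < \<delta> * (1 - \<rho>)" using small by blast
        have "norm (D n y h - A y h) \<le> \<delta> * norm h" if "n \<ge> N" "y \<in> ball 0 \<rho>" for n y h
        proof -
          have "norm (D n y h - A y h) \<le> e n * norm h / (1 - \<rho>)" using DA that by simp
          also have "\<dots> \<le> (\<delta> * (1 - \<rho>)) * norm h / (1 - \<rho>)"
            using N[OF that(1)] \<rho>(2) by (intro divide_right_mono mult_right_mono) auto
          finally show ?thesis using \<rho>(2) by simp
        qed
        then show ?thesis unfolding eventually_sequentially by blast
      qed
      show "x \<in> ball 0 \<rho>" using \<rho> by simp
      show "(\<lambda>n. p n x) \<longlonglongrightarrow> G x" using lim x by simp
    qed (rule convex_ball)
    then obtain g where g: "\<And>y. y \<in> ball 0 \<rho> \<Longrightarrow> (\<lambda>n. p n y) \<longlonglongrightarrow> g y"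
      "\<And>y. y \<in> ball 0 \<rho> \<Longrightarrow> (g has_derivative A y) (at y within ball 0 \<rho>)" by blast
    have xb: "x \<in> ball 0 \<rho>" using \<rho> by simp
    have "(g has_derivative A x) (at x)" using g(2)[OF xb] at_within_open[OF xb open_ball] by simp
    moreover have "g y = G y" if "y \<in> ball 0 \<rho>" for y
      using LIMSEQ_unique[OF g(1)[OF that] lim[of y]] that \<rho>(2) by simp
    ultimately have "(G has_derivative A x) (at x)"
      by (rule has_derivative_transform_within_open[OF _ open_ball xb]) auto
    moreover have "A x (c *s v) = c * A x v" for c v
    proof (rule LIMSEQ_unique)
      show "(\<lambda>n. D n x (c *s v)) \<longlonglongrightarrow> A x (c *s v)" using Dlim \<rho>(1) by simp
      have "(\<lambda>n. c * D n x v) \<longlonglongrightarrow> c * A x v" using Dlim \<rho>(1) by (intro tendsto_intros) simp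
      then show "(\<lambda>n. D n x (c *s v)) \<longlonglongrightarrow> c * A x v" using p unfolding entire_with_def by simp
    qed
    ultimately show ?thesis by blast
  qed
  then show ?thesis
    unfolding extends_holomorphically_through_ball_def vec_holomorphic_on_def
    using cont bdry by (intro exI[of _ G]) auto
qed

lemma polynomial_limit_extends:
  assumes "\<And>\<epsilon>. \<epsilon> > 0 \<Longrightarrow> \<exists>c N. \<forall>x. norm x = 1 \<longrightarrow>
      norm (f x - (\<Sum>i\<le>(N::nat). \<Sum>j\<le>N. c i j * ((x $ 1) ^ i * (x $ 2) ^ j))) \<le> \<epsilon>"
  shows "extends_holomorphically_through_ball f"
proof -
  have "\<exists>p D. entire_with p D \<and> (\<forall>x. norm x = 1 \<longrightarrow> norm (f x - p x) \<le> inverse (real (Suc n)))" for n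
  proof -
    obtain c N where c: "\<forall>x. norm x = 1 \<longrightarrow>
      norm (f x - (\<Sum>i\<le>(N::nat). \<Sum>j\<le>N. c i j * ((x $ 1) ^ i * (x $ 2) ^ j))) \<le> inverse (real (Suc n))"
      using assms[of "inverse (real (Suc n))"] by auto
    have "\<exists>D. entire_with (\<lambda>x. \<Sum>i\<le>N. \<Sum>j\<le>N. c i j * ((x $ 1) ^ i * (x $ 2) ^ j)) D"
      by (intro entire_with_sum entire_with_monomial finite_atMost)
    then show ?thesis using c by blast
  qed
  then obtain p D where "\<And>n. entire_with (p n) (D n)" "\<And>n x. norm x = 1 \<Longrightarrow> norm (f x - p n x) \<le> inverse (real (Suc n))"
    by metis
  then show ?thesis using sphere_limit_extends[OF _ LIMSEQ_inverse_real_of_nat] by blast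
qed

text \<open>
  The exact extension \<open>g\<close>, in the parameter \<open>t\<close>, serves for every \<open>\<epsilon>\<close>.
\<close>

lemma extends_along_pencil_ext:
  assumes ext: "\<And>L. L \<in> lines_through a \<Longrightarrow> extends_holomorphically_along f L"
  shows "pencil_ext (\<lambda>x. f (vector [fst x, snd x])) (to_pair a)"
  unfolding pencil_ext_def
proof (intro allI impI)
  fix v :: "complex \<times> complex" assume v: "v \<noteq> 0"
  define u :: "complex ^ 2" where "u = vector [fst v, snd v]"
  have u: "u \<noteq> 0" using v by (auto simp: u_def vec_eq_iff forall_2 prod_eq_iff)
  have "line_at a u \<in> lines_through a"
    unfolding lines_through_def complex_line_def using u by (auto simp: line_at_def intro: range_eqI[of _ _ 0])
  then obtain g where g: "continuous_on (line_at a u \<inter> cball 0 1) g" "line_holomorphic_on g (line_at a u) (ball 0 1)"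
    "\<And>z. z \<in> line_at a u \<inter> sphere 0 1 \<Longrightarrow> g z = f z"
    using ext unfolding extends_holomorphically_along_def by blast
  have pt: "line_pt (to_pair a) v t = to_pair (a + t *s u)" for t
    by (simp add: line_pt_def to_pair_def u_def)
  have inverse: "vector [fst (to_pair y), snd (to_pair y)] = y" for y :: "complex ^ 2"
    by (simp add: to_pair_def vec_eq_iff forall_2)
  show "line_ext (\<lambda>x. f (vector [fst x, snd x])) (to_pair a) v"
    unfolding line_ext_def pt norm_to_pair inverse
  proof (intro allI impI exI[of _ "\<lambda>t. g (a + t *s u)"] conjI)
    have "linear (\<lambda>t::complex. t *s u)"
      by (rule linearI) (simp_all add: vec_eq_iff distrib_right)
    then have "continuous_on S (\<lambda>t. a + t *s u)" for S
      by (intro continuous_intros linear_continuous_on linear_conv_bounded_linear[THEN iffD1])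
    then show "continuous_on {t. norm (a + t *s u) \<le> 1} (\<lambda>t. g (a + t *s u))"
      by (rule continuous_on_compose2[OF g(1)]) (auto simp: line_at_def)
    show "(\<lambda>t. g (a + t *s u)) holomorphic_on {t. norm (a + t *s u) < 1}"
      using g(2) u unfolding line_holomorphic_on_def by auto
    show "norm (f (a + t *s u) - g (a + t *s u)) \<le> \<epsilon>" if "\<epsilon> > 0" "norm (a + t *s u) = 1" for \<epsilon> t
    proof -
      have "a + t *s u \<in> line_at a u \<inter> sphere 0 1" using that(2) by (auto simp: line_at_def)
      from g(3)[OF this] that(1) show ?thesis by simp
    qed
  qed
qed

lemma pair_function_continuous:
  assumes "continuous_on (sphere 0 1) f"
  shows "continuous_on (sphere 0 1) (\<lambda>x. f (vector [fst x, snd x] :: complex ^ 2))"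
proof (rule continuous_on_compose2[OF assms])
  have eq: "(\<lambda>x :: complex \<times> complex. vector [fst x, snd x] :: complex ^ 2) = (\<lambda>x. \<chi> i. if i = 1 then fst x else snd x)"
    by (simp add: fun_eq_iff vec_eq_iff forall_2)
  have "continuous_on (sphere 0 1) (\<lambda>x :: complex \<times> complex. if i = (1 :: 2) then fst x else snd x)" for i
    by (cases "i = 1") (auto intro!: continuous_intros)
  then show "continuous_on (sphere 0 1) (\<lambda>x :: complex \<times> complex. vector [fst x, snd x] :: complex ^ 2)"
    unfolding eq by (rule continuous_on_vec_lambda)
  have "norm (vector [fst x, snd x] :: complex ^ 2) = norm x" for x :: "complex \<times> complex"
    by (simp add: norm_prod_def norm_vec_def L2_set_def sum_2)
  then show "(\<lambda>x :: complex \<times> complex. vector [fst x, snd x] :: complex ^ 2) ` sphere 0 1 \<subseteq> sphere 0 1" by auto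
qed

text \<open>
  The hypotheses enter through four facts: the determinant \<open>cdet\<close> of the three points is nonzero, the
  line through \<open>a\<close> and \<open>b\<close> has a point in the ball, \<open>\<langle>a|b\<rangle> \<noteq> 1\<close>, and one of \<open>\<langle>a|c\<rangle>\<close>, \<open>\<langle>b|c\<rangle>\<close> differs
  from \<open>1\<close>.  If \<open>\<langle>a|b\<rangle> = 1\<close>, then \<open>line_meets_ball_gram\<close> would place one of the points \<open>a\<close>, \<open>b\<close> in the ball and
  the other one outside its closure, and this is the case in which \<open>\<langle>a|b\<rangle> \<noteq> 1\<close> is assumed.
\<close>

theorem corollary1p3:
  fixes a b c :: "complex ^ 2"
  assumes "\<not> (\<exists>L. complex_line L \<and> a \<in> L \<and> b \<in> L \<and> c \<in> L)"
    and "line_join a b \<inter> ball 0 1 \<noteq> {}"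
    and "(a \<in> ball 0 1 \<and> b \<notin> cball 0 1) \<or> (b \<in> ball 0 1 \<and> a \<notin> cball 0 1)
           \<Longrightarrow> hermitian_inner a b \<noteq> 1"
    and "hermitian_inner a c \<noteq> 1 \<or> hermitian_inner b c \<noteq> 1"
  shows "holomorphic_test_family (lines_through a \<union> lines_through b \<union> lines_through c)"
  unfolding holomorphic_test_family_def
proof (intro allI impI, elim conjE)
  fix f assume f: "continuous_on (sphere 0 1) f"
    and ext: "\<forall>L\<in>lines_through a \<union> lines_through b \<union> lines_through c. extends_holomorphically_along f L"
  define F where "F x = f (vector [fst x, snd x])" for x :: "complex \<times> complex"
  have F: "continuous_on (sphere 0 1) F" unfolding F_def by (rule pair_function_continuous[OF f])
  have pencils: "pencil_ext F (to_pair a)" "pencil_ext F (to_pair b)" "pencil_ext F (to_pair c)"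
    unfolding F_def by (rule extends_along_pencil_ext, use ext in blast)+
  have herm_eq: "herm (to_pair x) (to_pair y) = hermitian_inner x y" for x y
    by (simp add: herm_def hermitian_inner_def to_pair_def)
  obtain \<tau> where "a + \<tau> *s (b - a) \<in> ball 0 1"
    using assms(2) by (auto simp: line_join_def line_at_def)
  moreover have "to_pair (a + \<tau> *s (b - a)) = line_pt (to_pair a) (to_pair b - to_pair a) \<tau>"
    by (simp add: to_pair_def line_pt_def right_diff_distrib)
  ultimately have meet: "norm (line_pt (to_pair a) (to_pair b - to_pair a) \<tau>) < 1"
    by (metis mem_ball_0 norm_to_pair)
  have ind: "cdet (to_pair b - to_pair a) (to_pair c - to_pair a) \<noteq> 0"
  proof
    assume "cdet (to_pair b - to_pair a) (to_pair c - to_pair a) = 0"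
    then have det: "(b $ 1 - a $ 1) * (c $ 2 - a $ 2) = (b $ 2 - a $ 2) * (c $ 1 - a $ 1)"
      by (simp add: cdet_def to_pair_def)
    have on_line: "\<exists>L. complex_line L \<and> a \<in> L \<and> b \<in> L \<and> c \<in> L"
      if v: "v \<noteq> 0" and "b = a + s *s v" "c = a + t *s v" for v s t
    proof (intro exI conjI)
      show "complex_line (line_at a v)" using v by (auto simp: complex_line_def)
      show "a \<in> line_at a v" unfolding line_at_def by (rule range_eqI[of _ _ 0]) simp
    qed (use that in \<open>auto simp: line_at_def\<close>)
    have "\<exists>v s t. v \<noteq> 0 \<and> b = a + s *s v \<and> c = a + t *s v"
    proof (cases "b = a")
      case True
      show ?thesis
      proof (cases "c = a")
        case True
        then show ?thesis using \<open>b = a\<close>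
          by (intro exI[of _ "vector [1, 0]"] exI[of _ 0]) (auto simp: vec_eq_iff forall_2)
      next
        case False
        then show ?thesis using True
          by (intro exI[of _ "c - a"] exI[of _ 0] exI[of _ 1]) (auto simp: vec_eq_iff)
      qed
    next
      case False
      have solve: "y = p + m / d * n" if "d \<noteq> 0" "d * (y - p) = n * m" for y p m d n :: complex
      proof -
        have "m / d * n = d * (y - p) / d" using that(2) by (simp add: mult.commute)
        then show ?thesis using that(1) by simp
      qed
      have param: "\<exists>t. c = a + t *s (b - a)"
        if "d \<noteq> 0" "d * (c $ 1 - a $ 1) = (b $ 1 - a $ 1) * m" "d * (c $ 2 - a $ 2) = (b $ 2 - a $ 2) * m" for d m
        using solve[OF that(1,2)] solve[OF that(1,3)]
        unfolding vec_eq_iff forall_2 vector_add_component vector_smult_component vector_minus_component by blast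
      have "\<exists>t. c = a + t *s (b - a)" if "b $ 1 \<noteq> a $ 1"
        using det that by (intro param[of "b $ 1 - a $ 1" "c $ 1 - a $ 1"]) auto
      moreover have "\<exists>t. c = a + t *s (b - a)" if "b $ 2 \<noteq> a $ 2"
        using det that by (intro param[of "b $ 2 - a $ 2" "c $ 2 - a $ 2"]) auto
      moreover have "b $ 1 \<noteq> a $ 1 \<or> b $ 2 \<noteq> a $ 2" using False by (auto simp: vec_eq_iff forall_2)
      ultimately obtain t where "c = a + t *s (b - a)" by blast
      moreover have "b = a + 1 *s (b - a)" by simp
      moreover have "b - a \<noteq> 0" using False by simp
      ultimately show ?thesis by blast
    qed
    then show False using on_line assms(1) by blast
  qed
  have ab: "herm (to_pair a) (to_pair b) \<noteq> 1"
  proof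
    assume h: "herm (to_pair a) (to_pair b) = 1"
    have "to_pair a \<noteq> to_pair b" using ind by (auto simp: cdet_def)
    from line_meets_ball_gram[OF this meet] have neg: "(1 - (norm a)\<^sup>2) * (1 - (norm b)\<^sup>2) < 0"
      by (simp add: h)
    have "norm a < 1 \<and> norm b > 1 \<or> norm b < 1 \<and> norm a > 1"
    proof -
      have sq: "0 < 1 - (norm y)\<^sup>2 \<longleftrightarrow> norm y < 1" "1 - (norm y)\<^sup>2 < 0 \<longleftrightarrow> norm y > 1" for y :: "complex ^ 2"
        using abs_square_less_1[of "norm y"] abs_square_le_1[of "norm y"] by auto
      show ?thesis using neg unfolding mult_less_0_iff sq by blast
    qed
    then show False using assms(3) h by (auto simp: herm_eq)
  qed
  have ac_bc: "herm (to_pair a) (to_pair c) \<noteq> 1 \<or> herm (to_pair b) (to_pair c) \<noteq> 1"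
    using assms(4) by (simp add: herm_eq)
  show "extends_holomorphically_through_ball f"
  proof (rule polynomial_limit_extends)
    fix \<epsilon> :: real assume "\<epsilon> > 0"
    from sphere_polynomial_approx[OF F three_pencils_everywhere[OF F pencils meet ab ind ac_bc] this]
    obtain C N where C: "\<And>z w. (z, w) \<in> sphere 0 1 \<Longrightarrow>
        norm (F (z, w) - (\<Sum>i\<le>(N::nat). \<Sum>j\<le>N. C i j * (z ^ i * w ^ j))) \<le> \<epsilon>" by blast
    have "norm (f x - (\<Sum>i\<le>N. \<Sum>j\<le>N. C i j * ((x $ 1) ^ i * (x $ 2) ^ j))) \<le> \<epsilon>" if "norm x = 1" for x
    proof -
      have "(x $ 1, x $ 2) \<in> sphere 0 1" using that norm_to_pair[of x] by (simp add: to_pair_def)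
      moreover have "F (x $ 1, x $ 2) = f x"
        unfolding F_def by (rule arg_cong[of _ _ f]) (simp add: vec_eq_iff forall_2)
      ultimately show ?thesis using C by fastforce
    qed
    then show "\<exists>c N. \<forall>x. norm x = 1 \<longrightarrow>
        norm (f x - (\<Sum>i\<le>(N::nat). \<Sum>j\<le>N. c i j * ((x $ 1) ^ i * (x $ 2) ^ j))) \<le> \<epsilon>" by blast
  qed
qed

end
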